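(* Let $g$ be a (complex-valued) rrl-continuable function. Then one of the following holds: (i) either there is an arc of the unit circle through which $g$ admits analytic continuation; then $g$ is uniquely rrl-continuable, and all the analytic continuations of $g$ through arcs of the unit circle match and coincide with the rrl-continuation of $g$; (ii) or the unit circle is a strong natural boundary for $g$. Moreover, if $g$ is polygenous, then the unit circle is a strong natural boundary for $g$.
   Context: Notation: $\mathbb D=\{z\in\mathbb C: |z|<1\}$, $\mathbb E=\{z\in\mathbb C:|z|>1\}\cup\{\infty\}\subset\widehat{\mathbb C}$. Right limits: a right limit of a bounded sequence $(a_k)_{k\ge0}$ of complex numbers is a two-sided sequence $(b_n)_{n\in\mathbb Z}$ for which there is a strictly increasing sequence of positive integers $(k_j)_{j\ge1}$ with $\lim_{j\to\infty}a_{n+k_j}=b_n$ for every $n\in\mathbb Z$. It is renascent if $b_n=a_n$ for all $n\ge0$. rrl-continuation: a holomorphic function $g(z)=\sum_{k\ge0}a_kz^k$ on $\mathbb D$ with bounded $(a_k)$ is rrl-continuable if $(a_k)$ has a renascent right limit $(b_n)_{n\in\mathbb Z}$; then the function $z\mapsto-\sum_{n<0}b_nz^n$ on $\mathbb E$ is called an rrl-continuation of $g$. It is uniquely rrl-continuable if it has exactly one rrl-continuation, and polygenous if it is rrl-continuable with more than one rrl-continuation. Analytic continuation through an arc: $g$ admits analytic continuation through a nonempty open arc $J$ of the unit circle if there are an open neighbourhood $U$ of $J$ in $\mathbb C$ and a holomorphic function $h_J$ on $U$ with $h_J=g$ on $U\cap\mathbb D$. Saying that this continuation coincides with a function $h$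 on $\mathbb E$ means that $h_J=h$ on $U'\cap\mathbb E$ for some open neighbourhood $U'\subset U$ of $J$. Strong natural boundary: the unit circle is a strong natural boundary for a holomorphic function $g$ on $\mathbb D$ if, for every nonempty open interval $(\omega_1,\omega_2)$, $\sup_{0<r<1}\int_{\omega_1}^{\omega_2}|g(re^{i\omega})|\,d\omega=\infty$. *)

theory Defs
  imports "HOL-Complex_Analysis.Complex_Analysis"
begin

text \<open>
  Points of the Riemann sphere are elements of \<open>complex option\<close>, with \<open>None\<close> the point at infinity
  (as in \<open>Alexandroff_compactification\<close>). Functions on the exterior E of the closed unit disk are
  taken extensional, so that equality of such functions is equality on E.
\<close>

definition exterior_disk :: "complex option set" where
  "exterior_disk = insert None (Some ` {z. norm z > 1})"

text \<open>
  The truncation in \<open>nat (n + int (k j))\<close> only concerns finitely many \<open>j\<close> for each \<open>n\<close>, because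
  \<open>k\<close> is strictly increasing.
\<close>

definition right_limit :: "(nat \<Rightarrow> complex) \<Rightarrow> (int \<Rightarrow> complex) \<Rightarrow> bool" where
  "right_limit a b \<longleftrightarrow>
     (\<exists>k::nat \<Rightarrow> nat. strict_mono k \<and> (\<forall>j. 0 < k j) \<and>
        (\<forall>n. (\<lambda>j. a (nat (n + int (k j)))) \<longlonglongrightarrow> b n))"

definition renascent_right_limit :: "(nat \<Rightarrow> complex) \<Rightarrow> (int \<Rightarrow> complex) \<Rightarrow> bool" where
  "renascent_right_limit a b \<longleftrightarrow> right_limit a b \<and> (\<forall>n. b (int n) = a n)"

definition bounded_power_series :: "(complex \<Rightarrow> complex) \<Rightarrow> (nat \<Rightarrow> complex) \<Rightarrow> bool" where
  "bounded_power_series g a \<longleftrightarrow>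
     g holomorphic_on ball 0 1 \<and> bounded (range a) \<and>
     (\<forall>z\<in>ball 0 1. (\<lambda>k. a k * z ^ k) sums g z)"

text \<open>All exponents in the series are negative, so its value at infinity is \<open>0\<close>.\<close>

definition exterior_function :: "(int \<Rightarrow> complex) \<Rightarrow> complex option \<Rightarrow> complex" where
  "exterior_function b =
     (\<lambda>w\<in>exterior_disk. case w of None \<Rightarrow> 0 | Some z \<Rightarrow> - (\<Sum>\<^sub>\<infinity>n\<in>{..<0}. b n * z powi n))"

definition rrl_continuations :: "(complex \<Rightarrow> complex) \<Rightarrow> (complex option \<Rightarrow> complex) set" where
  "rrl_continuations g =
     {exterior_function b | a b. bounded_power_series g a \<and> renascent_right_limit a b}"

definition rrl_continuable :: "(complex \<Rightarrow> complex) \<Rightarrow> bool" where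
  "rrl_continuable g \<longleftrightarrow> (\<exists>a b. bounded_power_series g a \<and> renascent_right_limit a b)"

definition uniquely_rrl_continuable :: "(complex \<Rightarrow> complex) \<Rightarrow> bool" where
  "uniquely_rrl_continuable g \<longleftrightarrow> rrl_continuable g \<and> (\<exists>!h. h \<in> rrl_continuations g)"

definition polygenous :: "(complex \<Rightarrow> complex) \<Rightarrow> bool" where
  "polygenous g \<longleftrightarrow> rrl_continuable g \<and>
     (\<exists>h1\<in>rrl_continuations g. \<exists>h2\<in>rrl_continuations g. h1 \<noteq> h2)"

definition open_arc :: "complex set \<Rightarrow> bool" where
  "open_arc J \<longleftrightarrow> (\<exists>\<omega>1 \<omega>2. \<omega>1 < \<omega>2 \<and> J = cis ` {\<omega>1<..<\<omega>2})"

definition analytic_continuation_through ::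
    "(complex \<Rightarrow> complex) \<Rightarrow> complex set \<Rightarrow> complex set \<Rightarrow> (complex \<Rightarrow> complex) \<Rightarrow> bool" where
  "analytic_continuation_through g J U f \<longleftrightarrow>
     open_arc J \<and> open U \<and> J \<subseteq> U \<and> f holomorphic_on U \<and> (\<forall>z\<in>U \<inter> ball 0 1. f z = g z)"

definition continuation_coincides ::
    "complex set \<Rightarrow> complex set \<Rightarrow> (complex \<Rightarrow> complex) \<Rightarrow> (complex option \<Rightarrow> complex) \<Rightarrow> bool" where
  "continuation_coincides J U f h \<longleftrightarrow>
     (\<exists>V. open V \<and> J \<subseteq> V \<and> V \<subseteq> U \<and> (\<forall>z\<in>V. Some z \<in> exterior_disk \<longrightarrow> f z = h (Some z)))"

text \<open>
  The domains of two continuations may be arbitrarily large and may overlap far from the arcs, so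
  the functions can only be expected to agree after shrinking the domains around the arcs.
\<close>

definition continuations_match ::
    "complex set \<Rightarrow> complex set \<Rightarrow> (complex \<Rightarrow> complex) \<Rightarrow>
     complex set \<Rightarrow> complex set \<Rightarrow> (complex \<Rightarrow> complex) \<Rightarrow> bool" where
  "continuations_match J1 U1 f1 J2 U2 f2 \<longleftrightarrow>
     (\<exists>V1 V2. open V1 \<and> J1 \<subseteq> V1 \<and> V1 \<subseteq> U1 \<and> open V2 \<and> J2 \<subseteq> V2 \<and> V2 \<subseteq> U2 \<and>
        (\<forall>z\<in>V1 \<inter> V2. f1 z = f2 z))"

definition strong_natural_boundary :: "(complex \<Rightarrow> complex) \<Rightarrow> bool" where
  "strong_natural_boundary g \<longleftrightarrow>
     (\<forall>\<omega>1 \<omega>2::real. \<omega>1 < \<omega>2 \<longrightarrow>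
        (SUP r\<in>{0<..<1}. \<integral>\<^sup>+\<omega>\<in>{\<omega>1<..<\<omega>2}. ennreal (norm (g (rcis r \<omega>))) \<partial>lborel) = \<infinity>)"

end

theory Submission
  imports Defs "HOL-Computational_Algebra.Fundamental_Theorem_Algebra"
begin

text \<open>
  If \<open>g\<close> is bounded in \<open>L\<^sup>1\<close> along an arc, multiply its boundary distribution by a smooth cut-off
  \<open>\<phi>\<close> supported in the arc. The product has rapidly decaying negative Fourier coefficients, so up to
  a bounded function it is in \<open>H\<^sup>1\<close>, and its Fourier coefficients tend to \<open>0\<close>: an \<open>H\<^sup>1\<close> function is a
  product of two \<open>H\<^sup>2\<close> functions. Shifting along the sequence that defines a right limit \<open>b\<close>, these
  coefficients converge to those of \<open>\<phi>\<close> times the distribution \<open>B(\<theta>) = \<Sum> b\<^sub>n e\<^bsup>in\<theta>\<^esup>\<close>, so \<open>B\<close> vanishes on the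
  arc. Pairing \<open>B\<close> with the Cauchy kernel \<open>1 / (1 - z e\<^bsup>-i\<theta>\<^esup>)\<close> gives \<open>\<Sum> b\<^sub>n z\<^sup>n\<close> over \<open>n \<ge> 0\<close> inside the disk
  and \<open>- \<Sum> b\<^sub>n z\<^sup>n\<close> over \<open>n < 0\<close> outside. The kernel may be cut off near the arc without changing the
  pairing, which then is holomorphic across the arc. So every renascent right limit provides the
  continuation of \<open>g\<close>, and conversely a continuation through an arc bounds \<open>g\<close> locally. The rest is
  the identity theorem.
\<close>

section \<open>Absolutely convergent trigonometric series\<close>

text \<open>In the limit, an \<open>L\<^sup>1\<close> bound on circles gives only a measure on the
  arc, and Fourier coefficients of a measure need not tend to 0. Analyticity has to enter, as in the
  theorem of F. and M. Riesz. Here it does so without boundary values: g is seen only on circles of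
  radius r < 1, where its series converges absolutely, all bounds are uniform in r, and r -> 1 is
  taken coefficient by coefficient. The factorization is therefore wanted for polynomials only,
  where it is an induction over the roots. Two demands fix the smoothness of the cut-off. Fourth
  order decay of its coefficients splits, in the negative coefficients of the product, into a
  summable factor in each of two indices. And since \<open>b\<close> is merely bounded, a test
  function is paired with \<open>B\<close> through summable coefficients, which two derivatives of
  the cut-off kernel supply, uniformly in z near the centre of the arc. Hence class C^4, which
  powers of a positive part reach explicitly.\<close>

lemma infsum_dominated_limit:
  fixes f :: "nat \<Rightarrow> 'i \<Rightarrow> complex"
  assumes lim: "\<And>i. i \<in> A \<Longrightarrow> (\<lambda>k. f k i) \<longlonglongrightarrow> g i"
    and bound: "\<And>k i. i \<in> A \<Longrightarrow> norm (f k i) \<le> M i" and "M summable_on A"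
  shows "(\<lambda>k. \<Sum>\<^sub>\<infinity>i\<in>A. f k i) \<longlonglongrightarrow> (\<Sum>\<^sub>\<infinity>i\<in>A. g i)"
proof (rule tendstoI)
  fix e :: real assume e: "0 < e"
  have gM: "norm (g i) \<le> M i" if "i \<in> A" for i
    by (rule Lim_norm_ubound[OF _ lim[OF that]]) (auto simp: bound that)
  \<comment> \<open>The M-test gives one finite \<open>X\<close> that serves every \<open>k\<close>
    simultaneously; what remains is the convergence of a finite sum.\<close>
  have u1: "uniform_limit UNIV (\<lambda>X k. \<Sum>i\<in>X. f k i) (\<lambda>k. \<Sum>\<^sub>\<infinity>i\<in>A. f k i) (finite_subsets_at_top A)"
    by (rule Weierstrass_m_test_general[where M = M]) (use bound assms(3) in auto)
  \<comment> \<open>A one-point parameter space lets the same test handle the limit sum.\<close>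
  have u2: "uniform_limit (UNIV :: unit set) (\<lambda>X k. \<Sum>i\<in>X. g i) (\<lambda>k. \<Sum>\<^sub>\<infinity>i\<in>A. g i) (finite_subsets_at_top A)"
    by (rule Weierstrass_m_test_general[where M = M]) (use gM assms(3) in auto)
  have fin: "\<forall>\<^sub>F X in finite_subsets_at_top A. finite X \<and> X \<subseteq> A"
    by (intro eventually_finite_subsets_at_top_weakI) auto
  have "\<forall>\<^sub>F X in finite_subsets_at_top A. (finite X \<and> X \<subseteq> A) \<and>
      (\<forall>k\<in>UNIV. dist (\<Sum>i\<in>X. f k i) (\<Sum>\<^sub>\<infinity>i\<in>A. f k i) < e/3) \<and>
      (\<forall>k\<in>(UNIV :: unit set). dist (\<Sum>i\<in>X. g i) (\<Sum>\<^sub>\<infinity>i\<in>A. g i) < e/3)"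
    using e by (intro eventually_conj fin uniform_limitD[OF u1] uniform_limitD[OF u2]) auto
  from eventually_happens'[OF finite_subsets_at_top_neq_bot this] obtain X where X: "finite X" "X \<subseteq> A"
      "\<And>k. dist (\<Sum>i\<in>X. f k i) (\<Sum>\<^sub>\<infinity>i\<in>A. f k i) < e/3"
      "dist (\<Sum>i\<in>X. g i) (\<Sum>\<^sub>\<infinity>i\<in>A. g i) < e/3"
    by auto
  have "(\<lambda>k. \<Sum>i\<in>X. f k i) \<longlonglongrightarrow> (\<Sum>i\<in>X. g i)"
    using X lim by (intro tendsto_sum) auto
  then have "\<forall>\<^sub>F k in sequentially. dist (\<Sum>i\<in>X. f k i) (\<Sum>i\<in>X. g i) < e/3"
    using e by (intro tendstoD) auto
  then show "\<forall>\<^sub>F k in sequentially. dist (\<Sum>\<^sub>\<infinity>i\<in>A. f k i) (\<Sum>\<^sub>\<infinity>i\<in>A. g i) < e"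
  proof eventually_elim
    case (elim k)
    then show ?case using X(3)[of k] X(4) by (simp add: dist_norm) norm
  qed
qed

lemma has_integral_cis:
  fixes m :: int
  shows "((\<lambda>\<theta>. cis (of_int m * \<theta>)) has_integral (if m = 0 then 2 * pi else 0)) {s..s + 2*pi}"
proof (cases "m = 0")
  case True
  have "((\<lambda>\<theta>::real. 1::complex) has_integral complex_of_real (2*pi)) {s..s + 2*pi}"
    using has_integral_const_real[of "1::complex" s "s+2*pi"] by (simp add: scaleR_conv_of_real)
  then show ?thesis using True by simp
next
  case False
  have "((\<lambda>\<theta>. cis (of_int m * \<theta>)) has_integral
      (cis (of_int m * (s + 2*pi)) / (\<i> * of_int m) - cis (of_int m * s) / (\<i> * of_int m))) {s..s + 2*pi}"
  proof (rule fundamental_theorem_of_calculus)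
    fix x assume "x \<in> {s..s+2*pi}"
    have "((\<lambda>\<theta>. exp (\<i> * of_int m * \<theta>) / (\<i> * of_int m)) has_field_derivative exp (\<i> * of_int m * of_real x)) (at (of_real x))"
      using False by (auto intro!: derivative_eq_intros)
    from has_vector_derivative_real_field[OF this]
    show "((\<lambda>\<theta>. cis (of_int m * \<theta>) / (\<i> * of_int m)) has_vector_derivative cis (of_int m * x)) (at x within {s..s+2*pi})"
      by (simp add: cis_conv_exp mult_ac)
  qed auto
  moreover have "cis (of_int m * (s + 2*pi)) = cis (of_int m * s)"
    by (simp add: distrib_left cis_mult[symmetric] mult.commute) (metis cis_multiple_2pi Ints_of_int mult.assoc mult.commute mult.right_neutral)
  ultimately show ?thesis using False by simp
qed

section \<open>Fourier coefficients of absolutely convergent series\<close>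

definition trig_series :: "(int \<Rightarrow> complex) \<Rightarrow> real \<Rightarrow> complex" where
  "trig_series c \<theta> = (\<Sum>\<^sub>\<infinity>n. c n * cis (of_int n * \<theta>))"

text \<open>The period window starts at an arbitrary \<open>s\<close>, so that it can later be
  centred at the midpoint of the arc.\<close>

definition fourier_coeff :: "real \<Rightarrow> (real \<Rightarrow> complex) \<Rightarrow> int \<Rightarrow> complex" where
  "fourier_coeff s f m = integral {s..s + 2*pi} (\<lambda>\<theta>. f \<theta> * cis (- (of_int m * \<theta>))) / (2 * pi)"

lemma uniform_limit_trig_series:
  assumes "(\<lambda>n. norm (c n)) summable_on UNIV"
  shows "uniform_limit S (\<lambda>X \<theta>. \<Sum>n\<in>X. c n * cis (of_int n * \<theta>)) (trig_series c) (finite_subsets_at_top UNIV)"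
  using Weierstrass_m_test_general[where M = "\<lambda>n. norm (c n)" and f = "\<lambda>n \<theta>. c n * cis (of_int n * \<theta>)" and X = UNIV and Y = S] assms
  unfolding trig_series_def by (simp add: norm_mult)

lemma trig_series_has_sum:
  assumes "(\<lambda>n. norm (c n)) summable_on UNIV"
  shows "((\<lambda>n. c n * cis (of_int n * \<theta>)) has_sum trig_series c \<theta>) UNIV"
  unfolding trig_series_def
  by (rule has_sum_infsum, rule abs_summable_summable) (use assms in \<open>simp add: norm_mult\<close>)

lemma continuous_on_trig_series [continuous_intros]:
  assumes "(\<lambda>n. norm (c n)) summable_on UNIV"
  shows "continuous_on S (trig_series c)"
  by (rule uniform_limit_theorem[OF _ uniform_limit_trig_series[OF assms]])
     (auto intro!: continuous_intros always_eventually simp: finite_subsets_at_top_neq_bot)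

lemma has_sum_integral_trig_series:
  fixes a b :: real and f :: "real \<Rightarrow> complex"
  assumes c: "(\<lambda>n. norm (c n)) summable_on UNIV" and f: "continuous_on {a..b} f"
  shows "((\<lambda>n. c n * integral {a..b} (\<lambda>\<theta>. f \<theta> * cis (of_int n * \<theta>))) has_sum
           integral {a..b} (\<lambda>\<theta>. f \<theta> * trig_series c \<theta>)) UNIV"
proof -
  have bf: "bounded (f ` {a..b})" by (intro compact_imp_bounded compact_continuous_image f) auto
  have u: "uniform_limit {a..b} (\<lambda>X \<theta>. f \<theta> * (\<Sum>n\<in>X. c n * cis (of_int n * \<theta>))) (\<lambda>\<theta>. f \<theta> * trig_series c \<theta>) (finite_subsets_at_top UNIV)"
    by (intro uniform_lim_mult uniform_limit_const uniform_limit_trig_series c bf compact_imp_bounded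
          compact_continuous_image continuous_on_trig_series) auto
  have cX: "continuous_on {a..b} (\<lambda>\<theta>. f \<theta> * (\<Sum>n\<in>X. c n * cis (of_int n * \<theta>)))" for X
    by (intro continuous_intros f)
  obtain I J where IJ: "\<And>X. ((\<lambda>\<theta>. f \<theta> * (\<Sum>n\<in>X. c n * cis (of_int n * \<theta>))) has_integral I X) {a..b}"
     "((\<lambda>\<theta>. f \<theta> * trig_series c \<theta>) has_integral J) {a..b}" "(I \<longlongrightarrow> J) (finite_subsets_at_top UNIV)"
    using uniform_limit_integral[OF u cX finite_subsets_at_top_neq_bot] by blast
  have "I X = (\<Sum>n\<in>X. c n * integral {a..b} (\<lambda>\<theta>. f \<theta> * cis (of_int n * \<theta>)))" if "finite X" for X
  proof -
    have "I X = integral {a..b} (\<lambda>\<theta>. \<Sum>n\<in>X. c n * (f \<theta> * cis (of_int n * \<theta>)))"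
      using integral_unique[OF IJ(1)[of X]] by (simp add: sum_distrib_left mult_ac)
    also have "\<dots> = (\<Sum>n\<in>X. integral {a..b} (\<lambda>\<theta>. c n * (f \<theta> * cis (of_int n * \<theta>))))"
      using that by (intro integral_sum integrable_continuous_interval continuous_intros f)
    finally show ?thesis by simp
  qed
  then have "((\<lambda>X. \<Sum>n\<in>X. c n * integral {a..b} (\<lambda>\<theta>. f \<theta> * cis (of_int n * \<theta>))) \<longlongrightarrow> J) (finite_subsets_at_top UNIV)"
    by (intro Lim_transform_eventually[OF IJ(3)] eventually_finite_subsets_at_top_weakI) auto
  then show ?thesis using integral_unique[OF IJ(2)] by (simp add: has_sum_def)
qed

text \<open>Multiplication becomes convolution, by termwise integration of a uniformly convergent
  series. Only one factor has summable coefficients; the other, later the cut-off, is just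
  continuous.\<close>

lemma fourier_coeff_mult_trig_series:
  assumes c: "(\<lambda>n. norm (c n)) summable_on UNIV" and f: "continuous_on UNIV f"
  shows "((\<lambda>n. c n * fourier_coeff s f (m - n)) has_sum fourier_coeff s (\<lambda>\<theta>. f \<theta> * trig_series c \<theta>) m) UNIV"
proof -
  have f': "continuous_on {s..s+2*pi} (\<lambda>\<theta>. f \<theta> * cis (- (of_int m * \<theta>)))"
    by (intro continuous_intros continuous_on_subset[OF f]) auto
  from has_sum_cmult_left[OF has_sum_integral_trig_series[OF c f'], of "inverse (2*pi)"]
  show ?thesis
    unfolding fourier_coeff_def
    by (simp add: field_simps cis_mult)
qed

text \<open>Orthogonality, read off from the convolution formula for the constant 1, whose
  coefficients are a Kronecker delta.\<close>

lemma fourier_coeff_trig_series: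
  assumes c: "(\<lambda>n. norm (c n)) summable_on UNIV"
  shows "fourier_coeff s (trig_series c) m = c m"
proof -
  have fc1: "fourier_coeff s (\<lambda>_. 1) n = (if n = 0 then 1 else 0)" for n
    using integral_unique[OF has_integral_cis[of "-n" s]] unfolding fourier_coeff_def by simp
  have "((\<lambda>n. c n * (if m - n = 0 then 1 else 0)) has_sum fourier_coeff s (trig_series c) m) UNIV"
    using fourier_coeff_mult_trig_series[OF c, of "\<lambda>_. 1" s m] by (simp add: fc1)
  moreover have "((\<lambda>n. c n * (if m - n = 0 then 1 else 0)) has_sum c m) UNIV"
    by (rule has_sum_cong_neutral[THEN iffD1, OF _ _ _ has_sum_finite[of "{m}" "\<lambda>n. c n * (if m - n = 0 then 1 else 0)", simplified]]) auto
  ultimately show ?thesis by (rule has_sum_unique)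
qed


text \<open>Taylor coefficients viewed as Fourier coefficients on a circle: analyticity is the
  vanishing at negative frequencies.\<close>

definition nonneg_ext :: "(nat \<Rightarrow> complex) \<Rightarrow> int \<Rightarrow> complex" where
  "nonneg_ext a n = (if n \<ge> 0 then a (nat n) else 0)"

lemma has_sum_int_nonneg:
  fixes f :: "nat \<Rightarrow> 'a :: {comm_monoid_add, topological_space}"
  shows "((\<lambda>n::int. if n \<ge> 0 then f (nat n) else 0) has_sum S) UNIV \<longleftrightarrow> (f has_sum S) UNIV"
proof -
  have "((\<lambda>n::int. if n \<ge> 0 then f (nat n) else 0) has_sum S) UNIV \<longleftrightarrow> ((\<lambda>n. f (nat n)) has_sum S) (range int)"
  proof (rule has_sum_cong_neutral)
    fix x assume "x \<in> UNIV - range int"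
    then have "\<not> x \<ge> 0" by (metis DiffD2 nonneg_int_cases rangeI)
    then show "(if 0 \<le> x then f (nat x) else 0) = 0" by simp
  qed auto
  also have "\<dots> \<longleftrightarrow> (f has_sum S) UNIV"
    by (subst has_sum_reindex) (auto simp: o_def)
  finally show ?thesis .
qed

lemma summable_nonneg_ext:
  assumes "summable (\<lambda>n. norm (a n))"
  shows "(\<lambda>n. norm (nonneg_ext a n)) summable_on UNIV"
proof -
  have "(\<lambda>n. norm (a n)) summable_on UNIV"
    using assms by (simp add: summable_on_UNIV_nonneg_real_iff)
  then obtain S where "((\<lambda>n. norm (a n)) has_sum S) UNIV" by (auto simp: summable_on_def)
  from has_sum_int_nonneg[THEN iffD2, OF this] show ?thesis
    unfolding summable_on_def nonneg_ext_def by (auto simp: if_distrib[of norm] cong: if_cong intro!: exI[of _ S])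
qed

lemma trig_series_nonneg_ext:
  assumes "summable (\<lambda>n. norm (a n))"
  shows "(\<lambda>n. a n * cis (of_nat n * \<theta>)) sums trig_series (nonneg_ext a) \<theta>"
proof -
  have "((\<lambda>n::int. if n \<ge> 0 then a (nat n) * cis (of_nat (nat n) * \<theta>) else 0) has_sum trig_series (nonneg_ext a) \<theta>) UNIV"
    using trig_series_has_sum[OF summable_nonneg_ext[OF assms], of \<theta>]
    by (rule has_sum_cong[THEN iffD1, rotated]) (auto simp: nonneg_ext_def)
  then show ?thesis
    by (intro has_sum_imp_sums) (simp only: has_sum_int_nonneg[of "\<lambda>n. a n * cis (of_nat n * \<theta>)"])
qed

section \<open>A Riemann--Lebesgue lemma for Hardy space\<close>

text \<open>Expand the nonnegative integral of |u - S|^2 for the partial sum \<open>S\<close> over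
  \<open>X\<close>: the inner products of u and of S with S are both 2 pi E.\<close>

lemma trig_series_bessel:
  assumes c: "(\<lambda>n. norm (c n)) summable_on UNIV" and X: "finite X"
  shows "(\<Sum>n\<in>X. (norm (c n))\<^sup>2) \<le> integral {s..s + 2*pi} (\<lambda>\<theta>. (norm (trig_series c \<theta>))\<^sup>2) / (2*pi)"
proof -
  define u where "u = trig_series c"
  define S where "S \<theta> = (\<Sum>n\<in>X. c n * cis (of_int n * \<theta>))" for \<theta>
  define E where "E = (\<Sum>n\<in>X. (norm (c n))\<^sup>2)"
  let ?W = "{s..s + 2*pi}"
  have cu: "continuous_on T u" for T unfolding u_def by (intro continuous_intros c)
  have cS: "continuous_on T S" for T unfolding S_def by (intro continuous_intros)
  have "(\<lambda>n. norm (if n \<in> X then c n else 0)) summable_on UNIV"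
    by (rule summable_on_cong_neutral[THEN iffD1, OF _ _ _ summable_on_finite[OF X, of "\<lambda>n. norm (c n)"]]) auto
  moreover have "trig_series (\<lambda>n. if n \<in> X then c n else 0) = S"
  proof
    fix \<theta>
    have "trig_series (\<lambda>n. if n \<in> X then c n else 0) \<theta> = (\<Sum>\<^sub>\<infinity>n\<in>X. c n * cis (of_int n * \<theta>))"
      unfolding trig_series_def by (rule infsum_cong_neutral) auto
    then show "trig_series (\<lambda>n. if n \<in> X then c n else 0) \<theta> = S \<theta>" using X by (simp add: S_def)
  qed
  ultimately have fS: "fourier_coeff s S n = (if n \<in> X then c n else 0)" for n
    using fourier_coeff_trig_series[of "\<lambda>n. if n \<in> X then c n else 0"] by simp
  have fu: "fourier_coeff s u n = c n" for n
    unfolding u_def by (rule fourier_coeff_trig_series[OF c])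
  \<comment> \<open>Pairing with \<open>S\<close> sees only the coefficients in \<open>X\<close>,
    which \<open>u\<close> and \<open>S\<close> share.\<close>
  have ip: "integral ?W (\<lambda>\<theta>. f \<theta> * cnj (S \<theta>)) = 2 * pi * E"
    if f: "continuous_on ?W f" and "\<And>n. n \<in> X \<Longrightarrow> fourier_coeff s f n = c n" for f
  proof -
    have "integral ?W (\<lambda>\<theta>. f \<theta> * cnj (S \<theta>)) = integral ?W (\<lambda>\<theta>. \<Sum>n\<in>X. cnj (c n) * (f \<theta> * cis (- (of_int n * \<theta>))))"
      by (simp add: S_def sum_distrib_left cis_cnj mult_ac)
    also have "\<dots> = (\<Sum>n\<in>X. cnj (c n) * integral ?W (\<lambda>\<theta>. f \<theta> * cis (- (of_int n * \<theta>))))"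
      by (subst integral_sum) (auto intro!: X integrable_continuous_interval continuous_intros f)
    also have "\<dots> = (\<Sum>n\<in>X. cnj (c n) * (2 * pi * c n))"
      by (rule sum.cong) (use that(2) in \<open>auto simp: fourier_coeff_def field_simps\<close>)
    also have "\<dots> = 2 * pi * E"
      unfolding E_def by (simp add: sum_distrib_left complex_norm_square mult_ac del: of_real_power)
    finally show ?thesis .
  qed
  have iu: "integral ?W (\<lambda>\<theta>. u \<theta> * cnj (S \<theta>)) = 2 * pi * E"
    and iS: "integral ?W (\<lambda>\<theta>. S \<theta> * cnj (S \<theta>)) = 2 * pi * E"
    by (rule ip[OF cu fu], rule ip[OF cS]) (simp add: fS)
  have nn: "(norm (u \<theta> - S \<theta>))\<^sup>2 = (norm (u \<theta>))\<^sup>2 - 2 * Re (u \<theta> * cnj (S \<theta>)) + Re (S \<theta> * cnj (S \<theta>))" for \<theta>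
    unfolding cmod_power2 by (simp add: power2_eq_square algebra_simps)
  have Re_int: "integral ?W (\<lambda>\<theta>. Re (f \<theta>)) = Re (integral ?W f)" if "continuous_on ?W f" for f
    using integral_linear[OF integrable_continuous_interval[OF that] bounded_linear_Re] by (simp add: o_def)
  have "0 \<le> integral ?W (\<lambda>\<theta>. (norm (u \<theta> - S \<theta>))\<^sup>2)"
    by (intro integral_nonneg integrable_continuous_interval continuous_intros cu cS) auto
  also have "\<dots> = integral ?W (\<lambda>\<theta>. (norm (u \<theta>))\<^sup>2) - 2 * integral ?W (\<lambda>\<theta>. Re (u \<theta> * cnj (S \<theta>))) + integral ?W (\<lambda>\<theta>. Re (S \<theta> * cnj (S \<theta>)))"
    unfolding nn
    by (subst integral_add, (intro integrable_continuous_interval continuous_intros cu cS)+,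
        subst integral_diff, (intro integrable_continuous_interval continuous_intros cu cS)+)
       (simp only: integral_mult_right)
  also have "\<dots> = integral ?W (\<lambda>\<theta>. (norm (u \<theta>))\<^sup>2) - 2 * pi * E"
    by (subst (1 2) Re_int) (auto intro!: continuous_intros cu cS simp: iu iS)
  finally show ?thesis by (simp add: u_def E_def field_simps)
qed

lemma sum_le_sqrt_sqrt:
  fixes x y :: "'a \<Rightarrow> real"
  assumes "(\<Sum>i\<in>A. (x i)\<^sup>2) \<le> a" "(\<Sum>i\<in>A. (y i)\<^sup>2) \<le> b"
  shows "(\<Sum>i\<in>A. \<bar>x i\<bar> * \<bar>y i\<bar>) \<le> sqrt a * sqrt b"
proof -
  have "(\<Sum>i\<in>A. \<bar>x i\<bar> * \<bar>y i\<bar>) \<le> L2_set x A * L2_set y A" by (rule L2_set_mult_ineq)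
  also have "\<dots> \<le> sqrt a * sqrt b"
    unfolding L2_set_def using assms
    by (intro mult_mono real_sqrt_le_mono) (auto intro!: sum_nonneg order_trans[OF sum_nonneg assms(1)])
  finally show ?thesis .
qed

lemma l2_tail:
  fixes U :: "nat \<Rightarrow> complex"
  assumes "\<And>n. (\<Sum>i\<le>n. (norm (U i))\<^sup>2) \<le> C" "e > 0"
  shows "\<exists>N. \<forall>M. (\<Sum>i\<in>{N..M}. (norm (U i))\<^sup>2) \<le> e"
proof -
  have "summable (\<lambda>i. (norm (U i))\<^sup>2)"
    by (rule bounded_imp_summable) (use assms in auto)
  then obtain N where N: "\<And>m n. m \<ge> N \<Longrightarrow> norm (\<Sum>i\<in>{m..<n}. (norm (U i))\<^sup>2) < e"
    using assms(2) unfolding summable_Cauchy by blast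
  have "(\<Sum>i\<in>{N..M}. (norm (U i))\<^sup>2) \<le> e" for M
    using N[of N "Suc M"] by (simp add: atLeastLessThanSuc_atLeastAtMost)
  then show ?thesis by blast
qed

text \<open>Cauchy-Schwarz on two blocks: for i >= N1 the tail of \<open>U\<close> is small, and for
  i < N1 the index m - i is beyond N2, where the tail of \<open>V\<close> is small.\<close>

lemma l2_convolution_tendsto_0:
  fixes U V :: "nat \<Rightarrow> complex"
  assumes U: "\<And>n. (\<Sum>i\<le>n. (norm (U i))\<^sup>2) \<le> C" and V: "\<And>n. (\<Sum>i\<le>n. (norm (V i))\<^sup>2) \<le> C"
  shows "(\<lambda>m. \<Sum>i\<le>m. U i * V (m - i)) \<longlonglongrightarrow> 0"
proof (rule tendsto_norm_zero_cancel, rule LIMSEQ_I)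
  fix r :: real assume r: "r > 0"
  have C: "C \<ge> 0" using U[of 0] by (meson norm_ge_zero order_trans sum_nonneg zero_le_power)
  \<comment> \<open>Chosen so that each block contributes at most r/4; \<open>C + 1\<close> avoids a
    division by zero.\<close>
  define e where "e = (r / (4 * sqrt (C + 1)))\<^sup>2"
  have e: "e > 0" using r C by (simp add: e_def)
  have se: "sqrt e * sqrt C \<le> r / 4"
  proof -
    have "sqrt e * sqrt C = r / 4 * (sqrt C / sqrt (C + 1))"
      using r C by (simp add: e_def)
    also have "\<dots> \<le> r / 4 * 1" using C r by (intro mult_left_mono) auto
    finally show ?thesis by simp
  qed
  obtain N1 where N1: "\<And>M. (\<Sum>i\<in>{N1..M}. (norm (U i))\<^sup>2) \<le> e" using l2_tail[OF U e] by blast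
  obtain N2 where N2: "\<And>M. (\<Sum>i\<in>{N2..M}. (norm (V i))\<^sup>2) \<le> e" using l2_tail[OF V e] by blast
  have "norm (\<Sum>i\<le>m. U i * V (m - i)) < r" if m: "m \<ge> N1 + N2" for m
  proof -
    have rev: "(\<Sum>i\<in>A. (norm (V (m - i)))\<^sup>2) = (\<Sum>i\<in>(\<lambda>i. m - i) ` A. (norm (V i))\<^sup>2)" if "A \<subseteq> {..m}" for A
    proof -
      have "inj_on (\<lambda>i. m - i) A"
        using that by (intro inj_onI) (metis atMost_iff diff_diff_cancel subsetD)
      then show ?thesis by (simp add: sum.reindex)
    qed
    have "(\<Sum>i\<in>{N1..m}. \<bar>norm (U i)\<bar> * \<bar>norm (V (m - i))\<bar>) \<le> sqrt e * sqrt C"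
    proof (rule sum_le_sqrt_sqrt[OF N1])
      have "(\<Sum>i\<in>(\<lambda>i. m - i) ` {N1..m}. (norm (V i))\<^sup>2) \<le> (\<Sum>i\<le>m. (norm (V i))\<^sup>2)"
        by (rule sum_mono2) auto
      then show "(\<Sum>i\<in>{N1..m}. (norm (V (m - i)))\<^sup>2) \<le> C" using V[of m] by (subst rev) auto
    qed
    moreover have "(\<Sum>i\<in>{..<N1}. \<bar>norm (U i)\<bar> * \<bar>norm (V (m - i))\<bar>) \<le> sqrt C * sqrt e"
    proof (rule sum_le_sqrt_sqrt)
      have "(\<Sum>i\<in>{..<N1}. (norm (U i))\<^sup>2) \<le> (\<Sum>i\<le>N1. (norm (U i))\<^sup>2)" by (rule sum_mono2) auto
      then show "(\<Sum>i\<in>{..<N1}. (norm (U i))\<^sup>2) \<le> C" using U[of N1] by simp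
      have "(\<Sum>i\<in>(\<lambda>i. m - i) ` {..<N1}. (norm (V i))\<^sup>2) \<le> (\<Sum>i\<in>{N2..m}. (norm (V i))\<^sup>2)"
        by (rule sum_mono2) (use m in auto)
      then show "(\<Sum>i\<in>{..<N1}. (norm (V (m - i)))\<^sup>2) \<le> e" using N2[of m] m by (subst rev) auto
    qed
    moreover have "(\<Sum>i\<le>m. norm (U i * V (m - i))) = (\<Sum>i\<in>{..<N1}. \<bar>norm (U i)\<bar> * \<bar>norm (V (m - i))\<bar>) + (\<Sum>i\<in>{N1..m}. \<bar>norm (U i)\<bar> * \<bar>norm (V (m - i))\<bar>)"
    proof -
      have "{..m} = {..<N1} \<union> {N1..m}" using m by auto
      then show ?thesis by (simp add: sum.union_disjoint norm_mult ivl_disj_int)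
    qed
    ultimately have "(\<Sum>i\<le>m. norm (U i * V (m - i))) \<le> r / 4 + r / 4" using se by (simp add: mult.commute)
    then have "(\<Sum>i\<le>m. norm (U i * V (m - i))) < r" using r by simp
    then show ?thesis by (rule le_less_trans[OF norm_sum])
  qed
  then show "\<exists>no. \<forall>n\<ge>no. norm (norm (\<Sum>i\<le>n. U i * V (n - i)) - 0) < r" by auto
qed

section \<open>Square-root factorization on the unit circle\<close>

lemma csqrt_arg: "norm (w::complex) < 1 \<Longrightarrow> 1 - w \<notin> \<real>\<^sub>\<le>\<^sub>0"
  using complex_Re_le_cmod[of w] by (auto simp: complex_nonpos_Reals_iff)

text \<open>On the circle |u| = |v| = sqrt |p|, so both factors inherit square means from the mean
  of |p|. A linear factor with its root outside the disk is split into two equal square roots. For a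
  root w inside, the Blaschke factor \<open>(z - w) / (1 - cnj w * z)\<close> has modulus 1 on the
  circle and goes entirely to \<open>u\<close>, and the zero-free \<open>1 - cnj w * z\<close> is
  split. A root on the circle would be a branch point there.\<close>

lemma poly_circle_factorization:
  fixes p :: "complex poly"
  assumes "p \<noteq> 0" "\<And>z. norm z = 1 \<Longrightarrow> poly p z \<noteq> 0"
  shows "\<exists>R>1. \<exists>u v. u holomorphic_on ball 0 R \<and> v holomorphic_on ball 0 R \<and>
           (\<forall>z\<in>ball 0 R. u z * v z = poly p z) \<and> (\<forall>z. norm z = 1 \<longrightarrow> norm (u z) = norm (v z))"
  using assms
proof (induction "degree p" arbitrary: p)
  case 0
  then obtain c where "p = [:c:]" by (metis degree_eq_zeroE)
  then have "(\<forall>z\<in>ball 0 2. csqrt c * csqrt c = poly p z)"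
    by (simp add: power2_eq_square[symmetric])
  then show ?case
    by (intro exI[of _ 2] conjI exI[of _ "\<lambda>_. csqrt c"]) (auto intro: holomorphic_intros)
next
  case (Suc n)
  have "\<not> constant (poly p)" using Suc.hyps(2) by (simp add: constant_degree)
  then obtain w where w: "poly p w = 0" using Fundamental_Theorem_Algebra.fundamental_theorem_of_algebra by blast
  then obtain q where pq: "p = [:-w, 1:] * q" by (auto simp: poly_eq_0_iff_dvd dvd_def)
  have q0: "q \<noteq> 0" using Suc.prems pq by auto
  have "degree p = Suc (degree q)" unfolding pq using q0 by (subst degree_mult_eq) auto
  then have "n = degree q" using Suc.hyps by simp
  moreover have "poly q z \<noteq> 0" if "norm z = 1" for z using Suc.prems(2)[OF that] by (auto simp: pq)
  ultimately obtain R u v where R: "R > 1" and u: "u holomorphic_on ball 0 R" and v: "v holomorphic_on ball 0 R"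
    and uv: "\<And>z. z \<in> ball 0 R \<Longrightarrow> u z * v z = poly q z" and nuv: "\<And>z. norm z = 1 \<Longrightarrow> norm (u z) = norm (v z)"
    using Suc.hyps(1)[of q] q0 by blast
  have w1: "norm w \<noteq> 1" using w Suc.prems(2) by auto
  show ?case
  proof (cases "norm w < 1")
    case True
    \<comment> \<open>For |w| < 1 the bound 2 / (1 + |w|) exceeds 1 and still keeps |w| |z| below
      1.\<close>
    define R' where "R' = min R (2 / (1 + norm w))"
    have R': "R' > 1" "R' \<le> R" using R True by (auto simp: R'_def field_simps add_pos_nonneg)
    have small: "norm (cnj w * z) < 1" if "z \<in> ball 0 R'" for z
    proof -
      have "norm z * (1 + norm w) < 2" using that by (simp add: R'_def field_simps add_pos_nonneg)
      moreover have "norm w * norm z \<le> norm z * norm w" by simp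
      moreover have "norm z * norm w \<le> norm z \<or> norm z = 0" using True by (simp add: mult_left_le)
      ultimately show ?thesis by (auto simp: norm_mult algebra_simps)
    qed
    define s where "s z = csqrt (1 - cnj w * z)" for z
    have s2: "s z * s z = 1 - cnj w * z" for z by (simp add: s_def power2_eq_square[symmetric])
    have s0: "1 - cnj w * z \<noteq> 0" if "z \<in> ball 0 R'" for z using small[OF that] by auto
    have hs: "s holomorphic_on ball 0 R'" unfolding s_def
      by (intro holomorphic_intros) (use csqrt_arg[OF small] in auto)
    have sub: "ball 0 R' \<subseteq> ball (0::complex) R" using R' by auto
    have n1: "norm (z - w) = norm (1 - cnj w * z)" if "norm z = 1" for z
    proof -
      have "z * cnj z = 1" using that by (simp add: complex_norm_square[symmetric])
      then have "z - w = z * cnj (1 - cnj w * z)" by (simp add: algebra_simps)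
      then show ?thesis using that by (metis complex_mod_cnj mult_1 norm_mult)
    qed
    show ?thesis
    proof (rule exI[of _ R'], rule conjI[OF R'(1)],
        rule exI[of _ "\<lambda>z. u z * s z * ((z - w) / (1 - cnj w * z))"], rule exI[of _ "\<lambda>z. v z * s z"],
        intro conjI ballI allI impI)
      show "(\<lambda>z. u z * s z * ((z - w) / (1 - cnj w * z))) holomorphic_on ball 0 R'"
        using s0 by (intro holomorphic_intros hs holomorphic_on_subset[OF u sub]) auto
      show "(\<lambda>z. v z * s z) holomorphic_on ball 0 R'"
        by (intro holomorphic_intros hs holomorphic_on_subset[OF v sub])
      fix z :: complex assume z: "z \<in> ball 0 R'"
      have "u z * s z * ((z - w) / (1 - cnj w * z)) * (v z * s z) = (u z * v z) * (s z * s z) * ((z - w) / (1 - cnj w * z))"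
        by simp
      also have "\<dots> = poly q z * (z - w)" using s0[OF z] uv[OF subsetD[OF sub z]] by (simp add: s2)
      also have "\<dots> = poly p z" by (simp add: pq algebra_simps)
      finally show "u z * s z * ((z - w) / (1 - cnj w * z)) * (v z * s z) = poly p z" .
    next
      fix z :: complex assume z: "norm z = 1"
      have "1 - cnj w * z \<noteq> 0" using s0[of z] z R' by simp
      then show "norm (u z * s z * ((z - w) / (1 - cnj w * z))) = norm (v z * s z)"
        using nuv[OF z] n1[OF z] by (simp add: norm_mult norm_divide)
    qed
  next
    case False
    then have w2: "norm w > 1" using w1 by simp
    define R' where "R' = min R (norm w)"
    have R': "R' > 1" "R' \<le> R" using R w2 by (auto simp: R'_def)
    have small: "norm (z / w) < 1" if "z \<in> ball 0 R'" for z
      using that w2 by (auto simp: R'_def norm_divide divide_less_eq)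
    \<comment> \<open>The root is taken factor by factor: \<open>1 - z / w\<close> has positive real
      part and avoids the branch cut, which \<open>z - w\<close> may meet.\<close>
    define s where "s z = csqrt (- w) * csqrt (1 - z / w)" for z
    have s2: "s z * s z = z - w" for z
    proof -
      have "s z * s z = (csqrt (-w))\<^sup>2 * (csqrt (1 - z / w))\<^sup>2" by (simp add: s_def power2_eq_square)
      also have "\<dots> = z - w" using w2 by (auto simp: field_simps)
      finally show ?thesis .
    qed
    have hs: "s holomorphic_on ball 0 R'" unfolding s_def
      by (intro holomorphic_intros) (use csqrt_arg[OF small] w2 in auto)
    have sub: "ball 0 R' \<subseteq> ball (0::complex) R" using R' by auto
    show ?thesis
    proof (rule exI[of _ R'], rule conjI[OF R'(1)],
        rule exI[of _ "\<lambda>z. u z * s z"], rule exI[of _ "\<lambda>z. v z * s z"],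
        intro conjI ballI allI impI)
      fix z :: complex assume z: "z \<in> ball 0 R'"
      have "u z * s z * (v z * s z) = (u z * v z) * (s z * s z)" by simp
      also have "\<dots> = poly q z * (z - w)" using uv[OF subsetD[OF sub z]] by (simp add: s2)
      also have "\<dots> = poly p z" by (simp add: pq algebra_simps)
      finally show "u z * s z * (v z * s z) = poly p z" .
    qed (use R' nuv in \<open>auto simp: norm_mult intro!: holomorphic_intros hs holomorphic_on_subset[OF u sub] holomorphic_on_subset[OF v sub]\<close>)
  qed
qed

text \<open>Since R > 1, the Taylor series converges absolutely on the unit circle, which makes
  Bessel's inequality for trigonometric series applicable.\<close>

lemma holomorphic_taylor_bessel:
  assumes u: "u holomorphic_on ball 0 R" and R: "R > 1"
  shows "(\<Sum>i\<le>n. (norm (fps_nth (fps_expansion u 0) i))\<^sup>2) \<le> integral {s..s + 2*pi} (\<lambda>\<theta>. (norm (u (cis \<theta>)))\<^sup>2) / (2*pi)"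
proof -
  define U where "U = fps_nth (fps_expansion u 0)"
  have sums: "(\<lambda>n. U n * w ^ n) sums u w" if "w \<in> ball 0 R" for w
    using holomorphic_power_series[OF u that] by (simp add: U_def fps_expansion_def)
  obtain x where x: "1 < x" "x < R" using dense[OF R] by blast
  have "summable (\<lambda>n. norm (U n * 1 ^ n))"
    by (rule powser_insidea[OF sums_summable[OF sums[of "of_real x"]]]) (use x in auto)
  then have su: "summable (\<lambda>n. norm (U n))" by simp
  have eq: "trig_series (nonneg_ext U) \<theta> = u (cis \<theta>)" for \<theta>
  proof (rule sums_unique2[OF trig_series_nonneg_ext[OF su]])
    show "(\<lambda>n. U n * cis (of_nat n * \<theta>)) sums u (cis \<theta>)"
      using sums[of "cis \<theta>"] R unfolding Complex.DeMoivre by simp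
  qed
  have "(\<Sum>i\<le>n. (norm (U i))\<^sup>2) = (\<Sum>i\<in>int ` {..n}. (norm (nonneg_ext U i))\<^sup>2)"
    by (subst sum.reindex) (auto simp: nonneg_ext_def)
  also have "\<dots> \<le> integral {s..s + 2*pi} (\<lambda>\<theta>. (norm (trig_series (nonneg_ext U) \<theta>))\<^sup>2) / (2*pi)"
    by (rule trig_series_bessel[OF summable_nonneg_ext[OF su]]) auto
  finally show ?thesis unfolding eq unfolding U_def .
qed

text \<open>The dilation by \<open>\<rho>\<close> moves the zeros of \<open>p\<close> off the unit circle.\<close>

lemma poly_L1_factorization:
  fixes p :: "complex poly"
  assumes int: "integral {s..s + 2*pi} (\<lambda>\<theta>. norm (poly p (cis \<theta>))) \<le> C" and e: "0 < e" "e \<le> 1"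
  obtains \<rho> :: real and U V :: "nat \<Rightarrow> complex" where "1 - e < \<rho>" "\<rho> < 1"
    "\<And>n. (\<Sum>i\<le>n. (norm (U i))\<^sup>2) \<le> (C + 1) / (2*pi)"
    "\<And>n. (\<Sum>i\<le>n. (norm (V i))\<^sup>2) \<le> (C + 1) / (2*pi)"
    "\<And>m. \<rho> ^ m * coeff p m = (\<Sum>i\<le>m. U i * V (m - i))"
proof (cases "p = 0")
  case True
  then have "C \<ge> 0" using int by simp
  with True e show ?thesis by (intro that[of "1 - e / 2" "\<lambda>_. 0" "\<lambda>_. 0"]) auto
next
  case False
  let ?W = "{s..s + 2*pi}"
  define f where "f \<rho> = integral ?W (\<lambda>\<theta>. norm (poly p (of_real \<rho> * cis \<theta>)))" for \<rho>
  have "continuous_on UNIV (\<lambda>\<rho>. integral (cbox s (s+2*pi)) (\<lambda>\<theta>. norm (poly p (of_real \<rho> * cis \<theta>))))"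
    by (rule integral_continuous_on_param) (auto simp: case_prod_beta intro!: continuous_intros)
  then have "isCont f 1" by (simp add: f_def[abs_def] continuous_on_eq_continuous_at)
  \<comment> \<open>The mean of |p| depends continuously on the radius, so a small dilation raises
    it by less than 1; this is the 1 in \<open>C + 1\<close>.\<close>
  then obtain d where d: "d > 0" "\<And>\<rho>. dist \<rho> 1 < d \<Longrightarrow> dist (f \<rho>) (f 1) < 1"
    unfolding continuous_at_eps_delta by (metis zero_less_one)
  define Z where "Z = norm ` {z. poly p z = 0}"
  have "finite Z" using False by (simp add: Z_def poly_roots_finite)
  moreover have "infinite {1 - min d e<..<1}" using d e by simp
  \<comment> \<open>Only finitely many radii carry a root of \<open>p\<close>.\<close>
  ultimately obtain \<rho> where rho: "\<rho> \<in> {1 - min d e<..<1}" "\<rho> \<notin> Z"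
    by (meson finite_subset subsetI)
  have r01: "\<rho> > 0" "\<rho> < 1" "1 - e < \<rho>" using rho e by auto
  have "dist (f \<rho>) (f 1) < 1" using d(2)[of \<rho>] rho by (auto simp: dist_real_def)
  moreover have "f 1 \<le> C" using int by (simp add: f_def)
  ultimately have "f \<rho> \<le> C + 1" unfolding dist_real_def by linarith
  define q where "q = pcompose p [:0, of_real \<rho>:]"
  have q: "poly q z = poly p (of_real \<rho> * z)" for z by (simp add: q_def poly_pcompose mult.commute)
  have cq: "coeff q m = of_real \<rho> ^ m * coeff p m" for m
    unfolding q_def by (simp add: coeff_pcompose_linear)
  have "q \<noteq> 0"
  proof
    assume "q = 0"
    then have "coeff p m = 0" for m using cq[of m] r01 by simp
    then show False using False by (simp add: poly_eq_iff)
  qed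
  moreover have "poly q z \<noteq> 0" if "norm z = 1" for z
  proof
    assume "poly q z = 0"
    then have "norm (of_real \<rho> * z) \<in> Z" unfolding q Z_def by blast
    then show False using that r01 rho by (simp add: norm_mult)
  qed
  ultimately obtain R u v where R: "R > 1" and u: "u holomorphic_on ball 0 R" and v: "v holomorphic_on ball 0 R"
    and uv: "\<And>z. z \<in> ball 0 R \<Longrightarrow> u z * v z = poly q z" and nuv: "\<And>z. norm z = 1 \<Longrightarrow> norm (u z) = norm (v z)"
    using poly_circle_factorization[of q] by blast
  define U where "U = fps_expansion u 0"
  define V where "V = fps_expansion v 0"
  have sq: "(norm (u (cis \<theta>)))\<^sup>2 = norm (poly p (of_real \<rho> * cis \<theta>))"
      "(norm (v (cis \<theta>)))\<^sup>2 = norm (poly p (of_real \<rho> * cis \<theta>))" for \<theta>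
  proof -
    have "u (cis \<theta>) * v (cis \<theta>) = poly p (of_real \<rho> * cis \<theta>)" using uv[of "cis \<theta>"] R by (simp add: q)
    then have "norm (u (cis \<theta>)) * norm (v (cis \<theta>)) = norm (poly p (of_real \<rho> * cis \<theta>))" by (metis norm_mult)
    then show "(norm (u (cis \<theta>)))\<^sup>2 = norm (poly p (of_real \<rho> * cis \<theta>))"
      "(norm (v (cis \<theta>)))\<^sup>2 = norm (poly p (of_real \<rho> * cis \<theta>))"
      using nuv[of "cis \<theta>"] by (simp_all add: power2_eq_square)
  qed
  have bd: "(\<Sum>i\<le>n. (norm (fps_nth U i))\<^sup>2) \<le> (C + 1) / (2*pi)"
       "(\<Sum>i\<le>n. (norm (fps_nth V i))\<^sup>2) \<le> (C + 1) / (2*pi)" for n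
  proof -
    have "f \<rho> / (2*pi) \<le> (C + 1) / (2*pi)" using \<open>f \<rho> \<le> C + 1\<close> by (intro divide_right_mono) auto
    then show "(\<Sum>i\<le>n. (norm (fps_nth U i))\<^sup>2) \<le> (C + 1) / (2*pi)"
       "(\<Sum>i\<le>n. (norm (fps_nth V i))\<^sup>2) \<le> (C + 1) / (2*pi)"
      using holomorphic_taylor_bessel[OF u R, of n s] holomorphic_taylor_bessel[OF v R, of n s]
      unfolding U_def V_def sq f_def by linarith+
  qed
  have "u has_fps_expansion U" "v has_fps_expansion V" unfolding U_def V_def
    using R u v by (auto intro!: has_fps_expansion_fps_expansion[of "ball 0 R"])
  \<comment> \<open>Equality of functions near 0 becomes equality of formal power series, whose
    product is the Cauchy product.\<close>
  then have "(\<lambda>z. u z * v z) has_fps_expansion U * V" by (rule has_fps_expansion_mult)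
  moreover have "eventually (\<lambda>z. u z * v z = poly q z) (nhds 0)"
    using R uv by (intro eventually_nhds_in_open[of "ball 0 R", THEN eventually_mono]) auto
  ultimately have "poly q has_fps_expansion U * V"
    using has_fps_expansion_cong[of "\<lambda>z. u z * v z" "poly q" "U * V" "U * V"] by blast
  moreover have "poly q has_fps_expansion fps_of_poly q"
    by (simp add: has_fps_expansion_def)
  ultimately have "U * V = fps_of_poly q" by (rule fps_expansion_unique_complex)
  then have "coeff q m = (\<Sum>i\<le>m. fps_nth U i * fps_nth V (m - i))" for m
    by (metis fps_mult_nth fps_of_poly_nth atLeast0AtMost)
  then show ?thesis using r01 by (intro that[OF _ _ bd, of \<rho>]) (auto simp: cq)
qed

text \<open>A Riemann--Lebesgue lemma for \<open>H\<^sup>1\<close>: the factorization passes to the limit coefficientwise and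
  exhibits \<open>d\<close> as a convolution of two square summable sequences.\<close>

lemma poly_coeffs_limit_tendsto_0:
  fixes p :: "nat \<Rightarrow> complex poly"
  assumes int: "\<And>k. integral {s..s + 2*pi} (\<lambda>\<theta>. norm (poly (p k) (cis \<theta>))) \<le> C"
    and lim: "\<And>m. (\<lambda>k. coeff (p k) m) \<longlonglongrightarrow> d m"
  shows "d \<longlonglongrightarrow> 0"
proof -
  define B where "B = (C + 1) / (2*pi)"
  have "\<forall>k. \<exists>\<rho> U V. 1 - 1 / real (Suc k) < \<rho> \<and> \<rho> < 1 \<and> (\<forall>n. (\<Sum>i\<le>n. (norm (U i))\<^sup>2) \<le> B) \<and>
     (\<forall>n. (\<Sum>i\<le>n. (norm (V i))\<^sup>2) \<le> B) \<and> (\<forall>m. of_real \<rho> ^ m * coeff (p k) m = (\<Sum>i\<le>m. U i * V (m - i)))"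
  proof
    fix k
    show "\<exists>\<rho> U V. 1 - 1 / real (Suc k) < \<rho> \<and> \<rho> < 1 \<and> (\<forall>n. (\<Sum>i\<le>n. (norm (U i))\<^sup>2) \<le> B) \<and>
     (\<forall>n. (\<Sum>i\<le>n. (norm (V i))\<^sup>2) \<le> B) \<and> (\<forall>m. of_real \<rho> ^ m * coeff (p k) m = (\<Sum>i\<le>m. U i * V (m - i)))"
      by (rule poly_L1_factorization[OF int[of k], of "1 / real (Suc k)"]) (auto simp: B_def)
  qed
  from this[unfolded choice_iff] obtain \<rho> U V where
    H: "\<forall>k. 1 - 1 / real (Suc k) < \<rho> k \<and> \<rho> k < 1 \<and> (\<forall>n. (\<Sum>i\<le>n. (norm (U k i :: complex))\<^sup>2) \<le> B) \<and>
     (\<forall>n. (\<Sum>i\<le>n. (norm (V k i :: complex))\<^sup>2) \<le> B) \<and>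
     (\<forall>m. of_real (\<rho> k) ^ m * coeff (p k) m = (\<Sum>i\<le>m. U k i * V k (m - i)))"
    by blast
  have rho: "1 - 1 / real (Suc k) < \<rho> k" "\<rho> k < 1"
    and U: "(\<Sum>i\<le>n. (norm (U k i))\<^sup>2) \<le> B"
    and V: "(\<Sum>i\<le>n. (norm (V k i))\<^sup>2) \<le> B"
    and pUV: "of_real (\<rho> k) ^ m * coeff (p k) m = (\<Sum>i\<le>m. U k i * V k (m - i))" for k n m
    using H[THEN spec, of k] by simp_all
  have rho1: "\<rho> \<longlonglongrightarrow> 1"
  proof (rule real_tendsto_sandwich[of "\<lambda>k. 1 - 1 / real (Suc k)" _ _ "\<lambda>_. 1"])
    show "(\<lambda>k. 1 - 1 / real (Suc k)) \<longlonglongrightarrow> 1"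
      using tendsto_diff[OF tendsto_const LIMSEQ_inverse_real_of_nat, of 1] by (simp add: inverse_eq_divide)
  qed (use rho in \<open>auto intro!: always_eventually less_imp_le\<close>)
  have single: "norm (W i) \<le> sqrt B" if "\<And>n. (\<Sum>i\<le>n. (norm (W i))\<^sup>2) \<le> B" for W :: "nat \<Rightarrow> complex" and i
  proof -
    have "(norm (W i))\<^sup>2 \<le> (\<Sum>i\<le>i. (norm (W i))\<^sup>2)" by (rule member_le_sum) auto
    with that[of i] show ?thesis by (simp add: real_le_rsqrt)
  qed
  have nb: "norm ((U k i, V k i)) \<le> sqrt B + sqrt B" for k i
    by (rule order_trans[OF norm_Pair_le add_mono[OF single[of "U k", OF U] single[of "V k", OF V]]])
  \<comment> \<open>A diagonal subsequence, extracted for pairs so that \<open>U\<close> and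
    \<open>V\<close> converge along the same indices.\<close>
  obtain r :: "nat \<Rightarrow> nat" where r: "strict_mono r"
      and conv: "\<And>i. i \<in> UNIV \<Longrightarrow> \<exists>l. (\<lambda>k. (U (r k) i, V (r k) i)) \<longlonglongrightarrow> l"
  proof (rule function_convergent_subsequence[of "UNIV :: nat set" "\<lambda>k i. (U k i, V k i)" "sqrt B + sqrt B"])
    show "countable (UNIV :: nat set)" by simp
  qed (use nb in auto)
  from conv have "\<forall>i. \<exists>l. (\<lambda>k. (U (r k) i, V (r k) i)) \<longlonglongrightarrow> l" by blast
  then obtain L where L: "\<forall>i. (\<lambda>k. (U (r k) i, V (r k) i)) \<longlonglongrightarrow> L i" unfolding choice_iff by (rule exE)
  define U' where "U' i = fst (L i)" for i
  define V' where "V' i = snd (L i)" for i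
  have U': "(\<lambda>k. U (r k) i) \<longlonglongrightarrow> U' i" and V': "(\<lambda>k. V (r k) i) \<longlonglongrightarrow> V' i" for i
    using tendsto_fst[OF L[THEN spec, of i]] tendsto_snd[OF L[THEN spec, of i]] by (auto simp: U'_def V'_def)
  have "(\<Sum>i\<le>n. (norm (U' i))\<^sup>2) \<le> B" for n
    by (rule Lim_bounded[OF tendsto_sum[OF tendsto_power[OF tendsto_norm[OF U']]], where M = 0]) (use U in blast)
  moreover have "(\<Sum>i\<le>n. (norm (V' i))\<^sup>2) \<le> B" for n
    by (rule Lim_bounded[OF tendsto_sum[OF tendsto_power[OF tendsto_norm[OF V']]], where M = 0]) (use V in blast)
  ultimately have "(\<lambda>m. \<Sum>i\<le>m. U' i * V' (m - i)) \<longlonglongrightarrow> 0" by (rule l2_convolution_tendsto_0)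
  \<comment> \<open>The identity \<open>pUV\<close> is followed along \<open>r\<close>; the dilation
    factors tend to 1 and disappear.\<close>
  moreover have "d = (\<lambda>m. \<Sum>i\<le>m. U' i * V' (m - i))"
  proof (rule ext, rule LIMSEQ_unique)
    fix m
    have "(\<lambda>k. of_real (\<rho> k) ^ m * coeff (p k) m) \<longlonglongrightarrow> of_real 1 ^ m * d m"
      by (intro tendsto_mult tendsto_power tendsto_of_real rho1 lim)
    from LIMSEQ_subseq_LIMSEQ[OF this r]
    show "(\<lambda>k. of_real (\<rho> (r k)) ^ m * coeff (p (r k)) m) \<longlonglongrightarrow> d m"
      by (simp add: o_def)
    show "(\<lambda>k. of_real (\<rho> (r k)) ^ m * coeff (p (r k)) m) \<longlonglongrightarrow> (\<Sum>i\<le>m. U' i * V' (m - i))"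
      unfolding pUV by (intro tendsto_sum tendsto_mult U' V')
  qed
  ultimately show ?thesis by simp
qed

text \<open>Truncation far out costs less than 1 in the supremum norm, hence at most 2 pi in
  \<open>L\<^sup>1\<close>, and reduces the claim to polynomials. Cutting at
  \<open>M k \<ge> k\<close> leaves each fixed coefficient untouched for large
  \<open>k\<close>.\<close>

lemma coeffs_limit_tendsto_0:
  fixes c :: "nat \<Rightarrow> nat \<Rightarrow> complex"
  assumes summ: "\<And>k. summable (\<lambda>m. norm (c k m))"
    and int: "\<And>k. integral {s..s + 2*pi} (\<lambda>\<theta>. norm (trig_series (nonneg_ext (c k)) \<theta>)) \<le> C"
    and lim: "\<And>m. (\<lambda>k. c k m) \<longlonglongrightarrow> d m"
  shows "d \<longlonglongrightarrow> 0"
proof -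
  let ?W = "{s..s + 2*pi}"
  have "\<exists>M\<ge>k. (\<Sum>m. norm (c k (m + M))) < 1" for k
  proof -
    obtain N where N: "\<And>n. n \<ge> N \<Longrightarrow> norm (\<Sum>i. norm (c k (i + n))) < 1"
      using suminf_exist_split[OF zero_less_one summ[of k]] by blast
    from N[of "max k N"] show ?thesis by (intro exI[of _ "max k N"]) auto
  qed
  then obtain M where M: "\<And>k. M k \<ge> k" "\<And>k. (\<Sum>m. norm (c k (m + M k))) < 1" by metis
  define p where "p k = (\<Sum>m<M k. monom (c k m) m)" for k
  have pk: "poly (p k) z = (\<Sum>m<M k. c k m * z ^ m)" for k z
    by (simp add: p_def poly_sum poly_monom)
  have cp: "coeff (p k) m = (if m < M k then c k m else 0)" for k m
    by (simp add: p_def coeff_sum if_distrib[of "\<lambda>x. coeff x m"] sum.delta' cong: if_cong)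
  have le: "norm (poly (p k) (cis \<theta>)) \<le> norm (trig_series (nonneg_ext (c k)) \<theta>) + 1" for k \<theta>
  proof -
    have s: "(\<lambda>m. c k m * cis (of_nat m * \<theta>)) sums trig_series (nonneg_ext (c k)) \<theta>"
      by (rule trig_series_nonneg_ext[OF summ])
    have sM: "summable (\<lambda>m. norm (c k (m + M k)))" using summ[of k] by (subst summable_iff_shift)
    have "trig_series (nonneg_ext (c k)) \<theta> - poly (p k) (cis \<theta>) = (\<Sum>m. c k (m + M k) * cis (of_nat (m + M k) * \<theta>))"
      using suminf_minus_initial_segment[OF sums_summable[OF s], of "M k"] sums_unique[OF s]
      unfolding pk Complex.DeMoivre by simp
    also have "norm \<dots> \<le> (\<Sum>m. norm (c k (m + M k)))"
      by (rule order_trans[OF summable_norm]) (use sM in \<open>simp_all add: norm_mult\<close>)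
    finally have "norm (trig_series (nonneg_ext (c k)) \<theta> - poly (p k) (cis \<theta>)) \<le> 1" using M(2)[of k] by simp
    then show ?thesis by (smt (verit) norm_triangle_ineq2 norm_minus_commute)
  qed
  show ?thesis
  proof (rule poly_coeffs_limit_tendsto_0[of s p "C + 2 * pi"])
    fix k
    have "integral ?W (\<lambda>\<theta>. norm (poly (p k) (cis \<theta>))) \<le> integral ?W (\<lambda>\<theta>. norm (trig_series (nonneg_ext (c k)) \<theta>) + 1)"
      by (intro integral_le integrable_continuous_interval continuous_intros le
             summable_nonneg_ext summ)
    also have "\<dots> = integral ?W (\<lambda>\<theta>. norm (trig_series (nonneg_ext (c k)) \<theta>)) + 2 * pi"
      by (subst integral_add) (auto intro!: integrable_continuous_interval continuous_intros summable_nonneg_ext summ)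
    finally show "integral ?W (\<lambda>\<theta>. norm (poly (p k) (cis \<theta>))) \<le> C + 2 * pi" using int[of k] by simp
  next
    fix m
    have "eventually (\<lambda>k. c k m = coeff (p k) m) sequentially"
      using eventually_gt_at_top[of m]
    proof eventually_elim
      case (elim k)
      then show ?case using M(1)[of k] by (auto simp: cp)
    qed
    then show "(\<lambda>k. coeff (p k) m) \<longlonglongrightarrow> d m" by (rule Lim_transform_eventually[OF lim])
  qed
qed

section \<open>Right limits and local integral bounds\<close>

lemma bij_uminus_int: "bij (uminus :: int \<Rightarrow> int)"
  by (rule bijI') (auto intro: exI[of _ "- _"])

lemma bij_minus_int: "bij (\<lambda>k::int. n - k)"
  by (rule bijI') (auto intro: exI[of _ "n - _"])

lemma summable_on_int_abs:
  fixes g :: "nat \<Rightarrow> real"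
  assumes "summable g" "\<And>n. g n \<ge> 0"
  shows "(\<lambda>m::int. g (nat \<bar>m\<bar>)) summable_on UNIV"
proof -
  have "g summable_on UNIV" using assms by (simp add: summable_on_UNIV_nonneg_real_iff)
  then obtain S where "(g has_sum S) UNIV" by (auto simp: summable_on_def)
  from has_sum_int_nonneg[THEN iffD2, OF this]
  have h1: "(\<lambda>m::int. if m \<ge> 0 then g (nat m) else 0) summable_on UNIV" by (auto simp: summable_on_def)
  then have h2: "(\<lambda>m::int. if - m \<ge> 0 then g (nat (- m)) else 0) summable_on UNIV"
    using summable_on_reindex_bij_betw[OF bij_uminus_int, of "\<lambda>m::int. if m \<ge> 0 then g (nat m) else 0"] by simp
  show ?thesis
    by (rule summable_on_comparison_test[OF summable_on_add[OF h1 h2]]) (auto simp: assms(2))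
qed

lemma summable_on_inverse_square:
  "(\<lambda>m::int. 1 / (1 + \<bar>real_of_int m\<bar>)\<^sup>2) summable_on UNIV"
proof -
  have "summable (\<lambda>n. 1 / (1 + real n)\<^sup>2)"
    using inverse_power_summable[of 2, where 'a = real] unfolding summable_Suc_iff[symmetric, of "\<lambda>n. inverse (of_nat n ^ 2)"]
    by (simp add: inverse_eq_divide add.commute)
  from summable_on_int_abs[OF this] show ?thesis by simp
qed

lemma norm_fourier_coeff_le:
  assumes "continuous_on {s..s + 2*pi} f"
  shows "norm (fourier_coeff s f m) \<le> integral {s..s + 2*pi} (\<lambda>\<theta>. norm (f \<theta>)) / (2*pi)"
proof -
  have "norm (integral {s..s + 2*pi} (\<lambda>\<theta>. f \<theta> * cis (- (of_int m * \<theta>)))) \<le> integral {s..s + 2*pi} (\<lambda>\<theta>. norm (f \<theta>))"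
    by (intro integral_norm_bound_integral integrable_continuous_interval continuous_intros assms)
       (simp add: norm_mult)
  then show ?thesis unfolding fourier_coeff_def by (simp add: norm_divide divide_right_mono)
qed

section \<open>The Poisson kernel\<close>

definition poisson_kernel :: "real \<Rightarrow> real \<Rightarrow> real" where
  "poisson_kernel \<rho> x = (1 - \<rho>\<^sup>2) / (norm (1 - of_real \<rho> * cis x))\<^sup>2"

lemma poisson_kernel_uminus: "poisson_kernel \<rho> (- x) = poisson_kernel \<rho> x"
proof -
  have "1 - of_real \<rho> * cis (- x) = cnj (1 - of_real \<rho> * cis x)" by (simp add: cis_cnj)
  then show ?thesis unfolding poisson_kernel_def by (simp only: complex_mod_cnj)
qed

lemma cis_of_int: "cis (of_int m * x) = (if m \<ge> 0 then cis x ^ nat m else cnj (cis x) ^ nat (- m))"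
proof (cases "m \<ge> 0")
  case True
  then show ?thesis by (simp add: Complex.DeMoivre)
next
  case False
  then have "cnj (cis x) ^ nat (- m) = cis (of_int (- m) * (- x))"
    by (simp add: Complex.DeMoivre cis_cnj)
  with False show ?thesis by simp
qed

text \<open>Two geometric series, in w for n >= 0 and in \<open>cnj w\<close> for n < 0, add up to
  the closed form, in which positivity is visible.\<close>

lemma poisson_kernel_series:
  fixes \<rho> :: real
  assumes "0 \<le> \<rho>" "\<rho> < 1"
  shows "((\<lambda>m::int. of_real \<rho> ^ nat \<bar>m\<bar> * cis (of_int m * x)) has_sum of_real (poisson_kernel \<rho> x)) UNIV"
proof -
  define w where "w = of_real \<rho> * cis x"
  have w: "norm w < 1" "norm w = \<rho>" using assms by (auto simp: w_def norm_mult)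
  have geo: "((\<lambda>n. v ^ n) has_sum 1 / (1 - v)) UNIV" if "norm v < 1" for v :: complex
    by (rule norm_summable_imp_has_sum)
       (use that in \<open>auto intro: geometric_sums simp: norm_power summable_geometric\<close>)
  have g1: "((\<lambda>n::int. if n \<ge> 0 then w ^ nat n else 0) has_sum 1 / (1 - w)) UNIV"
    by (rule has_sum_int_nonneg[THEN iffD2, OF geo[OF w(1)]])
  have "((\<lambda>n::int. if n \<ge> 0 then cnj w ^ nat n else 0) has_sum 1 / (1 - cnj w)) UNIV"
    by (rule has_sum_int_nonneg[THEN iffD2, OF geo]) (use w in simp)
  \<comment> \<open>Reflecting by - n - 1 rather than - n keeps the constant term from being counted
    twice.\<close>
  then have "((\<lambda>n::int. if - n - 1 \<ge> 0 then cnj w ^ nat (- n - 1) else 0) has_sum 1 / (1 - cnj w)) UNIV"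
    by (subst has_sum_reindex_bij_betw[of "\<lambda>n::int. - n - 1" UNIV UNIV "\<lambda>n::int. if n \<ge> 0 then cnj w ^ nat n else 0"])
       (auto intro!: bij_betw_byWitness[of _ "\<lambda>n. - n - 1"])
  from has_sum_cmult_right[OF this, of "cnj w"]
  have g2: "((\<lambda>n::int. if n < 0 then cnj w ^ nat (- n) else 0) has_sum cnj w / (1 - cnj w)) UNIV"
  proof (rule has_sum_cong[THEN iffD1, rotated, THEN iffD1[OF arg_cong[where f = "\<lambda>s. (_ has_sum s) _"], rotated]])
    fix n :: int
    have "n < 0 \<Longrightarrow> nat (- n) = Suc (nat (- n - 1))" by simp
    then show "cnj w * (if 0 \<le> - n - 1 then cnj w ^ nat (- n - 1) else 0) = (if n < 0 then cnj w ^ nat (- n) else 0)"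
      by auto
  qed simp
  have nz: "1 - w \<noteq> 0" "1 - cnj w \<noteq> 0" using w by auto
  have "1 / (1 - w) + cnj w / (1 - cnj w) = (1 - w * cnj w) / ((1 - w) * cnj (1 - w))"
    using nz by (simp add: field_simps)
  also have "\<dots> = of_real (1 - \<rho>\<^sup>2) / of_real ((norm (1 - w))\<^sup>2)"
    unfolding complex_norm_square[symmetric] w(2) by (simp add: power2_eq_square)
  finally have val: "1 / (1 - w) + cnj w / (1 - cnj w) = of_real (poisson_kernel \<rho> x)"
    by (simp add: poisson_kernel_def w_def)
  have "((\<lambda>n::int. (if n \<ge> 0 then w ^ nat n else 0) + (if n < 0 then cnj w ^ nat (- n) else 0)) has_sum of_real (poisson_kernel \<rho> x)) UNIV"
    using has_sum_add[OF g1 g2] by (simp add: val)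
  then show ?thesis
    by (rule has_sum_cong[THEN iffD1, rotated]) (auto simp: cis_of_int w_def power_mult_distrib)
qed

lemma summable_poisson_coeffs:
  fixes \<rho> :: real
  assumes "0 \<le> \<rho>" "\<rho> < 1"
  shows "(\<lambda>m::int. norm (of_real \<rho> ^ nat \<bar>m\<bar> :: complex)) summable_on UNIV"
  using summable_on_int_abs[of "\<lambda>n. \<rho> ^ n"] assms by (simp add: norm_power summable_geometric)

text \<open>The damped series is the convolution of \<open>f\<close> with the Poisson kernel, which
  is nonnegative with mean 1; Fubini does the rest. This takes the place of Fourier inversion:
  damping makes the bounded coefficients of a continuous function summable at no cost in
  norm.\<close>

lemma poisson_L1_contraction:
  fixes \<rho> :: real
  assumes f: "continuous_on {s..s + 2*pi} f" and rho: "0 \<le> \<rho>" "\<rho> < 1"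
  shows "integral {s..s + 2*pi} (\<lambda>\<theta>. norm (trig_series (\<lambda>m. fourier_coeff s f m * of_real \<rho> ^ nat \<bar>m\<bar>) \<theta>))
           \<le> integral {s..s + 2*pi} (\<lambda>t. norm (f t))"
proof -
  let ?W = "{s..s + 2*pi}"
  define K :: "int \<Rightarrow> complex" where "K m = of_real \<rho> ^ nat \<bar>m\<bar>" for m
  define S where "S = trig_series (\<lambda>m. fourier_coeff s f m * K m)"
  let ?p = "poisson_kernel \<rho>"
  have sK: "(\<lambda>m. norm (K m)) summable_on UNIV"
    unfolding K_def by (rule summable_poisson_coeffs[OF rho])
  have sK': "(\<lambda>m. norm (K m * cis (- (of_int m * \<theta>)))) summable_on UNIV" for \<theta>
    using sK by (simp add: norm_mult)
  have ser: "trig_series (\<lambda>m. K m * cis (- (of_int m * \<theta>))) t = of_real (?p (t - \<theta>))" for t \<theta>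
  proof -
    have "trig_series (\<lambda>m. K m * cis (- (of_int m * \<theta>))) t = trig_series K (t - \<theta>)"
      unfolding trig_series_def mult.assoc cis_mult by (simp add: right_diff_distrib)
    also have "\<dots> = of_real (?p (t - \<theta>))"
      unfolding trig_series_def K_def by (rule infsumI[OF poisson_kernel_series[OF rho]])
    finally show ?thesis .
  qed
  have nz: "1 - of_real \<rho> * cis x \<noteq> 0" for x
  proof
    assume "1 - of_real \<rho> * cis x = 0"
    then have "norm (of_real \<rho> * cis x) = 1" by (metis eq_iff_diff_eq_0 norm_one)
    then show False using rho by (simp add: norm_mult)
  qed
  have cp: "continuous_on T (\<lambda>x. ?p (g x))" if "continuous_on T g" for T and g :: "'z::topological_space \<Rightarrow> real"
    unfolding poisson_kernel_def using nz by (intro continuous_intros that) auto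
  have p0: "?p x \<ge> 0" for x
    using rho unfolding poisson_kernel_def by (intro divide_nonneg_nonneg) (auto simp: power_le_one)
  have sfK: "(\<lambda>m. norm (fourier_coeff s f m * K m)) summable_on UNIV"
    by (rule summable_on_comparison_test[OF summable_on_cmult_right[OF sK]])
       (auto simp: norm_mult intro!: mult_right_mono norm_fourier_coeff_le[OF f])
  have cS: "continuous_on T S" for T unfolding S_def by (intro continuous_intros sfK)
  have S_int: "S \<theta> = integral ?W (\<lambda>t. f t * of_real (?p (t - \<theta>))) / (2*pi)" for \<theta>
  proof -
    have "((\<lambda>n. K n * cis (- (of_int n * \<theta>)) * integral ?W (\<lambda>t. f t * cis (of_int n * t)) * inverse (2*pi)) has_sum
          integral ?W (\<lambda>t. f t * of_real (?p (t - \<theta>))) * inverse (2*pi)) UNIV"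
      using has_sum_cmult_left[OF has_sum_integral_trig_series[OF sK' f, of \<theta>], of "inverse (2*pi)"]
      unfolding ser .
    \<comment> \<open>Reflection n -> - n, because \<open>fourier_coeff\<close> integrates against
      the conjugate exponentials.\<close>
    then have "((\<lambda>n. K (- n) * cis (- (of_int (- n) * \<theta>)) * integral ?W (\<lambda>t. f t * cis (of_int (- n) * t)) * inverse (2*pi)) has_sum
          integral ?W (\<lambda>t. f t * of_real (?p (t - \<theta>))) * inverse (2*pi)) UNIV"
      by (subst has_sum_reindex_bij_betw[OF bij_uminus_int, of "\<lambda>n. K n * cis (- (of_int n * \<theta>)) * integral ?W (\<lambda>t. f t * cis (of_int n * t)) * inverse (2*pi)"])
    then have "((\<lambda>n. fourier_coeff s f n * K n * cis (of_int n * \<theta>)) has_sum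
          integral ?W (\<lambda>t. f t * of_real (?p (t - \<theta>))) * inverse (2*pi)) UNIV"
      by (rule has_sum_cong[THEN iffD1, rotated]) (simp add: fourier_coeff_def K_def field_simps)
    then show ?thesis unfolding S_def trig_series_def divide_inverse of_real_inverse by (rule infsumI)
  qed
  have S_le: "norm (S \<theta>) \<le> integral ?W (\<lambda>t. norm (f t) * ?p (t - \<theta>)) / (2*pi)" for \<theta>
  proof -
    have "norm (integral ?W (\<lambda>t. f t * of_real (?p (t - \<theta>)))) \<le> integral ?W (\<lambda>t. norm (f t) * ?p (t - \<theta>))"
      by (intro integral_norm_bound_integral integrable_continuous_interval continuous_intros f cp)
         (simp add: norm_mult p0)
    then show ?thesis unfolding S_int by (simp add: norm_divide divide_right_mono)
  qed
  \<comment> \<open>The mean is the zeroth coefficient of the kernel series,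
    \<open>K 0 = 1\<close>.\<close>
  have ip: "integral ?W (\<lambda>\<theta>. ?p (t - \<theta>)) = 2 * pi" for t
  proof -
    have "fourier_coeff s (\<lambda>\<theta>. of_real (?p (\<theta> - t))) 0 = K 0"
      unfolding ser[symmetric] using fourier_coeff_trig_series[OF sK', of s t 0] by simp
    then have "integral ?W (\<lambda>\<theta>. complex_of_real (?p (\<theta> - t))) = 2 * pi"
      by (simp add: fourier_coeff_def K_def)
    moreover have "integral ?W (\<lambda>\<theta>. complex_of_real (?p (\<theta> - t))) = complex_of_real (integral ?W (\<lambda>\<theta>. ?p (\<theta> - t)))"
    proof -
      have "(\<lambda>\<theta>. ?p (\<theta> - t)) integrable_on ?W"
        by (intro integrable_continuous_interval cp continuous_intros)
      from integral_linear[OF this bounded_linear_of_real[where 'a = complex]] show ?thesis by (simp add: o_def)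
    qed
    ultimately have "complex_of_real (integral ?W (\<lambda>\<theta>. ?p (\<theta> - t))) = complex_of_real (2 * pi)"
      by simp
    then have "integral ?W (\<lambda>\<theta>. ?p (\<theta> - t)) = 2 * pi" by (simp only: of_real_eq_iff)
    moreover have "?p (t - \<theta>) = ?p (\<theta> - t)" for \<theta>
      using poisson_kernel_uminus[of \<rho> "\<theta> - t"] by simp
    ultimately show ?thesis by presburger
  qed
  have joint: "continuous_on T (\<lambda>(\<theta>, t). norm (f t) * ?p (t - \<theta>))" if "snd ` T \<subseteq> ?W" for T
    unfolding case_prod_beta using that
    by (intro continuous_intros cp continuous_on_compose2[OF f]) auto
  have "integral ?W (\<lambda>\<theta>. norm (S \<theta>)) \<le> integral ?W (\<lambda>\<theta>. integral ?W (\<lambda>t. norm (f t) * ?p (t - \<theta>)) / (2*pi))"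
  proof (intro integral_le integrable_continuous_interval S_le)
    show "continuous_on ?W (\<lambda>\<theta>. norm (S \<theta>))" by (intro continuous_intros cS)
    have "continuous_on ?W (\<lambda>\<theta>. integral (cbox s (s + 2*pi)) (\<lambda>t. norm (f t) * ?p (t - \<theta>)))"
      by (rule integral_continuous_on_param) (rule joint, auto)
    then show "continuous_on ?W (\<lambda>\<theta>. integral ?W (\<lambda>t. norm (f t) * ?p (t - \<theta>)) / (2*pi))"
      by (intro continuous_intros) auto
  qed
  also have "\<dots> = integral ?W (\<lambda>\<theta>. integral ?W (\<lambda>t. norm (f t) * ?p (t - \<theta>))) / (2*pi)" by simp
  also have "integral ?W (\<lambda>\<theta>. integral ?W (\<lambda>t. norm (f t) * ?p (t - \<theta>))) = integral ?W (\<lambda>t. integral ?W (\<lambda>\<theta>. norm (f t) * ?p (t - \<theta>)))"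
    using integral_swap_continuous[of s s "s + 2*pi" "s + 2*pi" "\<lambda>\<theta> t. norm (f t) * ?p (t - \<theta>)"] joint[of "cbox (s, s) (s+2*pi, s+2*pi)"]
    by (auto simp: cbox_Pair_eq)
  also have "\<dots> = integral ?W (\<lambda>t. norm (f t)) * (2 * pi)" by (simp add: ip)
  finally show ?thesis by (simp add: S_def K_def)
qed


lemma norm_infsum_le_infsum:
  fixes f :: "'i \<Rightarrow> complex"
  assumes "\<And>i. i \<in> A \<Longrightarrow> norm (f i) \<le> g i" "g summable_on A"
  shows "norm (\<Sum>\<^sub>\<infinity>i\<in>A. f i) \<le> (\<Sum>\<^sub>\<infinity>i\<in>A. g i)"
proof -
  have s: "(\<lambda>i. norm (f i)) summable_on A"
    by (rule summable_on_comparison_test[OF assms(2)]) (use assms(1) in auto)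
  then have "norm (\<Sum>\<^sub>\<infinity>i\<in>A. f i) \<le> (\<Sum>\<^sub>\<infinity>i\<in>A. norm (f i))" by (rule norm_infsum_bound)
  also have "\<dots> \<le> (\<Sum>\<^sub>\<infinity>i\<in>A. g i)" by (rule infsum_mono[OF s assms(2,1)])
  finally show ?thesis .
qed

text \<open>The shift by 2 keeps every radius strictly between 0 and 1, the first one
  included.\<close>

lemma radii_limit: "(\<lambda>k. 1 - 1 / real (k + 2)) \<longlonglongrightarrow> 1"
proof -
  have "(\<lambda>k. 1 - inverse (real (Suc (Suc k)))) \<longlonglongrightarrow> 1 - 0"
    by (intro tendsto_diff tendsto_const LIMSEQ_Suc[OF LIMSEQ_inverse_real_of_nat])
  then show ?thesis by (simp add: inverse_eq_divide add.commute)
qed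

text \<open>Local \<open>L\<^sup>1\<close> bounds become a global \<open>H\<^sup>1\<close> bound: the cut-off spoils analyticity, but only by a
  uniformly bounded amount, since the negative Fourier coefficients of \<open>\<phi> g\<close> decay fast.\<close>

lemma localized_coeffs_tendsto_0:
  fixes a :: "nat \<Rightarrow> complex" and \<phi> :: "real \<Rightarrow> complex" and s :: real
  defines "X \<equiv> fourier_coeff s \<phi>"
  assumes a: "\<And>k. norm (a k) \<le> A" and cont: "continuous_on UNIV \<phi>"
    and X: "\<And>m. norm (X m) \<le> K / (1 + \<bar>real_of_int m\<bar>) ^ 4"
    and bound: "\<And>r. 0 < r \<Longrightarrow> r < 1 \<Longrightarrow>
       integral {s..s + 2*pi} (\<lambda>\<theta>. norm (\<phi> \<theta> * trig_series (nonneg_ext (\<lambda>k. a k * of_real r ^ k)) \<theta>)) \<le> L"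
  shows "(\<lambda>m::nat. \<Sum>\<^sub>\<infinity>k. nonneg_ext a k * X (int m - k)) \<longlonglongrightarrow> 0"
proof -
  let ?W = "{s..s + 2*pi}"
  define q where "q m = 1 / (1 + \<bar>real_of_int m\<bar>)\<^sup>2" for m
  have q: "q m \<ge> 0" "q summable_on UNIV" for m
    using summable_on_inverse_square by (auto simp: q_def[abs_def])
  have A: "A \<ge> 0" by (rule order_trans[OF norm_ge_zero a[of 0]])
  have K: "K \<ge> 0" using order_trans[OF norm_ge_zero X[of 0]] by simp
  have Xq: "norm (X m) \<le> K * q m" for m
  proof -
    have "(1 + \<bar>real_of_int m\<bar>)\<^sup>2 \<le> (1 + \<bar>real_of_int m\<bar>) ^ 4" by (rule power_increasing) auto
    then have "K / (1 + \<bar>real_of_int m\<bar>) ^ 4 \<le> K / (1 + \<bar>real_of_int m\<bar>)\<^sup>2"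
      using K by (intro divide_left_mono) (auto intro!: mult_pos_pos zero_less_power add_pos_nonneg)
    then show ?thesis using X[of m] by (simp add: q_def)
  qed
  have qshift: "(\<lambda>k. q (m - k)) summable_on UNIV" for m
    using summable_on_reindex_bij_betw[OF bij_minus_int[of m], of q] q(2) by simp
  have ext: "norm (nonneg_ext (\<lambda>k. a k * c k) k) \<le> A" if "\<And>k. norm (c k) \<le> 1" for c :: "nat \<Rightarrow> complex" and k
    using mult_mono[OF a that, of "nat k" "nat k"] A by (auto simp: nonneg_ext_def norm_mult)
  have extX: "norm (nonneg_ext (\<lambda>k. a k * c k) k * X (m - k)) \<le> A * (K * q (m - k))" if "\<And>k. norm (c k) \<le> 1" for c :: "nat \<Rightarrow> complex" and k m
    unfolding norm_mult by (intro mult_mono ext that Xq A) auto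
  \<comment> \<open>For m < 0 <= k the distance |m - k| is at least |m| and at least |k|, so the
    fourth order decay is dominated by a product of two second order ones, summable in both indices.
    This is where four derivatives of the cut-off are spent.\<close>
  have neg: "norm (nonneg_ext (\<lambda>k. a k * c k) k * X (m - k)) \<le> A * (K * q m * q k)"
    if "\<And>k. norm (c k) \<le> 1" "m < 0" for c :: "nat \<Rightarrow> complex" and k m
  proof (cases "k \<ge> 0")
    case True
    let ?u = "1 + \<bar>real_of_int m\<bar>" and ?v = "1 + \<bar>real_of_int k\<bar>" and ?w = "1 + \<bar>real_of_int (m - k)\<bar>"
    have uv: "?u \<le> ?w" "?v \<le> ?w" using True that by auto
    have "?u\<^sup>2 * ?v\<^sup>2 \<le> ?w\<^sup>2 * ?w\<^sup>2" by (intro mult_mono power_mono uv) auto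
    then have "?u\<^sup>2 * ?v\<^sup>2 \<le> ?w ^ 4" by (simp add: power_add[symmetric])
    then have "K / ?w ^ 4 \<le> K / (?u\<^sup>2 * ?v\<^sup>2)"
      using K by (intro divide_left_mono) (auto intro!: mult_pos_pos zero_less_power add_pos_nonneg)
    then have "norm (X (m - k)) \<le> K * q m * q k" using X[of "m - k"] by (simp add: q_def)
    then show ?thesis unfolding norm_mult by (intro mult_mono ext that A) auto
  next
    case False
    then show ?thesis using A K q by (simp add: nonneg_ext_def)
  qed
  define r :: "nat \<Rightarrow> real" where "r k = 1 - 1 / real (k + 2)" for k
  have r: "0 < r k" "r k < 1" for k by (auto simp: r_def field_simps)
  have r1: "r \<longlonglongrightarrow> 1" using radii_limit by (simp add: r_def[abs_def])
  have cr: "norm (complex_of_real (r k) ^ n) \<le> 1" for k n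
    using r[of k] by (simp add: norm_power power_le_one)
  define e where "e k = nonneg_ext (\<lambda>n. a n * of_real (r k) ^ n)" for k
  have se: "(\<lambda>n. norm (e k n)) summable_on UNIV" for k
    unfolding e_def
  proof (rule summable_nonneg_ext, rule summable_comparison_test)
    show "\<exists>N. \<forall>n\<ge>N. norm (norm (a n * complex_of_real (r k) ^ n)) \<le> A * r k ^ n"
      using a r[of k] by (auto simp: norm_mult norm_power intro!: mult_right_mono exI[of _ 0])
    show "summable (\<lambda>n. A * r k ^ n)" using r[of k] by (intro summable_mult summable_geometric) auto
  qed
  define f where "f k \<theta> = \<phi> \<theta> * trig_series (e k) \<theta>" for k \<theta>
  have cf: "continuous_on T (f k)" for T k
    unfolding f_def by (intro continuous_intros se continuous_on_subset[OF cont]) auto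
  define F where "F k = fourier_coeff s (f k)" for k
  have F: "F k m = (\<Sum>\<^sub>\<infinity>n. e k n * X (m - n))" for k m
    using fourier_coeff_mult_trig_series[OF se cont, of k s m, THEN infsumI]
    unfolding F_def f_def X_def by simp
  define Z where "Z = (\<Sum>\<^sub>\<infinity>m. q m)"
  define T where "T = (\<Sum>\<^sub>\<infinity>m. A * K * Z * q m)"
  have Fneg: "norm (F k m) \<le> A * K * Z * q m" if "m < 0" for k m
  proof -
    have "norm (F k m) \<le> (\<Sum>\<^sub>\<infinity>n. A * (K * q m * q n))"
      unfolding F e_def
      by (rule norm_infsum_le_infsum) (auto intro!: neg that cr summable_on_cmult_right q)
    also have "\<dots> = (\<Sum>\<^sub>\<infinity>n. (A * K * q m) * q n)" by (simp add: mult_ac)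
    also have "\<dots> = (A * K * q m) * Z" unfolding Z_def by (rule infsum_cmult_right')
    also have "\<dots> = A * K * Z * q m" by simp
    finally show ?thesis .
  qed
  \<comment> \<open>The radius \<open>r k\<close> serves twice: for the circle on which the series
    is taken and for the Poisson damping. Both effects vanish in the limit.\<close>
  define P :: "nat \<Rightarrow> int \<Rightarrow> complex" where "P k m = F k m * of_real (r k) ^ nat \<bar>m\<bar>" for k m
  have sP: "(\<lambda>m. norm (P k m)) summable_on UNIV" for k
    unfolding P_def F_def norm_mult
    by (rule summable_on_comparison_test[OF summable_on_cmult_right[OF summable_poisson_coeffs[of "r k"]]])
       (use r[of k] in \<open>auto intro!: mult_right_mono norm_fourier_coeff_le[OF cf]\<close>)
  define c where "c k m = P k (int m)" for k m
  have sc: "summable (\<lambda>m. norm (c k m))" for k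
  proof -
    have "(\<lambda>m. norm (P k m)) summable_on range int" by (rule summable_on_subset_banach[OF sP]) auto
    then have "(\<lambda>m. norm (c k m)) summable_on UNIV"
      by (subst (asm) summable_on_reindex) (auto simp: o_def c_def)
    then show ?thesis by (rule summable_on_UNIV_nonneg_real_iff[THEN iffD1, rotated]) auto
  qed
  \<comment> \<open>The non-analytic part. Removing it leaves a series over nonnegative frequencies,
    and changes the \<open>L\<^sup>1\<close> norm by at most 2 pi T, uniformly in k.\<close>
  define N where "N k m = (if m < 0 then P k m else 0)" for k m
  have Nle: "norm (N k m) \<le> A * K * Z * q m" for k m
  proof -
    have "norm (P k m) \<le> norm (F k m)"
      unfolding P_def norm_mult by (rule mult_right_le_one_le) (auto simp: cr)
    moreover have "0 \<le> A * K * Z * q m"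
      unfolding Z_def by (intro mult_nonneg_nonneg A K q infsum_nonneg)
    ultimately show ?thesis using Fneg[of m k] by (auto simp: N_def)
  qed
  have sT: "(\<lambda>m. A * K * Z * q m) summable_on UNIV" by (intro summable_on_cmult_right q)
  have sN: "(\<lambda>m. norm (N k m)) summable_on UNIV" for k
    by (rule summable_on_comparison_test[OF sT]) (use Nle in auto)
  have split: "trig_series (nonneg_ext (c k)) \<theta> = trig_series (P k) \<theta> - trig_series (N k) \<theta>" for k \<theta>
  proof -
    have "((\<lambda>n. nonneg_ext (c k) n * cis (of_int n * \<theta>) + N k n * cis (of_int n * \<theta>)) has_sum
        (trig_series (nonneg_ext (c k)) \<theta> + trig_series (N k) \<theta>)) UNIV"
      by (intro has_sum_add trig_series_has_sum summable_nonneg_ext sc sN)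
    then have "((\<lambda>n. P k n * cis (of_int n * \<theta>)) has_sum (trig_series (nonneg_ext (c k)) \<theta> + trig_series (N k) \<theta>)) UNIV"
      by (rule has_sum_cong[THEN iffD1, rotated]) (auto simp: nonneg_ext_def c_def N_def)
    from has_sum_unique[OF this trig_series_has_sum[OF sP]] show ?thesis by (simp add: eq_diff_eq)
  qed
  have Nb: "norm (trig_series (N k) \<theta>) \<le> T" for k \<theta>
    unfolding trig_series_def T_def
    by (rule norm_infsum_le_infsum[OF _ sT]) (use Nle in \<open>simp add: norm_mult\<close>)
  have int: "integral ?W (\<lambda>\<theta>. norm (trig_series (nonneg_ext (c k)) \<theta>)) \<le> L + 2 * pi * T" for k
  proof -
    have "integral ?W (\<lambda>\<theta>. norm (trig_series (nonneg_ext (c k)) \<theta>)) \<le> integral ?W (\<lambda>\<theta>. norm (trig_series (P k) \<theta>) + T)"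
    proof (intro integral_le integrable_continuous_interval continuous_intros sP summable_nonneg_ext sc)
      fix \<theta>
      show "norm (trig_series (nonneg_ext (c k)) \<theta>) \<le> norm (trig_series (P k) \<theta>) + T"
        unfolding split using Nb[of k \<theta>] norm_triangle_ineq4[of "trig_series (P k) \<theta>" "trig_series (N k) \<theta>"] by linarith
    qed
    also have "\<dots> = integral ?W (\<lambda>\<theta>. norm (trig_series (P k) \<theta>)) + 2 * pi * T"
      by (subst integral_add) (auto intro!: integrable_continuous_interval continuous_intros sP)
    also have "integral ?W (\<lambda>\<theta>. norm (trig_series (P k) \<theta>)) \<le> integral ?W (\<lambda>t. norm (f k t))"
      unfolding P_def[abs_def] F_def by (rule poisson_L1_contraction[OF cf]) (use r[of k] in auto)
    also have "\<dots> \<le> L" unfolding f_def e_def by (rule bound[OF r])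
    finally show ?thesis by simp
  qed
  have lim: "(\<lambda>k. c k m) \<longlonglongrightarrow> (\<Sum>\<^sub>\<infinity>n. nonneg_ext a n * X (int m - n))" for m
  proof -
    have "(\<lambda>k. F k (int m)) \<longlonglongrightarrow> (\<Sum>\<^sub>\<infinity>n. nonneg_ext a n * X (int m - n))"
      unfolding F
    proof (rule infsum_dominated_limit)
      show "(\<lambda>n. A * (K * q (int m - n))) summable_on UNIV" by (intro summable_on_cmult_right qshift)
      show "norm (e k n * X (int m - n)) \<le> A * (K * q (int m - n))" for k n
        unfolding e_def by (rule extX[OF cr])
      fix n
      have "(\<lambda>k. a (nat n) * of_real (r k) ^ nat n) \<longlonglongrightarrow> a (nat n) * of_real 1 ^ nat n"
        by (intro tendsto_mult tendsto_power tendsto_of_real tendsto_const r1)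
      then have "(\<lambda>k. e k n) \<longlonglongrightarrow> nonneg_ext a n"
        by (auto simp: e_def nonneg_ext_def)
      then show "(\<lambda>k. e k n * X (int m - n)) \<longlonglongrightarrow> nonneg_ext a n * X (int m - n)"
        by (rule tendsto_mult_right)
    qed
    then have "(\<lambda>k. F k (int m) * of_real (r k) ^ m) \<longlonglongrightarrow> (\<Sum>\<^sub>\<infinity>n. nonneg_ext a n * X (int m - n)) * of_real 1 ^ m"
      by (intro tendsto_mult tendsto_power tendsto_of_real r1)
    then show ?thesis by (simp add: c_def P_def)
  qed
  show ?thesis by (rule coeffs_limit_tendsto_0[OF sc int lim])
qed

lemma right_limit_bounded:
  assumes "right_limit a b" "\<And>k. norm (a k) \<le> A"
  shows "norm (b n) \<le> A"
proof -
  obtain k where "(\<lambda>j. a (nat (n + int (k j)))) \<longlonglongrightarrow> b n"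
    using assms(1) by (auto simp: right_limit_def)
  then show ?thesis by (rule Lim_norm_ubound[rotated]) (auto simp: assms(2))
qed

text \<open>The two-sided series of a right limit vanishes, in the sense of distributions, where \<open>\<phi>\<close> lives.\<close>

lemma right_limit_annihilates:
  fixes X :: "int \<Rightarrow> complex"
  assumes rl: "right_limit a b" and a: "\<And>k. norm (a k) \<le> A"
    and X: "(\<lambda>m. norm (X m)) summable_on UNIV"
    and lim: "(\<lambda>m::nat. \<Sum>\<^sub>\<infinity>k. nonneg_ext a k * X (int m - k)) \<longlonglongrightarrow> 0"
  shows "(\<Sum>\<^sub>\<infinity>l. b l * X (n - l)) = 0"
proof -
  obtain k where k: "strict_mono k" "\<And>n. (\<lambda>j. a (nat (n + int (k j)))) \<longlonglongrightarrow> b n"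
    using rl by (auto simp: right_limit_def)
  have A: "A \<ge> 0" by (rule order_trans[OF norm_ge_zero a[of 0]])
  have kinf: "filterlim k at_top sequentially" using k(1) by (rule filterlim_subseq)
  have ev: "\<forall>\<^sub>F j in sequentially. l + int (k j) \<ge> 0" for l
    using eventually_compose_filterlim[OF eventually_ge_at_top[of "nat (- l)"] kinf]
    by (rule eventually_mono) auto
  have "(\<lambda>j. \<Sum>\<^sub>\<infinity>l. nonneg_ext a (l + int (k j)) * X (n - l)) \<longlonglongrightarrow> (\<Sum>\<^sub>\<infinity>l. b l * X (n - l))"
  proof (rule infsum_dominated_limit)
    have "(\<lambda>l. norm (X (n - l))) summable_on UNIV"
      using summable_on_reindex_bij_betw[OF bij_minus_int[of n], of "\<lambda>m. norm (X m)"] X by simp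
    then show "(\<lambda>l. A * norm (X (n - l))) summable_on UNIV" by (rule summable_on_cmult_right)
    show "norm (nonneg_ext a (l + int (k j)) * X (n - l)) \<le> A * norm (X (n - l))" for j l
      using a A by (auto simp: norm_mult nonneg_ext_def intro!: mult_right_mono)
    fix l
    \<comment> \<open>At negative indices \<open>nonneg_ext\<close> gives 0, whereas
      \<open>nat\<close> in \<open>right_limit\<close> gives \<open>a 0\<close>; the two agree as
      soon as \<open>l + int (k j)\<close> is nonnegative.\<close>
    have "(\<lambda>j. nonneg_ext a (l + int (k j))) \<longlonglongrightarrow> b l"
      by (rule Lim_transform_eventually[OF k(2)[of l] eventually_mono[OF ev[of l]]]) (simp add: nonneg_ext_def)
    then show "(\<lambda>j. nonneg_ext a (l + int (k j)) * X (n - l)) \<longlonglongrightarrow> b l * X (n - l)"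
      by (rule tendsto_mult_right)
  qed
  \<comment> \<open>Reindexed by i = l + k j, the same sums are the localized coefficients at n + k
    j, taken from a null sequence at indices that tend to infinity.\<close>
  moreover have "(\<lambda>j. \<Sum>\<^sub>\<infinity>l. nonneg_ext a (l + int (k j)) * X (n - l)) \<longlonglongrightarrow> 0"
  proof (rule Lim_transform_eventually)
    have "filterlim (\<lambda>j. nat (n + int (k j))) at_top sequentially"
      unfolding filterlim_at_top
    proof
      fix Z
      show "\<forall>\<^sub>F j in sequentially. Z \<le> nat (n + int (k j))"
        using ev[of "n - int Z"] by (rule eventually_mono) auto
    qed
    then show "(\<lambda>j. \<Sum>\<^sub>\<infinity>i. nonneg_ext a i * X (int (nat (n + int (k j))) - i)) \<longlonglongrightarrow> 0"
      by (rule filterlim_compose[OF lim])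
    show "\<forall>\<^sub>F j in sequentially. (\<Sum>\<^sub>\<infinity>i. nonneg_ext a i * X (int (nat (n + int (k j))) - i)) = (\<Sum>\<^sub>\<infinity>l. nonneg_ext a (l + int (k j)) * X (n - l))"
      using ev[of n]
    proof eventually_elim
      case (elim j)
      have "(\<Sum>\<^sub>\<infinity>l. nonneg_ext a (l + int (k j)) * X (n + int (k j) - (l + int (k j)))) = (\<Sum>\<^sub>\<infinity>i. nonneg_ext a i * X (n + int (k j) - i))"
        by (rule infsum_reindex_bij_betw[of "\<lambda>l. l + int (k j)" UNIV UNIV "\<lambda>i. nonneg_ext a i * X (n + int (k j) - i)"])
           (auto intro!: bij_betw_byWitness[of _ "\<lambda>l. l - int (k j)"])
      with elim show ?case by simp
    qed
  qed
  ultimately show ?thesis by (rule LIMSEQ_unique)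
qed

section \<open>Smooth periodic cut-off functions\<close>

text \<open>Recursion over a derivative turns the closure rules below into inductions on k with
  arbitrary f. The type class covers both the real functions that build the cut-off and the complex
  ones in the Fourier integrals.\<close>

primrec periodic_Ck :: "nat \<Rightarrow> (real \<Rightarrow> 'a::real_normed_field) \<Rightarrow> bool" where
  "periodic_Ck 0 f \<longleftrightarrow> continuous_on UNIV f \<and> (\<forall>x. f (x + 2*pi) = f x)"
| "periodic_Ck (Suc k) f \<longleftrightarrow> (\<forall>x. f (x + 2*pi) = f x) \<and>
     (\<exists>f'. (\<forall>x. (f has_vector_derivative f' x) (at x)) \<and> periodic_Ck k f')"

lemma periodic_Ck_periodic: "periodic_Ck k f \<Longrightarrow> f (x + 2*pi) = f x"
  by (cases k) auto

lemma periodic_Ck_SucI: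
  assumes "\<And>x. (f has_vector_derivative f' x) (at x)" "periodic_Ck k f'" "\<And>x. f (x + 2*pi) = f x"
  shows "periodic_Ck (Suc k) f"
  using assms by (simp del: periodic_Ck.simps(1)) blast

lemma periodic_Ck_SucE:
  assumes "periodic_Ck (Suc k) f"
  obtains f' where "\<forall>x. (f has_vector_derivative f' x) (at x)" "periodic_Ck k f'"
  using assms by auto

lemma periodic_Ck_continuous: "periodic_Ck k f \<Longrightarrow> continuous_on S f"
  by (cases k) (auto intro: continuous_on_subset has_vector_derivative_continuous continuous_at_imp_continuous_on)

lemma periodic_Ck_Suc_imp: "periodic_Ck (Suc k) f \<Longrightarrow> periodic_Ck k f"
proof (induction k arbitrary: f)
  case 0
  then show ?case using periodic_Ck_continuous[OF 0] periodic_Ck_periodic[OF 0] by simp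
next
  case (Suc k)
  then obtain f' where "\<forall>x. (f has_vector_derivative f' x) (at x)" "periodic_Ck (Suc k) f'" by auto
  with Suc show ?case by auto
qed

lemma periodic_Ck_const: "periodic_Ck k (\<lambda>_. c)"
  by (induction k arbitrary: c) (auto intro!: exI[of _ "\<lambda>_. 0"])

lemma periodic_Ck_add: "periodic_Ck k f \<Longrightarrow> periodic_Ck k g \<Longrightarrow> periodic_Ck k (\<lambda>x. f x + g x)"
proof (induction k arbitrary: f g)
  case (Suc k)
  obtain f' where "\<forall>x. (f has_vector_derivative f' x) (at x)" and f'k: "periodic_Ck k f'"
    using periodic_Ck_SucE[OF Suc.prems(1)] by blast
  then have f': "\<And>x. (f has_vector_derivative f' x) (at x)" "periodic_Ck k f'" by auto
  obtain g' where "\<forall>x. (g has_vector_derivative g' x) (at x)" and g'k: "periodic_Ck k g'"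
    using periodic_Ck_SucE[OF Suc.prems(2)] by blast
  then have g': "\<And>x. (g has_vector_derivative g' x) (at x)" "periodic_Ck k g'" by auto
  show ?case
    by (rule periodic_Ck_SucI[OF has_vector_derivative_add[OF f'(1) g'(1)] Suc.IH[OF f'(2) g'(2)]])
       (simp add: Suc.prems[THEN periodic_Ck_periodic])
qed (auto intro!: continuous_intros)

lemma periodic_Ck_mult: "periodic_Ck k f \<Longrightarrow> periodic_Ck k g \<Longrightarrow> periodic_Ck k (\<lambda>x. f x * g x)"
proof (induction k arbitrary: f g)
  case (Suc k)
  obtain f' where "\<forall>x. (f has_vector_derivative f' x) (at x)" and f'k: "periodic_Ck k f'"
    using periodic_Ck_SucE[OF Suc.prems(1)] by blast
  then have f': "\<And>x. (f has_vector_derivative f' x) (at x)" "periodic_Ck k f'" by auto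
  obtain g' where "\<forall>x. (g has_vector_derivative g' x) (at x)" and g'k: "periodic_Ck k g'"
    using periodic_Ck_SucE[OF Suc.prems(2)] by blast
  then have g': "\<And>x. (g has_vector_derivative g' x) (at x)" "periodic_Ck k g'" by auto
  have "periodic_Ck k (\<lambda>x. f x * g' x + f' x * g x)"
    by (intro periodic_Ck_add Suc.IH f'k g'k Suc.prems[THEN periodic_Ck_Suc_imp])
  then show ?case
    by (rule periodic_Ck_SucI[OF has_vector_derivative_mult[OF f'(1) g'(1)]])
       (simp add: Suc.prems[THEN periodic_Ck_periodic])
qed (auto intro!: continuous_intros)

lemma has_vector_derivative_inverse_field:
  fixes f :: "real \<Rightarrow> 'a::real_normed_field"
  assumes "(f has_vector_derivative f') (at x within S)" "f x \<noteq> 0"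
  shows "((\<lambda>x. inverse (f x)) has_vector_derivative - (f' * (inverse (f x) * inverse (f x)))) (at x within S)"
  using Deriv.has_derivative_inverse[OF assms(2) assms(1)[unfolded has_vector_derivative_def]]
  unfolding has_vector_derivative_def by (simp add: algebra_simps)

lemma periodic_Ck_inverse:
  assumes "periodic_Ck k f" "\<And>x. f x \<noteq> 0"
  shows "periodic_Ck k (\<lambda>x. inverse (f x))"
  using assms(1)
proof (induction k)
  case 0
  then show ?case using assms(2) by (auto intro!: continuous_intros)
next
  case (Suc k)
  obtain f' where "\<forall>x. (f has_vector_derivative f' x) (at x)" and f'k: "periodic_Ck k f'"
    using periodic_Ck_SucE[OF Suc.prems] by blast
  then have f': "\<And>x. (f has_vector_derivative f' x) (at x)" "periodic_Ck k f'" by auto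
  have "periodic_Ck k (\<lambda>x. (- 1) * (f' x * (inverse (f x) * inverse (f x))))"
    by (intro periodic_Ck_mult periodic_Ck_const Suc.IH Suc.prems[THEN periodic_Ck_Suc_imp] f'k)
  moreover have "((\<lambda>x. inverse (f x)) has_vector_derivative (- 1) * (f' x * (inverse (f x) * inverse (f x)))) (at x)" for x
    using has_vector_derivative_inverse_field[OF f'(1) assms(2)] by simp
  ultimately show ?case
    by (intro periodic_Ck_SucI) (simp_all add: Suc.prems[THEN periodic_Ck_periodic])
qed

lemma periodic_Ck_of_real:
  "periodic_Ck k f \<Longrightarrow> periodic_Ck k (\<lambda>x. of_real (f x) :: complex)"
proof (induction k arbitrary: f)
  case (Suc k)
  obtain f' where "\<forall>x. (f has_vector_derivative f' x) (at x)" and f'k: "periodic_Ck k f'"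
    using periodic_Ck_SucE[OF Suc.prems] by blast
  then have f': "\<And>x. (f has_vector_derivative f' x) (at x)" "periodic_Ck k f'" by auto
  have "((\<lambda>x. complex_of_real (f x)) has_vector_derivative of_real (f' x)) (at x)" for x
    by (rule has_vector_derivative_of_real) (use f' in \<open>simp add: has_real_derivative_iff_has_vector_derivative\<close>)
  then show ?case
    by (rule periodic_Ck_SucI[OF _ Suc.IH[OF f'(2)]]) (simp add: Suc.prems[THEN periodic_Ck_periodic])
qed (auto intro!: continuous_intros)

text \<open>Differentiation shifts the phase by a quarter period, so the family over all t is closed
  under it.\<close>

lemma periodic_Ck_cos: "periodic_Ck k (\<lambda>x. cos (x - t) :: real)"
proof (induction k arbitrary: t)
  case 0
  have "cos (x + 2*pi - t) = cos (x - t)" for x using cos_periodic[of "x - t"] by (simp add: algebra_simps)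
  then show ?case by (auto intro!: continuous_intros)
next
  case (Suc k)
  have "((\<lambda>x. cos (x - t)) has_vector_derivative cos (x - (t - pi/2))) (at x)" for x
  proof -
    have "cos (x - (t - pi/2)) = - sin (x - t)" using cos_add[of "x - t" "pi/2"] by (simp add: algebra_simps)
    then show ?thesis
      unfolding has_real_derivative_iff_has_vector_derivative[symmetric]
      by (auto intro!: derivative_eq_intros)
  qed
  moreover have "cos (x + 2*pi - t) = cos (x - t)" for x using cos_periodic[of "x - t"] by (simp add: algebra_simps)
  ultimately show ?case by (rule periodic_Ck_SucI[OF _ Suc.IH])
qed

lemma DERIV_max_power:
  "((\<lambda>x::real. max 0 x ^ Suc (Suc n)) has_real_derivative real (Suc (Suc n)) * max 0 x ^ Suc n) (at x)"
proof (cases x "0::real" rule: linorder_cases)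
  case greater
  have "((\<lambda>x::real. x ^ Suc (Suc n)) has_real_derivative real (Suc (Suc n)) * max 0 x ^ Suc n) (at x)"
    using DERIV_pow[of "Suc (Suc n)" x] greater by simp
  then show ?thesis
    by (rule DERIV_cong_ev[THEN iffD1, rotated 3])
       (use greater in \<open>auto intro!: eventually_nhds_in_open[of "{0<..}", THEN eventually_mono]\<close>)
next
  case less
  have "((\<lambda>x::real. 0) has_real_derivative real (Suc (Suc n)) * max 0 x ^ Suc n) (at x)"
    using less by simp
  then show ?thesis
    by (rule DERIV_cong_ev[THEN iffD1, rotated 3])
       (use less in \<open>auto intro!: eventually_nhds_in_open[of "{..<0}", THEN eventually_mono]\<close>)
next
  case equal
  have "((\<lambda>h::real. max 0 h ^ Suc (Suc n) / h) \<longlongrightarrow> 0) (at 0)"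
  proof (rule tendsto_0_le[where K = 1 and f = "\<lambda>h. h ^ Suc n"])
    show "((\<lambda>h::real. h ^ Suc n) \<longlongrightarrow> 0) (at 0)" by (auto intro!: tendsto_eq_intros)
    show "\<forall>\<^sub>F h in at (0::real). norm (max 0 h ^ Suc (Suc n) / h) \<le> norm (h ^ Suc n) * 1"
      by (rule always_eventually) (auto simp: max_def)
  qed
  then show ?thesis using equal by (simp add: DERIV_def)
qed

text \<open>Each differentiation lowers the exponent by one; starting from k + 1, a continuous
  positive part is still there after k of them.\<close>

lemma periodic_Ck_max_power:
  assumes "periodic_Ck k f"
  shows "periodic_Ck k (\<lambda>x. max 0 (f x) ^ Suc k :: real)"
  using assms
proof (induction k)
  case 0
  then show ?case by (auto intro!: continuous_intros)
next
  case (Suc k)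
  obtain f' where "\<forall>x. (f has_vector_derivative f' x) (at x)" and f'k: "periodic_Ck k f'"
    using periodic_Ck_SucE[OF Suc.prems] by blast
  then have f': "\<And>x. (f has_vector_derivative f' x) (at x)" "periodic_Ck k f'" by auto
  have "periodic_Ck k (\<lambda>x. real (Suc (Suc k)) * max 0 (f x) ^ Suc k * f' x)"
    by (intro periodic_Ck_mult periodic_Ck_const Suc.IH Suc.prems[THEN periodic_Ck_Suc_imp] f'k)
  moreover have "((\<lambda>x. max 0 (f x) ^ Suc (Suc k)) has_vector_derivative real (Suc (Suc k)) * max 0 (f x) ^ Suc k * f' x) (at x)" for x
    using DERIV_chain2[OF DERIV_max_power, of f "f' x" x UNIV k] f'(1)[of x]
    by (simp add: has_real_derivative_iff_has_vector_derivative)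
  ultimately show ?case
    by (intro periodic_Ck_SucI) (simp_all only: Suc.prems[THEN periodic_Ck_periodic])
qed

text \<open>The quotient u / (u + v), with u vanishing far from t and v vanishing near t; the
  denominator is positive because these two regions are disjoint. Measuring distance by
  \<open>cos (x - t)\<close> makes periodicity automatic.\<close>

lemma periodic_bump:
  assumes d: "0 < d'" "d' < d" "d \<le> pi"
  obtains \<phi> :: "real \<Rightarrow> real" where "periodic_Ck 4 \<phi>" "\<And>x. 0 \<le> \<phi> x" "\<And>x. \<phi> x \<le> 1"
    "\<And>x. cos (x - t) \<ge> cos d' \<Longrightarrow> \<phi> x = 1" "\<And>x. cos (x - t) \<le> cos d \<Longrightarrow> \<phi> x = 0"
proof -
  define u where "u x = max 0 (cos (x - t) + (- cos d)) ^ Suc 4" for x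
  define v where "v x = max 0 ((- 1) * cos (x - t) + cos d') ^ Suc 4" for x
  have lt: "cos d < cos d'" using d by (intro cos_monotone_0_pi) auto
  have pos: "u x + v x > 0" for x
  proof (cases "cos (x - t) > cos d")
    case True
    then have "u x > 0" by (simp add: u_def)
    then show ?thesis by (simp add: v_def add_pos_nonneg)
  next
    case False
    then have "v x > 0" using lt by (simp add: v_def)
    then show ?thesis by (simp add: u_def add_nonneg_pos)
  qed
  have nn: "u x \<ge> 0" "v x \<ge> 0" for x by (auto simp: u_def v_def)
  have cu: "periodic_Ck 4 u" unfolding u_def
    by (intro periodic_Ck_max_power periodic_Ck_add periodic_Ck_cos periodic_Ck_const)
  have cv: "periodic_Ck 4 v" unfolding v_def
    by (intro periodic_Ck_max_power periodic_Ck_add periodic_Ck_mult periodic_Ck_cos periodic_Ck_const)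
  show ?thesis
  proof (rule that[of "\<lambda>x. u x * inverse (u x + v x)"])
    show "periodic_Ck 4 (\<lambda>x. u x * inverse (u x + v x))"
      using pos by (intro periodic_Ck_mult periodic_Ck_inverse periodic_Ck_add cu cv) (metis less_irrefl)
    fix x
    show "0 \<le> u x * inverse (u x + v x)" using nn[of x] pos[of x] by simp
    show "u x * inverse (u x + v x) \<le> 1" using nn[of x] pos[of x] by (simp add: field_simps)
    show "u x * inverse (u x + v x) = 1" if "cos (x - t) \<ge> cos d'"
    proof -
      have "v x = 0" using that by (simp add: v_def)
      then show ?thesis using pos[of x] by simp
    qed
    show "u x * inverse (u x + v x) = 0" if "cos (x - t) \<le> cos d"
      using that by (simp add: u_def)
  qed
qed

text \<open>Integration by parts over a full period; periodicity cancels the boundary terms.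
  Integrability of the left-hand function is part of the conclusion, so a derivative of unknown
  continuity is admissible.\<close>

lemma integral_deriv_cis:
  fixes f :: "real \<Rightarrow> complex"
  assumes f: "\<And>x. (f has_vector_derivative f' x) (at x)" and per: "f (s + 2*pi) = f s"
  shows "((\<lambda>\<theta>. f' \<theta> * cis (- (of_int m * \<theta>))) has_integral
           \<i> * of_int m * integral {s..s + 2*pi} (\<lambda>\<theta>. f \<theta> * cis (- (of_int m * \<theta>)))) {s..s + 2*pi}"
proof -
  have cf: "continuous_on T f" for T
    by (auto intro!: continuous_at_imp_continuous_on has_vector_derivative_continuous f)
  let ?e = "\<lambda>\<theta>. cis (- (of_int m * \<theta>))"
  have de: "(?e has_vector_derivative - (\<i> * of_int m) * ?e x) (at x)" for x
  proof -
    have "((\<lambda>\<theta>. exp (- (\<i> * of_int m * \<theta>))) has_field_derivative - (\<i> * of_int m) * exp (- (\<i> * of_int m * of_real x))) (at (of_real x))"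
      by (auto intro!: derivative_eq_intros)
    from has_vector_derivative_real_field[OF this]
    show ?thesis by (simp add: cis_conv_exp mult_ac)
  qed
  have per_e: "?e (s + 2*pi) = ?e s"
  proof -
    have "cis (- (of_int m * (s + 2*pi))) = cis (- (of_int m * s)) * cis (2 * pi * of_int (- m))"
      by (simp add: cis_mult algebra_simps)
    also have "cis (2 * pi * of_int (- m)) = 1" by (rule cis_multiple_2pi) auto
    finally show ?thesis by simp
  qed
  have "((\<lambda>x. f x * (- (\<i> * of_int m) * ?e x) + f' x * ?e x) has_integral (f (s + 2*pi) * ?e (s + 2*pi) - f s * ?e s)) {s..s + 2*pi}"
    by (rule fundamental_theorem_of_calculus)
       (simp, rule has_vector_derivative_mult[OF has_vector_derivative_at_within[OF f] has_vector_derivative_at_within[OF de]])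
  then have 1: "((\<lambda>x. f x * (- (\<i> * of_int m) * ?e x) + f' x * ?e x) has_integral 0) {s..s + 2*pi}"
    by (simp only: per per_e diff_self)
  have "((\<lambda>x. f x * ?e x) has_integral integral {s..s + 2*pi} (\<lambda>x. f x * ?e x)) {s..s + 2*pi}"
    by (intro integrable_integral integrable_continuous_interval continuous_intros cf)
  from has_integral_add[OF 1 has_integral_mult_right[OF this, of "\<i> * of_int m"]]
  show ?thesis by (simp add: algebra_simps)
qed

lemma fourier_coeff_deriv:
  fixes f :: "real \<Rightarrow> complex"
  assumes "\<And>x. (f has_vector_derivative f' x) (at x)" "f (s + 2*pi) = f s"
  shows "fourier_coeff s f' m = \<i> * of_int m * fourier_coeff s f m"
  using integral_unique[OF integral_deriv_cis[OF assms]] by (simp add: fourier_coeff_def)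

lemma periodic_Ck_fourier_decay:
  assumes "periodic_Ck k f"
  shows "\<exists>K. \<forall>m. norm (fourier_coeff s f m) * \<bar>of_int m\<bar> ^ k \<le> K"
  using assms
proof (induction k arbitrary: f)
  case 0
  then have "continuous_on {s..s + 2*pi} f" by (rule periodic_Ck_continuous)
  from norm_fourier_coeff_le[OF this] show ?case by auto
next
  case (Suc k)
  obtain f' where "\<forall>x. (f has_vector_derivative f' x) (at x)" and f'k: "periodic_Ck k f'"
    using periodic_Ck_SucE[OF Suc.prems] by blast
  then have f': "\<And>x. (f has_vector_derivative f' x) (at x)" "periodic_Ck k f'" by auto
  obtain K where "\<And>m. norm (fourier_coeff s f' m) * \<bar>of_int m\<bar> ^ k \<le> K" using Suc.IH[OF f'(2)] by blast
  moreover have "f (s + 2*pi) = f s" by (rule periodic_Ck_periodic[OF Suc.prems])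
  ultimately show ?case
    by (intro exI[of _ K]) (simp add: fourier_coeff_deriv[OF f'(1)] norm_mult mult_ac)
qed

lemma periodic_Ck4_fourier_decay:
  assumes "periodic_Ck 4 f"
  obtains K where "\<And>m. norm (fourier_coeff s f m) \<le> K / (1 + \<bar>real_of_int m\<bar>) ^ 4"
proof -
  obtain K where K: "\<And>m. norm (fourier_coeff s f m) * \<bar>of_int m\<bar> ^ 4 \<le> K"
    using periodic_Ck_fourier_decay[OF assms] by blast
  have K0: "K \<ge> 0" using order_trans[OF _ K[of 0]] by simp
  \<comment> \<open>The constant 16 = 2^4 comes from 1 + |m| <= 2 |m| for nonzero m; the second
    summand covers m = 0.\<close>
  have "norm (fourier_coeff s f m) \<le> (16 * K + norm (fourier_coeff s f 0)) / (1 + \<bar>real_of_int m\<bar>) ^ 4" for m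
  proof (cases "m = 0")
    case True
    then show ?thesis using K0 by simp
  next
    case False
    then have "1 + \<bar>real_of_int m\<bar> \<le> 2 * \<bar>real_of_int m\<bar>" by auto
    then have "(1 + \<bar>real_of_int m\<bar>) ^ 4 \<le> (2 * \<bar>real_of_int m\<bar>) ^ 4" by (rule power_mono) auto
    then have "norm (fourier_coeff s f m) * (1 + \<bar>real_of_int m\<bar>) ^ 4 \<le> norm (fourier_coeff s f m) * (2 * \<bar>real_of_int m\<bar>) ^ 4"
      by (rule mult_left_mono) auto
    also have "\<dots> = 16 * (norm (fourier_coeff s f m) * \<bar>real_of_int m\<bar> ^ 4)" by (simp add: power_mult_distrib)
    also have "\<dots> \<le> 16 * K + norm (fourier_coeff s f 0)" using K[of m] by (simp add: add_increasing2)
    finally show ?thesis by (subst pos_le_divide_eq) (auto intro!: zero_less_power add_pos_nonneg)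
  qed
  then show ?thesis by (rule that)
qed

section \<open>The cut-off Cauchy kernel\<close>

lemma deriv_eq_0_on_open:
  fixes f :: "real \<Rightarrow> complex"
  assumes "(f has_vector_derivative f') (at x)" "open G" "x \<in> G" "\<And>y. y \<in> G \<Longrightarrow> f y = 0"
  shows "f' = 0"
proof (rule vector_derivative_unique_at[OF assms(1)])
  show "(f has_vector_derivative 0) (at x)"
    by (rule has_vector_derivative_transform_within_open[OF has_vector_derivative_const[of 0] assms(2,3)])
       (use assms(4) in auto)
qed

text \<open>The quotient is smooth although \<open>d\<close> may vanish, because \<open>f\<close> vanishes near the zeros of \<open>d\<close>.\<close>

lemma has_vector_derivative_cutoff_quotient:
  fixes f d :: "real \<Rightarrow> complex"
  assumes f: "(f has_vector_derivative f') (at x)" and d: "(d has_vector_derivative d') (at x)"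
    and G: "open G" "\<And>y. y \<in> G \<Longrightarrow> f y = 0" and nz: "\<And>y. y \<notin> G \<Longrightarrow> d y \<noteq> 0"
  shows "((\<lambda>x. f x / d x) has_vector_derivative (f' / d x - f x * d' / (d x)\<^sup>2)) (at x)"
proof (cases "x \<in> G")
  case True
  \<comment> \<open>With f' and f x both 0, the claimed derivative is 0 even where
    \<open>d x = 0\<close>.\<close>
  have "f' = 0" by (rule deriv_eq_0_on_open[OF f G(1) True G(2)])
  moreover have "((\<lambda>x. f x / d x) has_vector_derivative 0) (at x)"
    by (rule has_vector_derivative_transform_within_open[OF has_vector_derivative_const[of 0] G(1) True])
       (use G(2) in auto)
  ultimately show ?thesis using G(2)[OF True] by simp
next
  case False
  from has_vector_derivative_mult[OF f has_vector_derivative_inverse_field[OF d nz[OF False]]]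
  show ?thesis by (simp add: divide_inverse power2_eq_square algebra_simps)
qed

text \<open>Two integrations by parts. The bound is uniform over \<open>S\<close> because off
  \<open>G\<close> the denominator has modulus at least \<eta>, and on \<open>G\<close> the kernel
  is 0 together with its derivatives.\<close>

lemma cutoff_kernel_coeff_decay:
  fixes \<psi> :: "real \<Rightarrow> complex"
  assumes psi: "periodic_Ck 2 \<psi>" and G: "open G" "\<And>\<theta>. \<theta> \<in> G \<Longrightarrow> \<psi> \<theta> = 0"
    and eta: "0 < \<eta>" "\<eta> \<le> 1" and far: "\<And>z \<theta>. z \<in> S \<Longrightarrow> \<theta> \<notin> G \<Longrightarrow> \<eta> \<le> norm (1 - z * cis (- \<theta>))"
    and S: "\<And>z. z \<in> S \<Longrightarrow> norm z \<le> 2"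
  shows "\<exists>M. \<forall>z\<in>S. \<forall>l. norm (fourier_coeff s (\<lambda>\<theta>. \<psi> \<theta> / (1 - z * cis (- \<theta>))) l) \<le> M / (1 + \<bar>real_of_int l\<bar>)\<^sup>2"
proof -
  let ?W = "{s..s + 2*pi}"
  have psi2: "periodic_Ck (Suc (Suc 0)) \<psi>" using psi by (simp only: numeral_2_eq_2)
  obtain \<psi>1 where p1a: "\<forall>x. (\<psi> has_vector_derivative \<psi>1 x) (at x)" and p1b: "periodic_Ck (Suc 0) \<psi>1"
    using periodic_Ck_SucE[OF psi2] by blast
  obtain \<psi>2 where p2a: "\<forall>x. (\<psi>1 has_vector_derivative \<psi>2 x) (at x)" and p2b: "periodic_Ck 0 \<psi>2"
    using periodic_Ck_SucE[OF p1b] by blast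
  have bdd: "\<exists>B. \<forall>x\<in>?W. norm (f x) \<le> B" if "periodic_Ck k f" for f :: "real \<Rightarrow> complex" and k
  proof -
    have "bounded (f ` ?W)"
      by (intro compact_imp_bounded compact_continuous_image periodic_Ck_continuous[OF that]) auto
    then show ?thesis by (auto simp: bounded_iff)
  qed
  obtain B0 B1 B2 where B012: "\<forall>x\<in>?W. norm (\<psi> x) \<le> B0" "\<forall>x\<in>?W. norm (\<psi>1 x) \<le> B1" "\<forall>x\<in>?W. norm (\<psi>2 x) \<le> B2"
    using bdd[OF psi] bdd[OF p1b] bdd[OF p2b] by auto
  define B where "B = max B0 (max B1 B2)"
  have B: "norm (\<psi> x) \<le> B" "norm (\<psi>1 x) \<le> B" "norm (\<psi>2 x) \<le> B" if "x \<in> ?W" for x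
    using B012 that by (auto simp: B_def le_max_iff_disj)
  have B0: "B \<ge> 0" using order_trans[OF norm_ge_zero B(1)[of s]] by simp
  have z1: "\<psi>1 x = 0" if "x \<in> G" for x
    using deriv_eq_0_on_open[OF p1a[THEN spec] G(1) that G(2)] .
  have z2: "\<psi>2 x = 0" if "x \<in> G" for x
    using deriv_eq_0_on_open[OF p2a[THEN spec] G(1) that z1] .
  \<comment> \<open>15 = 1 + 2 + 2 + 2 + 8, one number for each of the five terms of the second
    derivative; since \<eta> <= 1, the inverse cube of \<eta> dominates all lower powers.\<close>
  define M where "M = 15 * B / \<eta> ^ 3"
  have eta_pow: "x \<le> B * c * inverse (\<eta> ^ 3)" if "x \<le> B * c * inverse D ^ k" "\<eta> \<le> D" "k \<le> 3" "0 \<le> c" for x c D :: real and k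
  proof -
    have "inverse D ^ k \<le> inverse \<eta> ^ k" using that eta by (intro power_mono le_imp_inverse_le) auto
    also have "\<dots> \<le> inverse \<eta> ^ 3" using that eta by (intro power_increasing) (auto simp: one_le_inverse)
    finally have "B * c * inverse D ^ k \<le> B * c * inverse \<eta> ^ 3" using B0 that by (intro mult_left_mono) auto
    then show ?thesis using that by (simp add: power_inverse)
  qed
  have M0: "M \<ge> 0" using B0 eta by (simp add: M_def)
  have key: "norm (fourier_coeff s (\<lambda>\<theta>. \<psi> \<theta> / (1 - z * cis (- \<theta>))) l) \<le> (4 * M) / (1 + \<bar>real_of_int l\<bar>)\<^sup>2"
    if z: "z \<in> S" for z l
  proof -
    define d where "d \<theta> = 1 - z * cis (- \<theta>)" for \<theta>
    define d1 where "d1 \<theta> = \<i> * z * cis (- \<theta>)" for \<theta>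
    define d2 where "d2 \<theta> = z * cis (- \<theta>)" for \<theta>
    have dnz: "d \<theta> \<noteq> 0" "\<eta> \<le> norm (d \<theta>)" if "\<theta> \<notin> G" for \<theta>
      using far[OF z that] eta by (auto simp: d_def)
    have nd: "norm (d1 \<theta>) \<le> 2" "norm (d2 \<theta>) \<le> 2" for \<theta>
      using S[OF z] by (auto simp: d1_def d2_def norm_mult)
    have dcis: "((\<lambda>\<theta>. cis (- \<theta>)) has_vector_derivative - (\<i> * cis (- x))) (at x)" for x
    proof -
      have "((\<lambda>\<theta>. exp (- (\<i> * \<theta>))) has_field_derivative - (\<i> * exp (- (\<i> * of_real x)))) (at (of_real x))"
        by (auto intro!: derivative_eq_intros)
      from has_vector_derivative_real_field[OF this]
      show ?thesis by (simp add: cis_conv_exp)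
    qed
    have dd: "(d has_vector_derivative d1 x) (at x)" for x
      using has_vector_derivative_diff[OF has_vector_derivative_const[of 1] has_vector_derivative_mult[OF has_vector_derivative_const[of z] dcis[of x]]]
      by (simp add: d_def[abs_def] d1_def mult_ac)
    have dd1: "(d1 has_vector_derivative d2 x) (at x)" for x
      using has_vector_derivative_mult[OF has_vector_derivative_const[of "\<i> * z"] dcis[of x]]
      by (simp add: d1_def[abs_def] d2_def algebra_simps)
    define m where "m x = \<psi> x / d x" for x
    define m1 where "m1 x = \<psi>1 x / d x - \<psi> x * d1 x / (d x)\<^sup>2" for x
    \<comment> \<open>The quotient rule with denominators \<open>d\<close> and
      \<open>d\<^sup>2\<close>, left unsimplified so that it has the form delivered by the cut-off
      quotient rule.\<close>
    define m2 where "m2 x = (\<psi>2 x / d x - \<psi>1 x * d1 x / (d x)\<^sup>2)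
        - ((\<psi> x * d2 x + \<psi>1 x * d1 x) / (d x)\<^sup>2 - (\<psi> x * d1 x) * (d x * d1 x + d1 x * d x) / ((d x)\<^sup>2)\<^sup>2)" for x
    have dm: "(m has_vector_derivative m1 x) (at x)" for x
      unfolding m_def m1_def
      by (rule has_vector_derivative_cutoff_quotient[OF p1a[THEN spec] dd G dnz(1)])
    have dm1: "(m1 has_vector_derivative m2 x) (at x)" for x
      unfolding m1_def m2_def
    proof (rule has_vector_derivative_diff)
      show "((\<lambda>x. \<psi>1 x / d x) has_vector_derivative \<psi>2 x / d x - \<psi>1 x * d1 x / (d x)\<^sup>2) (at x)"
        by (rule has_vector_derivative_cutoff_quotient[OF p2a[THEN spec] dd G(1) z1 dnz(1)])
      show "((\<lambda>x. \<psi> x * d1 x / (d x)\<^sup>2) has_vector_derivative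
          (\<psi> x * d2 x + \<psi>1 x * d1 x) / (d x)\<^sup>2 - (\<psi> x * d1 x) * (d x * d1 x + d1 x * d x) / ((d x)\<^sup>2)\<^sup>2) (at x)"
        using has_vector_derivative_mult[OF dd dd, of x] unfolding power2_eq_square[of "d _", symmetric]
        by (intro has_vector_derivative_cutoff_quotient[OF has_vector_derivative_mult[OF p1a[THEN spec] dd1] _ G(1)])
           (auto simp: G(2) dnz(1))
    qed
    have per: "m (s + 2*pi) = m s" "m1 (s + 2*pi) = m1 s"
    proof -
      have "cis (- (s + 2*pi)) = cis (- s) * cis (- (2 * pi))" by (simp add: cis_mult)
      then have "cis (- (s + 2*pi)) = cis (- s)" using cis_multiple_2pi[of "-1"] by simp
      then show "m (s + 2*pi) = m s" "m1 (s + 2*pi) = m1 s"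
        unfolding m_def m1_def d_def d1_def periodic_Ck_periodic[OF psi] periodic_Ck_periodic[OF p1b] by simp_all
    qed
    have nm: "norm (m x) \<le> M" if x: "x \<in> ?W" for x
    proof (cases "x \<in> G")
      case True
      then show ?thesis using M0 G by (simp add: m_def)
    next
      case False
      have "norm (m x) \<le> B * 1 * inverse (norm (d x)) ^ 1"
        using B(1)[OF x] by (simp add: m_def norm_mult norm_inverse divide_inverse mult_right_mono)
      from eta_pow[OF this dnz(2)[OF False]] have "norm (m x) \<le> B * inverse (\<eta> ^ 3)" by simp
      also have "\<dots> \<le> M" using B0 eta by (simp add: M_def divide_inverse)
      finally show ?thesis .
    qed
    have nm2: "norm (m2 x) \<le> M" if x: "x \<in> ?W" for x
    proof (cases "x \<in> G")
      case True
      then show ?thesis using M0 G z1 z2 by (simp add: m2_def)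
    next
      case False
      note D = dnz(2)[OF False] and nz = dnz(1)[OF False]
      define I where "I = inverse (\<eta> ^ 3)"
      have t1: "norm (\<psi>2 x / d x) \<le> B * 1 * I" unfolding I_def
        by (rule eta_pow[OF _ D, of _ _ 1]) (use B(3)[OF x] in \<open>auto simp: norm_mult norm_inverse divide_inverse mult_right_mono\<close>)
      have t: "norm (u * v / (d x)\<^sup>2) \<le> B * 2 * I" if "norm u \<le> B" "norm v \<le> 2" for u v
        unfolding I_def
      proof (rule eta_pow[OF _ D, of _ _ 2])
        have "norm u * norm v \<le> B * 2" using that B0 by (intro mult_mono) auto
        then show "norm (u * v / (d x)\<^sup>2) \<le> B * 2 * inverse (norm (d x)) ^ 2"
          by (simp add: norm_mult norm_divide norm_power norm_inverse divide_inverse power_inverse mult_right_mono)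
      qed auto
      have t5: "norm ((\<psi> x * d1 x) * (d x * d1 x + d1 x * d x) / ((d x)\<^sup>2)\<^sup>2) \<le> B * 8 * I"
        unfolding I_def
      proof (rule eta_pow[OF _ D, of _ _ 3])
        \<comment> \<open>One factor \<open>d\<close> cancels; otherwise an inverse fourth power
          would appear.\<close>
        have eq: "(\<psi> x * d1 x) * (d x * d1 x + d1 x * d x) / ((d x)\<^sup>2)\<^sup>2 = \<psi> x * (2 * (d1 x * d1 x)) / (d x) ^ 3"
          using nz by (simp add: field_simps power2_eq_square power3_eq_cube)
        have "norm (d1 x) * norm (d1 x) \<le> 2 * 2" using nd by (intro mult_mono) auto
        then have "norm (\<psi> x) * (2 * (norm (d1 x) * norm (d1 x))) \<le> B * 8"
          using B(1)[OF x] B0 by (intro mult_mono) auto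
        then show "norm ((\<psi> x * d1 x) * (d x * d1 x + d1 x * d x) / ((d x)\<^sup>2)\<^sup>2) \<le> B * 8 * inverse (norm (d x)) ^ 3"
          unfolding eq by (simp add: norm_mult norm_divide norm_power norm_inverse divide_inverse power_inverse mult_right_mono)
      qed auto
      have "m2 x = \<psi>2 x / d x - \<psi>1 x * d1 x / (d x)\<^sup>2 - \<psi> x * d2 x / (d x)\<^sup>2 - \<psi>1 x * d1 x / (d x)\<^sup>2
         + (\<psi> x * d1 x) * (d x * d1 x + d1 x * d x) / ((d x)\<^sup>2)\<^sup>2"
        by (simp add: m2_def add_divide_distrib)
      moreover have "norm (a1 - a2 - a3 - a2 + a5) \<le> norm a1 + norm a2 + norm a3 + norm a2 + norm a5" for a1 a2 a3 a5 :: complex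
        by norm
      ultimately have "norm (m2 x) \<le> B * 1 * I + B * 2 * I + B * 2 * I + B * 2 * I + B * 8 * I"
        using t1 t[OF B(2)[OF x] nd(1)[of x]] t[OF B(1)[OF x] nd(2)[of x]] t5 by (smt (verit))
      then show ?thesis by (simp add: M_def I_def divide_inverse)
    qed
    have cm: "continuous_on T m" for T
      by (auto intro!: continuous_at_imp_continuous_on has_vector_derivative_continuous dm)
    \<comment> \<open>Boundedness of \<open>m2\<close> and the value of this integral are enough;
      continuity of \<open>m2\<close> is not established.\<close>
    have "norm (\<i> * of_int l * integral ?W (\<lambda>\<theta>. m1 \<theta> * cis (- (of_int l * \<theta>)))) \<le> M * measure lborel (cbox s (s + 2*pi))"
    proof (rule has_integral_bound[OF M0])
      show "((\<lambda>\<theta>. m2 \<theta> * cis (- (of_int l * \<theta>))) has_integral \<i> * of_int l * integral ?W (\<lambda>\<theta>. m1 \<theta> * cis (- (of_int l * \<theta>)))) (cbox s (s + 2*pi))"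
        unfolding interval_cbox[symmetric] by (rule integral_deriv_cis[OF dm1 per(2)])
      show "norm (m2 x * cis (- (of_int l * x))) \<le> M" if "x \<in> cbox s (s + 2*pi)" for x
        using nm2[of x] that by (simp add: norm_mult)
    qed
    then have 1: "norm (\<i> * of_int l * fourier_coeff s m1 l) \<le> M"
      unfolding fourier_coeff_def by (simp add: norm_mult norm_divide field_simps)
    have 2: "fourier_coeff s m1 l = \<i> * of_int l * fourier_coeff s m l"
      by (rule fourier_coeff_deriv[OF dm per(1)])
    have 3: "norm (fourier_coeff s m l) * (real_of_int l)\<^sup>2 \<le> M"
    proof -
      have "norm (\<i> * of_int l * (\<i> * of_int l * fourier_coeff s m l)) = norm (fourier_coeff s m l) * \<bar>real_of_int l\<bar>\<^sup>2"
        by (simp only: norm_mult norm_ii norm_of_int mult_1_left power2_eq_square mult_ac)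
      then show ?thesis using 1 unfolding 2 power2_abs by simp
    qed
    have 4: "norm (fourier_coeff s m l) \<le> M"
    proof -
      have "integral ?W (\<lambda>\<theta>. norm (m \<theta>)) \<le> integral ?W (\<lambda>\<theta>. M)"
        by (intro integral_le integrable_continuous_interval continuous_intros cm nm)
      then have "integral ?W (\<lambda>\<theta>. norm (m \<theta>)) / (2*pi) \<le> M" by (simp add: field_simps)
      then show ?thesis using norm_fourier_coeff_le[OF cm, of s l] by linarith
    qed
    \<comment> \<open>Merges the plain bound \<open>4\<close> with the decay \<open>3\<close>; each
      contributes 2 M.\<close>
    have "(1 + \<bar>real_of_int l\<bar>)\<^sup>2 \<le> 2 + 2 * (real_of_int l)\<^sup>2"
      using sum_squares_bound[of 1 "\<bar>real_of_int l\<bar>"] by (simp add: power2_sum)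
    then have "norm (fourier_coeff s m l) * (1 + \<bar>real_of_int l\<bar>)\<^sup>2 \<le> norm (fourier_coeff s m l) * (2 + 2 * (real_of_int l)\<^sup>2)"
      by (rule mult_left_mono) auto
    also have "\<dots> \<le> 4 * M" using 3 4 by (simp add: algebra_simps)
    finally have "norm (fourier_coeff s m l) \<le> (4 * M) / (1 + \<bar>real_of_int l\<bar>)\<^sup>2"
      by (subst pos_le_divide_eq) (auto intro!: zero_less_power add_pos_nonneg)
    then show ?thesis by (simp add: m_def[abs_def] d_def)
  qed
  show ?thesis by (rule exI[of _ "4 * M"]) (use key in blast)
qed

text \<open>Two open sets cover the domain: \<open>U \<times> G\<close>, where the quotient is 0,
  and the set where the denominator is nonzero. The exponent serves the kernel (k = 1) and its
  z-derivative (k = 2).\<close>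

lemma continuous_on_cutoff_kernel:
  fixes \<psi> :: "real \<Rightarrow> complex"
  assumes psi: "continuous_on UNIV \<psi>" and G: "open G" "\<And>\<theta>. \<theta> \<in> G \<Longrightarrow> \<psi> \<theta> = 0"
    and U: "open U" and far: "\<And>z \<theta>. z \<in> U \<Longrightarrow> \<theta> \<notin> G \<Longrightarrow> 1 - z * cis (- \<theta>) \<noteq> 0"
  shows "continuous_on (U \<times> T) (\<lambda>(z, \<theta>). \<psi> \<theta> / (1 - z * cis (- \<theta>)) ^ k)"
proof -
  define A where "A = {p. 1 - fst p * cis (- snd p) \<noteq> 0}"
  have "open A" unfolding A_def
    by (intro open_Collect_neq continuous_intros)
  moreover have "open (U \<times> G)" by (intro open_Times U G)
  moreover have "continuous_on (U \<times> G) (\<lambda>(z, \<theta>). \<psi> \<theta> / (1 - z * cis (- \<theta>)) ^ k)"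
    by (rule continuous_on_eq[OF continuous_on_const[of _ 0]]) (auto simp: G(2))
  moreover have "continuous_on A (\<lambda>(z, \<theta>). \<psi> \<theta> / (1 - z * cis (- \<theta>)) ^ k)"
    unfolding case_prod_beta
    by (intro continuous_intros continuous_on_compose2[OF psi]) (auto simp: A_def)
  ultimately have "continuous_on (U \<times> G \<union> A) (\<lambda>(z, \<theta>). \<psi> \<theta> / (1 - z * cis (- \<theta>)) ^ k)"
    using continuous_on_open_Un by blast
  moreover have "U \<times> T \<subseteq> U \<times> G \<union> A" using far unfolding A_def by fastforce
  ultimately show ?thesis by (rule continuous_on_subset)
qed

text \<open>Differentiation under the integral sign: the z-derivative of the kernel is again a
  cut-off quotient, with squared denominator.\<close>

lemma cutoff_kernel_coeff_holomorphic:
  fixes \<psi> :: "real \<Rightarrow> complex"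
  assumes psi: "continuous_on UNIV \<psi>" and G: "open G" "\<And>\<theta>. \<theta> \<in> G \<Longrightarrow> \<psi> \<theta> = 0"
    and U: "open U" "convex U" and far: "\<And>z \<theta>. z \<in> U \<Longrightarrow> \<theta> \<notin> G \<Longrightarrow> 1 - z * cis (- \<theta>) \<noteq> 0"
  shows "(\<lambda>z. fourier_coeff s (\<lambda>\<theta>. \<psi> \<theta> / (1 - z * cis (- \<theta>))) l) holomorphic_on U"
proof -
  let ?e = "\<lambda>\<theta>. cis (- (of_int l * \<theta>))"
  have ce: "continuous_on T (\<lambda>p. ?e (snd p))" for T :: "(complex \<times> real) set" by (intro continuous_intros)
  have ck: "continuous_on (U \<times> T) (\<lambda>(z, \<theta>). \<psi> \<theta> / (1 - z * cis (- \<theta>)) ^ k)" for T k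
    by (rule continuous_on_cutoff_kernel[OF psi G(1) _ U(1)]) (use G(2) far in auto)
  have "(\<lambda>z. integral (cbox s (s + 2*pi)) (\<lambda>\<theta>. \<psi> \<theta> / (1 - z * cis (- \<theta>)) * ?e \<theta>)) holomorphic_on U"
  proof (rule leibniz_rule_holomorphic[OF _ _ _ U(2)])
    fix z \<theta> assume z: "z \<in> U" and "\<theta> \<in> cbox s (s + 2*pi)"
    show "((\<lambda>z. \<psi> \<theta> / (1 - z * cis (- \<theta>)) * ?e \<theta>) has_field_derivative
        \<psi> \<theta> / (1 - z * cis (- \<theta>)) ^ 2 * (cis (- \<theta>) * ?e \<theta>)) (at z within U)"
    proof (cases "\<theta> \<in> G")
      case True
      then show ?thesis using G by simp
    next
      case False
      then show ?thesis using far[OF z False]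
        by (auto intro!: derivative_eq_intros simp: power2_eq_square)
    qed
  next
    fix z assume z: "z \<in> U"
    have "continuous_on ({s..s + 2*pi}) (\<lambda>\<theta>. (\<lambda>(z, \<theta>). \<psi> \<theta> / (1 - z * cis (- \<theta>)) ^ 1) (z, \<theta>))"
      by (rule continuous_on_compose2[OF ck[of UNIV 1]]) (use z in \<open>auto intro!: continuous_intros\<close>)
    then show "(\<lambda>\<theta>. \<psi> \<theta> / (1 - z * cis (- \<theta>)) * ?e \<theta>) integrable_on cbox s (s + 2*pi)"
      unfolding interval_cbox[symmetric]
      by (intro integrable_continuous_interval continuous_on_mult) (auto intro!: continuous_intros)
  next
    show "continuous_on (U \<times> cbox s (s + 2*pi)) (\<lambda>(z, \<theta>). \<psi> \<theta> / (1 - z * cis (- \<theta>)) ^ 2 * (cis (- \<theta>) * ?e \<theta>))"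
      unfolding case_prod_beta
      by (intro continuous_on_mult ck[of "cbox s (s + 2*pi)" 2, unfolded case_prod_beta])
         (intro continuous_intros)+
  qed
  then show ?thesis unfolding fourier_coeff_def by (auto intro!: holomorphic_intros)
qed

text \<open>The sum stands for the mean of B times a kernel with Fourier coefficients
  \<open>C z l\<close>, hence the index \<open>- l\<close>. Second order decay makes it a uniform
  limit of finite sums on a smaller closed ball.\<close>

lemma holomorphic_on_pairing:
  fixes b :: "int \<Rightarrow> complex"
  assumes b: "\<And>l. norm (b l) \<le> A" and hol: "\<And>l. (\<lambda>z. C z l) holomorphic_on ball z0 \<eta>"
    and M: "\<And>z l. z \<in> ball z0 \<eta> \<Longrightarrow> norm (C z l) \<le> M / (1 + \<bar>real_of_int l\<bar>)\<^sup>2" and r: "r < \<eta>"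
  shows "(\<lambda>z. \<Sum>\<^sub>\<infinity>l. b (- l) * C z l) holomorphic_on ball z0 r"
proof -
  have A: "A \<ge> 0" by (rule order_trans[OF norm_ge_zero b[of 0]])
  have sub: "cball z0 r \<subseteq> ball z0 \<eta>" "ball z0 r \<subseteq> ball z0 \<eta>" using r by auto
  have ulim: "uniform_limit (cball z0 r) (\<lambda>X z. \<Sum>l\<in>X. b (- l) * C z l) (\<lambda>z. \<Sum>\<^sub>\<infinity>l. b (- l) * C z l) (finite_subsets_at_top UNIV)"
  proof (rule Weierstrass_m_test_general)
    show "(\<lambda>l. A * (M * (1 / (1 + \<bar>real_of_int l\<bar>)\<^sup>2))) summable_on UNIV"
      by (intro summable_on_cmult_right summable_on_inverse_square)
    fix l z assume "z \<in> cball z0 r"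
    then have "z \<in> ball z0 \<eta>" using sub by auto
    then show "norm (b (- l) * C z l) \<le> A * (M * (1 / (1 + \<bar>real_of_int l\<bar>)\<^sup>2))"
      unfolding norm_mult using M[of z l] by (intro mult_mono b A) auto
  qed
  have "(\<lambda>z. \<Sum>l\<in>X. b (- l) * C z l) holomorphic_on ball z0 \<eta>" for X
    by (intro holomorphic_intros hol)
  then have ev: "\<forall>\<^sub>F X in finite_subsets_at_top UNIV. continuous_on (cball z0 r) (\<lambda>z. \<Sum>l\<in>X. b (- l) * C z l) \<and>
      (\<lambda>z. \<Sum>l\<in>X. b (- l) * C z l) holomorphic_on ball z0 r"
    using sub by (intro always_eventually allI conjI)
      (meson holomorphic_on_imp_continuous_on continuous_on_subset, meson holomorphic_on_subset)
  show ?thesis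
    using holomorphic_uniform_limit[OF ev ulim finite_subsets_at_top_neq_bot] by blast
qed

text \<open>Replacing the Cauchy kernel \<open>k = trig_series \<kappa>\<close> by \<open>(1 - \<phi>) k\<close> does not change its pairing with a
  two-sided series annihilated by \<open>\<phi>\<close>.\<close>

lemma pairing_cutoff_kernel:
  fixes b :: "int \<Rightarrow> complex" and \<phi> :: "real \<Rightarrow> complex" and s :: real
  defines "X \<equiv> fourier_coeff s \<phi>"
  assumes b: "\<And>l. norm (b l) \<le> A" and phi: "continuous_on UNIV \<phi>"
    and \<kappa>: "(\<lambda>n. norm (\<kappa> n)) summable_on UNIV" and X: "(\<lambda>m. norm (X m)) summable_on UNIV"
    and ann: "\<And>n. (\<Sum>\<^sub>\<infinity>l. b l * X (n - l)) = 0"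
    and ker: "\<And>\<theta>. trig_series \<kappa> \<theta> * (1 - z * cis (- \<theta>)) = 1"
  shows "(\<Sum>\<^sub>\<infinity>l. b (- l) * fourier_coeff s (\<lambda>\<theta>. (1 - \<phi> \<theta>) / (1 - z * cis (- \<theta>))) l) = (\<Sum>\<^sub>\<infinity>n. b (- n) * \<kappa> n)"
proof -
  let ?W = "{s..s + 2*pi}"
  define V where "V l = (\<Sum>\<^sub>\<infinity>n. \<kappa> n * X (l - n))" for l
  have A: "A \<ge> 0" by (rule order_trans[OF norm_ge_zero b[of 0]])
  have ct: "continuous_on T (trig_series \<kappa>)" for T by (intro continuous_intros \<kappa>)
  have fc: "fourier_coeff s (\<lambda>\<theta>. (1 - \<phi> \<theta>) / (1 - z * cis (- \<theta>))) l = \<kappa> l - V l" for l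
  proof -
    have eq: "(1 - \<phi> \<theta>) / (1 - z * cis (- \<theta>)) = trig_series \<kappa> \<theta> - \<phi> \<theta> * trig_series \<kappa> \<theta>" for \<theta>
    proof -
      have "1 - z * cis (- \<theta>) \<noteq> 0" using ker[of \<theta>] by auto
      then have "trig_series \<kappa> \<theta> = 1 / (1 - z * cis (- \<theta>))" using ker[of \<theta>] by (simp add: eq_divide_eq)
      then show ?thesis by (simp add: diff_divide_distrib)
    qed
    have "fourier_coeff s (\<lambda>\<theta>. trig_series \<kappa> \<theta> - \<phi> \<theta> * trig_series \<kappa> \<theta>) l
        = fourier_coeff s (trig_series \<kappa>) l - fourier_coeff s (\<lambda>\<theta>. \<phi> \<theta> * trig_series \<kappa> \<theta>) l"
      unfolding fourier_coeff_def diff_divide_distrib[symmetric] left_diff_distrib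
      by (subst integral_diff)
         (auto intro!: integrable_continuous_interval continuous_intros ct continuous_on_subset[OF phi])
    also have "\<dots> = \<kappa> l - V l"
      using fourier_coeff_mult_trig_series[OF \<kappa> phi, of s l, THEN infsumI]
      by (simp add: fourier_coeff_trig_series[OF \<kappa>] V_def X_def)
    finally show ?thesis by (simp only: eq)
  qed
  define f where "f n l = b (- l) * (\<kappa> n * X (l - n))" for n l
  have bij: "bij (\<lambda>l::int. l - n)" for n by (rule bijI') (auto intro: exI[of _ "_ + n"])
  \<comment> \<open>Absolute summability of the double family, which justifies the interchange of
    the sums and the summability of \<open>b (- l) * V l\<close>.\<close>
  have "(\<lambda>(n, l). A * (norm (\<kappa> n) * norm (X (l - n)))) summable_on UNIV \<times> UNIV"
  proof (rule summable_on_SigmaI)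
    fix n
    have "((\<lambda>l. norm (X (l - n))) has_sum (\<Sum>\<^sub>\<infinity>l. norm (X l))) UNIV"
      using has_sum_infsum[OF X] has_sum_reindex_bij_betw[OF bij[of n], of "\<lambda>l. norm (X l)"] by simp
    then show "((\<lambda>l. case (n, l) of (n, l) \<Rightarrow> A * (norm (\<kappa> n) * norm (X (l - n)))) has_sum A * (norm (\<kappa> n) * (\<Sum>\<^sub>\<infinity>l. norm (X l)))) UNIV"
      unfolding prod.case by (intro has_sum_cmult_right)
    show "(\<lambda>n. A * (norm (\<kappa> n) * (\<Sum>\<^sub>\<infinity>l. norm (X l)))) summable_on UNIV"
      by (intro summable_on_cmult_right summable_on_cmult_left \<kappa>)
  qed (use A in auto)
  then have "(\<lambda>p. norm (case p of (n, l) \<Rightarrow> f n l)) summable_on UNIV \<times> UNIV"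
    by (rule summable_on_comparison_test) (auto simp: f_def norm_mult intro!: mult_right_mono b)
  then have sf: "(\<lambda>(n, l). f n l) summable_on UNIV \<times> UNIV" by (rule abs_summable_summable)
  \<comment> \<open>For fixed n the sum over l is the annihilation hypothesis at index - n, up to
    the factor \<open>\<kappa> n\<close>.\<close>
  have inner: "(\<Sum>\<^sub>\<infinity>l. f n l) = 0" for n
  proof -
    have "(\<Sum>\<^sub>\<infinity>l. f n l) = (\<Sum>\<^sub>\<infinity>l. \<kappa> n * (b (- l) * X (l - n)))" by (simp add: f_def mult_ac)
    also have "\<dots> = \<kappa> n * (\<Sum>\<^sub>\<infinity>l. b (- l) * X (l - n))" by (rule infsum_cmult_right')
    also have "(\<Sum>\<^sub>\<infinity>l. b (- l) * X (l - n)) = (\<Sum>\<^sub>\<infinity>l. b l * X (- n - l))"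
      using infsum_reindex_bij_betw[OF bij_uminus_int, of "\<lambda>l. b l * X (- n - l)"] by simp
    finally show ?thesis by (simp add: ann)
  qed
  have bV: "b (- l) * V l = (\<Sum>\<^sub>\<infinity>n. f n l)" for l
    unfolding V_def f_def by (rule infsum_cmult_right'[symmetric])
  have "(\<Sum>\<^sub>\<infinity>l. b (- l) * V l) = (\<Sum>\<^sub>\<infinity>n. \<Sum>\<^sub>\<infinity>l. f n l)"
    unfolding bV by (rule infsum_swap_banach[OF sf, symmetric])
  then have 0: "(\<Sum>\<^sub>\<infinity>l. b (- l) * V l) = 0" by (simp add: inner)
  have "(\<lambda>(l, n). f n l) summable_on UNIV \<times> UNIV"
    using sf by (subst summable_on_swap) (simp only: prod.case)
  from summable_on_Sigma_banach[OF this] have sV: "(\<lambda>l. b (- l) * V l) summable_on UNIV"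
    unfolding bV by simp
  have sk: "(\<lambda>l. b (- l) * \<kappa> l) summable_on UNIV"
  proof (rule abs_summable_summable, rule summable_on_comparison_test)
    show "(\<lambda>l. A * norm (\<kappa> l)) summable_on UNIV" by (intro summable_on_cmult_right \<kappa>)
  qed (auto simp: norm_mult intro!: mult_right_mono b)
  have "(\<Sum>\<^sub>\<infinity>l. b (- l) * (\<kappa> l - V l)) = (\<Sum>\<^sub>\<infinity>l. b (- l) * \<kappa> l + - (b (- l) * V l))"
    by (simp add: algebra_simps)
  also have "\<dots> = (\<Sum>\<^sub>\<infinity>l. b (- l) * \<kappa> l) + (\<Sum>\<^sub>\<infinity>l. - (b (- l) * V l))"
    by (rule infsum_add[OF sk]) (use sV in \<open>simp add: summable_on_uminus\<close>)
  finally show ?thesis by (simp add: fc 0 infsum_uminus)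
qed

text \<open>For |z| < 1 the kernel is a geometric series in \<open>z * cis (- \<theta>)\<close>, so
  \<kappa> sits at frequencies n <= 0; the reversal in the pairing brings out the coefficients of b
  at nonnegative indices.\<close>

lemma inner_cauchy_kernel:
  fixes z :: complex and b :: "int \<Rightarrow> complex"
  assumes z: "norm z < 1" and b: "\<And>l. norm (b l) \<le> A"
  shows "\<exists>\<kappa>. (\<lambda>n. norm (\<kappa> n)) summable_on UNIV \<and> (\<forall>\<theta>. trig_series \<kappa> \<theta> * (1 - z * cis (- \<theta>)) = 1) \<and>
    (\<lambda>n. b (int n) * z ^ n) sums (\<Sum>\<^sub>\<infinity>n. b (- n) * \<kappa> n)"
proof -
  define \<kappa> where "\<kappa> n = nonneg_ext (\<lambda>k. z ^ k) (- n)" for n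
  have sz: "summable (\<lambda>k. norm (z ^ k))" using z by (simp add: norm_power summable_geometric)
  have 1: "(\<lambda>n. norm (\<kappa> n)) summable_on UNIV"
    using summable_nonneg_ext[OF sz] summable_on_reindex_bij_betw[OF bij_uminus_int, of "\<lambda>n. norm (nonneg_ext (\<lambda>k. z ^ k) n)"]
    by (simp add: \<kappa>_def)
  have 2: "trig_series \<kappa> \<theta> * (1 - z * cis (- \<theta>)) = 1" for \<theta>
  proof -
    have w: "norm (z * cis (- \<theta>)) < 1" using z by (simp add: norm_mult)
    have "trig_series \<kappa> \<theta> = trig_series (nonneg_ext (\<lambda>k. z ^ k)) (- \<theta>)"
      using infsum_reindex_bij_betw[OF bij_uminus_int, of "\<lambda>n. nonneg_ext (\<lambda>k. z ^ k) n * cis (of_int n * (- \<theta>))"]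
      unfolding trig_series_def \<kappa>_def by simp
    moreover have "(\<lambda>n. (z * cis (- \<theta>)) ^ n) sums trig_series (nonneg_ext (\<lambda>k. z ^ k)) (- \<theta>)"
      using trig_series_nonneg_ext[OF sz, of "- \<theta>"] unfolding power_mult_distrib Complex.DeMoivre .
    ultimately have "trig_series \<kappa> \<theta> = 1 / (1 - z * cis (- \<theta>))"
      using geometric_sums[OF w] sums_unique2 by metis
    moreover have "1 - z * cis (- \<theta>) \<noteq> 0" using w by auto
    ultimately show ?thesis by simp
  qed
  have "(\<lambda>n. norm (b (- n) * \<kappa> n)) summable_on UNIV"
    by (rule summable_on_comparison_test[OF summable_on_cmult_right[OF 1, of A]])
       (auto simp: norm_mult intro!: mult_right_mono b)
  from has_sum_infsum[OF abs_summable_summable[OF this]]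
  have "((\<lambda>n. b n * nonneg_ext (\<lambda>k. z ^ k) n) has_sum (\<Sum>\<^sub>\<infinity>n. b (- n) * \<kappa> n)) UNIV"
    using has_sum_reindex_bij_betw[OF bij_uminus_int, of "\<lambda>n. b n * nonneg_ext (\<lambda>k. z ^ k) n"]
    by (simp add: \<kappa>_def)
  then have "((\<lambda>n::int. if n \<ge> 0 then b (int (nat n)) * z ^ nat n else 0) has_sum (\<Sum>\<^sub>\<infinity>n. b (- n) * \<kappa> n)) UNIV"
    by (rule has_sum_cong[THEN iffD1, rotated]) (auto simp: nonneg_ext_def)
  then have "(\<lambda>n. b (int n) * z ^ n) sums (\<Sum>\<^sub>\<infinity>n. b (- n) * \<kappa> n)"
    by (intro has_sum_imp_sums) (simp only: has_sum_int_nonneg[of "\<lambda>n. b (int n) * z ^ n"])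
  with 1 2 show ?thesis by (intro exI[of _ \<kappa>] conjI allI)
qed

text \<open>For |z| > 1 the same kernel is minus a geometric series in
  \<open>cis \<theta> / z\<close> without constant term. This is the source of the sign and of the
  range n < 0 in the exterior function.\<close>

lemma outer_cauchy_kernel:
  fixes z :: complex and b :: "int \<Rightarrow> complex"
  assumes z: "norm z > 1"
  shows "\<exists>\<kappa>. (\<lambda>n. norm (\<kappa> n)) summable_on UNIV \<and> (\<forall>\<theta>. trig_series \<kappa> \<theta> * (1 - z * cis (- \<theta>)) = 1) \<and>
    (\<Sum>\<^sub>\<infinity>n. b (- n) * \<kappa> n) = exterior_function b (Some z)"
proof -
  define e :: "nat \<Rightarrow> complex" where "e k = (if k = 0 then 0 else - ((1 / z) ^ k))" for k
  define \<kappa> where "\<kappa> = nonneg_ext e"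
  have z0: "z \<noteq> 0" using z by auto
  have nz: "norm (1 / z) < 1" using z by (simp add: norm_divide divide_less_eq)
  have se: "summable (\<lambda>k. norm (e k))"
  proof (rule summable_comparison_test)
    show "summable (\<lambda>k. norm (1 / z) ^ k)" using nz by (intro summable_geometric) simp
    show "\<exists>N. \<forall>n\<ge>N. norm (norm (e n)) \<le> norm (1 / z) ^ n" by (auto simp: e_def norm_power)
  qed
  have 1: "(\<lambda>n. norm (\<kappa> n)) summable_on UNIV" unfolding \<kappa>_def by (rule summable_nonneg_ext[OF se])
  have 2: "trig_series \<kappa> \<theta> * (1 - z * cis (- \<theta>)) = 1" for \<theta>
  proof -
    define w where "w = 1 / z * cis \<theta>"
    have w: "norm w < 1" using nz by (simp only: w_def norm_mult norm_cis mult_1_right)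
    have w1: "z * cis (- \<theta>) = 1 / w" using z0 by (simp add: w_def field_simps cis_mult)
    have w0: "w \<noteq> 0" using z0 by (simp add: w_def)
    \<comment> \<open>1 - 1 / (1 - w) equals 1 / (1 - 1 / w), and 1 / w is
      \<open>z * cis (- \<theta>)\<close>.\<close>
    have "(\<lambda>n. (if n = 0 then 1 else 0) - w ^ n) sums (1 - 1 / (1 - w))"
      by (intro sums_diff geometric_sums w sums_single)
    moreover have "w ^ n = (1 / z) ^ n * cis (of_nat n * \<theta>)" for n
      unfolding w_def power_mult_distrib Complex.DeMoivre ..
    then have "(\<lambda>n. (if n = 0 then 1 else 0) - w ^ n) = (\<lambda>n. e n * cis (of_nat n * \<theta>))"
      by (auto simp: fun_eq_iff e_def)
    ultimately have "trig_series \<kappa> \<theta> = 1 - 1 / (1 - w)"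
      using trig_series_nonneg_ext[OF se, of \<theta>] sums_unique2 unfolding \<kappa>_def by metis
    moreover have "1 - w \<noteq> 0" using w by auto
    ultimately show ?thesis using w0 unfolding w1 by (simp add: field_simps)
  qed
  have "(\<Sum>\<^sub>\<infinity>n. b (- n) * \<kappa> n) = (\<Sum>\<^sub>\<infinity>n. b n * \<kappa> (- n))"
    using infsum_reindex_bij_betw[OF bij_uminus_int, of "\<lambda>n. b n * \<kappa> (- n)"] by simp
  also have "\<dots> = (\<Sum>\<^sub>\<infinity>n\<in>{..<0}. - (b n * z powi n))"
    by (rule infsum_cong_neutral)
       (auto simp: \<kappa>_def nonneg_ext_def e_def power_int_def power_divide field_simps power_inverse)
  also have "\<dots> = exterior_function b (Some z)"
    using z by (simp add: exterior_function_def exterior_disk_def infsum_uminus)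
  finally show ?thesis using 1 2 by (intro exI[of _ \<kappa>] conjI allI)
qed

section \<open>Continuation across an arc\<close>

lemma cmod_cis_diff_power2: "(norm (cis x - cis t))\<^sup>2 = 2 - 2 * cos (x - t)"
proof -
  have "(norm (cis x - cis t))\<^sup>2 = ((cos x)\<^sup>2 + (sin x)\<^sup>2) + ((cos t)\<^sup>2 + (sin t)\<^sup>2) - 2 * (cos x * cos t + sin x * sin t)"
    by (simp only: cmod_power2 minus_complex.sel cis.sel power2_diff) algebra
  then show ?thesis by (simp add: cos_diff)
qed

lemma trig_series_power_series:
  assumes bps: "bounded_power_series g a" and r: "0 < r" "r < 1"
  shows "trig_series (nonneg_ext (\<lambda>k. a k * of_real r ^ k)) \<theta> = g (rcis r \<theta>)"
proof -
  obtain A where A: "\<And>k. norm (a k) \<le> A"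
    using bps by (auto simp: bounded_power_series_def bounded_iff)
  have "summable (\<lambda>k. norm (a k * of_real r ^ k))"
  proof (rule summable_comparison_test)
    show "summable (\<lambda>k. A * r ^ k)" using r by (intro summable_mult summable_geometric) auto
    show "\<exists>N. \<forall>n\<ge>N. norm (norm (a n * of_real r ^ n)) \<le> A * r ^ n"
      using A r by (auto simp: norm_mult norm_power intro!: mult_right_mono)
  qed
  from trig_series_nonneg_ext[OF this]
  have "(\<lambda>k. a k * of_real r ^ k * cis (of_nat k * \<theta>)) sums trig_series (nonneg_ext (\<lambda>k. a k * of_real r ^ k)) \<theta>" .
  moreover have "(rcis r \<theta>) ^ k = of_real r ^ k * cis (of_nat k * \<theta>)" for k
    unfolding rcis_def power_mult_distrib Complex.DeMoivre ..
  moreover have "(\<lambda>k. a k * rcis r \<theta> ^ k) sums g (rcis r \<theta>)"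
    using bps r by (simp add: bounded_power_series_def rcis_def norm_mult)
  ultimately show ?thesis by (simp add: mult.assoc sums_unique2)
qed

lemma continuous_on_circle:
  assumes "bounded_power_series g a" "0 < r" "r < 1"
  shows "continuous_on T (\<lambda>\<theta>. g (rcis r \<theta>))"
proof -
  have "continuous_on (ball 0 1) g"
    using assms(1) by (auto simp: bounded_power_series_def holomorphic_on_imp_continuous_on)
  then show ?thesis
    by (rule continuous_on_compose2)
       (use assms in \<open>auto simp: rcis_def norm_mult intro!: continuous_intros\<close>)
qed

text \<open>Passes from the Lebesgue integral over the arc to the gauge integral over a window. The
  support condition is confined to the window, since a periodic \<phi> reappears beyond it.\<close>

lemma local_integral_bound:
  fixes \<phi> :: "real \<Rightarrow> real" and g :: "real \<Rightarrow> complex"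
  assumes phi: "continuous_on UNIV \<phi>" "\<And>x. 0 \<le> \<phi> x" "\<And>x. \<phi> x \<le> 1"
    and supp: "\<And>x. x \<in> {a..b} \<Longrightarrow> x \<notin> {\<omega>1<..<\<omega>2} \<Longrightarrow> \<phi> x = 0" and g: "continuous_on UNIV g"
    and L: "(\<integral>\<^sup>+\<omega>\<in>{\<omega>1<..<\<omega>2}. ennreal (norm (g \<omega>)) \<partial>lborel) \<le> ennreal L" "0 \<le> L"
  shows "integral {a..b} (\<lambda>\<theta>. norm (of_real (\<phi> \<theta>) * g \<theta>)) \<le> L"
proof -
  let ?I = "integral {a..b} (\<lambda>\<theta>. norm (of_real (\<phi> \<theta>) * g \<theta>))"
  have "((\<lambda>\<theta>. norm (of_real (\<phi> \<theta>) * g \<theta>)) has_integral ?I) {a..b}"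
    by (intro integrable_integral integrable_continuous_interval continuous_intros
          continuous_on_subset[OF phi(1)] continuous_on_subset[OF g]) auto
  then have "ennreal ?I = (\<integral>\<^sup>+\<theta>. ennreal (norm (of_real (\<phi> \<theta>) * g \<theta>)) * indicator {a..b} \<theta> \<partial>lborel)"
    by (intro nn_integral_has_integral_lebesgue'[symmetric]) auto
  also have "\<dots> \<le> (\<integral>\<^sup>+\<omega>\<in>{\<omega>1<..<\<omega>2}. ennreal (norm (g \<omega>)) \<partial>lborel)"
  proof (rule nn_integral_mono)
    fix x
    have "norm (of_real (\<phi> x) * g x) \<le> norm (g x)"
      using phi(2,3)[of x] by (simp add: norm_mult mult_left_le_one_le)
    then show "ennreal (norm (of_real (\<phi> x) * g x)) * indicator {a..b} x \<le> ennreal (norm (g x)) * indicator {\<omega>1<..<\<omega>2} x"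
      using supp[of x] by (auto simp: indicator_def intro!: ennreal_leI)
  qed
  also have "\<dots> \<le> ennreal L" by (rule L)
  finally show ?thesis using L(2) by (simp add: ennreal_le_iff)
qed

lemma continuation_across_bounded_arc:
  assumes bps: "bounded_power_series g a" and rr: "renascent_right_limit a b"
    and w: "\<omega>1 < \<omega>2" and t: "t = (\<omega>1 + \<omega>2) / 2" and L0: "0 \<le> L"
    and L: "\<And>r. 0 < r \<Longrightarrow> r < 1 \<Longrightarrow>
      (\<integral>\<^sup>+\<omega>\<in>{\<omega>1<..<\<omega>2}. ennreal (norm (g (rcis r \<omega>))) \<partial>lborel) \<le> ennreal L"
  obtains \<eta> F where "0 < \<eta>" "F holomorphic_on ball (cis t) \<eta>"
    "\<And>z. z \<in> ball (cis t) \<eta> \<Longrightarrow> norm z < 1 \<Longrightarrow> F z = g z"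
    "\<And>z. z \<in> ball (cis t) \<eta> \<Longrightarrow> norm z > 1 \<Longrightarrow> F z = exterior_function b (Some z)"
proof -
  \<comment> \<open>Half the length of the interval keeps the support in the arc; the cap at pi
    keeps cos monotone on [0, d], also for intervals longer than a full turn.\<close>
  define d where "d = min ((\<omega>2 - \<omega>1) / 2) pi"
  have "d > 0" "d \<le> pi" using w by (auto simp: d_def)
  then have d: "0 < d / 2" "d / 2 < d" "d \<le> pi" by auto
  obtain \<phi>r :: "real \<Rightarrow> real" where phi: "periodic_Ck 4 \<phi>r" "\<And>x. 0 \<le> \<phi>r x" "\<And>x. \<phi>r x \<le> 1"
    "\<And>x. cos (x - t) \<ge> cos (d / 2) \<Longrightarrow> \<phi>r x = 1" "\<And>x. cos (x - t) \<le> cos d \<Longrightarrow> \<phi>r x = 0"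
    using periodic_bump[OF d, of t] by blast
  define \<phi> where "\<phi> x = complex_of_real (\<phi>r x)" for x
  have Cphi: "periodic_Ck 4 \<phi>" unfolding \<phi>_def by (rule periodic_Ck_of_real[OF phi(1)])
  have cphi: "continuous_on T \<phi>" for T by (rule periodic_Ck_continuous[OF Cphi])
  \<comment> \<open>Centring the window gives |x - t| <= pi, so that \<open>cos (x - t)\<close>
    measures the distance from t.\<close>
  define s where "s = t - pi"
  define X where "X = fourier_coeff s \<phi>"
  obtain K where K: "\<And>m. norm (X m) \<le> K / (1 + \<bar>real_of_int m\<bar>) ^ 4"
    using periodic_Ck4_fourier_decay[OF Cphi, of s] unfolding X_def by blast
  have K0: "K \<ge> 0" using order_trans[OF norm_ge_zero K[of 0]] by simp
  have sX: "(\<lambda>m. norm (X m)) summable_on UNIV"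
  proof (rule summable_on_comparison_test)
    show "(\<lambda>m. K * (1 / (1 + \<bar>real_of_int m\<bar>)\<^sup>2)) summable_on UNIV"
      by (intro summable_on_cmult_right summable_on_inverse_square)
    fix m
    have "(1 + \<bar>real_of_int m\<bar>)\<^sup>2 \<le> (1 + \<bar>real_of_int m\<bar>) ^ 4" by (rule power_increasing) auto
    then have "K / (1 + \<bar>real_of_int m\<bar>) ^ 4 \<le> K / (1 + \<bar>real_of_int m\<bar>)\<^sup>2"
      using K0 by (intro divide_left_mono) (auto intro!: mult_pos_pos zero_less_power add_pos_nonneg)
    then show "norm (X m) \<le> K * (1 / (1 + \<bar>real_of_int m\<bar>)\<^sup>2)" using K[of m] by simp
  qed auto
  obtain A where A: "\<And>k. norm (a k) \<le> A"
    using bps by (auto simp: bounded_power_series_def bounded_iff)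
  have rl: "right_limit a b" and ren: "\<And>n. b (int n) = a n"
    using rr by (auto simp: renascent_right_limit_def)
  note b = right_limit_bounded[OF rl A]
  have supp: "\<phi>r x = 0" if x: "x \<in> {s..s + 2*pi}" "x \<notin> {\<omega>1<..<\<omega>2}" for x
  proof (rule phi(5))
    have "\<bar>x - t\<bar> \<le> pi" using x(1) by (auto simp: s_def)
    moreover have "d \<le> \<bar>x - t\<bar>" using x(2) w unfolding d_def t by (auto simp: min_le_iff_disj field_simps abs_if)
    ultimately have "cos \<bar>x - t\<bar> \<le> cos d" using d by (intro cos_monotone_0_pi_le) auto
    then show "cos (x - t) \<le> cos d" by simp
  qed
  have bound: "integral {s..s + 2*pi} (\<lambda>\<theta>. norm (\<phi> \<theta> * trig_series (nonneg_ext (\<lambda>k. a k * of_real r ^ k)) \<theta>)) \<le> L"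
    if r: "0 < r" "r < 1" for r
    unfolding trig_series_power_series[OF bps r] \<phi>_def
    by (rule local_integral_bound[OF periodic_Ck_continuous[OF phi(1)] phi(2,3) supp continuous_on_circle[OF bps r] L[OF r] L0])
  have "(\<lambda>m::nat. \<Sum>\<^sub>\<infinity>k. nonneg_ext a k * X (int m - k)) \<longlonglongrightarrow> 0"
    unfolding X_def by (rule localized_coeffs_tendsto_0[OF A cphi K[unfolded X_def] bound])
  then have ann: "(\<Sum>\<^sub>\<infinity>l. b l * X (n - l)) = 0" for n
    by (rule right_limit_annihilates[OF rl A sX])
  define \<psi> where "\<psi> x = 1 + (- 1) * \<phi> x" for x
  have Cpsi4: "periodic_Ck (Suc (Suc 2)) \<psi>"
    unfolding \<psi>_def using Cphi by (intro periodic_Ck_add periodic_Ck_const periodic_Ck_mult) (simp add: eval_nat_numeral)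
  have Cpsi: "periodic_Ck 2 \<psi>" by (rule periodic_Ck_Suc_imp[OF periodic_Ck_Suc_imp[OF Cpsi4]])
  define G where "G = {x. cos (x - t) > cos (d / 2)}"
  have oG: "open G" unfolding G_def by (intro open_Collect_less continuous_intros)
  have psiG: "\<psi> x = 0" if "x \<in> G" for x using phi(4)[of x] that by (simp add: \<psi>_def \<phi>_def G_def)
  \<comment> \<open>The squared chord between \<open>cis t\<close> and
    \<open>cis (t + d / 2)\<close>. A ball of at most half that chord as radius \<eta> stays \<eta>
    away from every \<open>cis \<theta>\<close> with \<theta> outside \<open>G\<close>; \<eta> <= 1
    also yields |z| <= 2.\<close>
  define c where "c = 2 - 2 * cos (d / 2)"
  have c: "c > 0" using cos_monotone_0_pi[of 0 "d / 2"] d by (simp add: c_def)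
  define \<eta> where "\<eta> = min 1 (sqrt c / 2)"
  have eta: "0 < \<eta>" "\<eta> \<le> 1" "2 * \<eta> \<le> sqrt c" using c by (auto simp: \<eta>_def)
  have far: "\<eta> \<le> norm (1 - z * cis (- \<theta>))" if "z \<in> ball (cis t) \<eta>" "\<theta> \<notin> G" for z \<theta>
  proof -
    have "c \<le> (norm (cis \<theta> - cis t))\<^sup>2"
      unfolding cmod_cis_diff_power2 c_def using that(2) by (simp add: G_def)
    then have "sqrt c \<le> norm (cis \<theta> - cis t)" by (rule real_le_lsqrt[OF norm_ge_zero])
    also have "\<dots> \<le> norm (cis \<theta> - z) + norm (z - cis t)" using norm_triangle_ineq[of "cis \<theta> - z" "z - cis t"] by simp
    finally have "\<eta> \<le> norm (cis \<theta> - z)" using eta that(1) by (simp add: dist_norm norm_minus_commute)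
    also have "cis \<theta> - z = cis \<theta> * (1 - z * cis (- \<theta>))" by (simp add: algebra_simps cis_mult)
    finally show ?thesis by (simp add: norm_mult)
  qed
  have z2: "norm z \<le> 2" if "z \<in> ball (cis t) \<eta>" for z
    using that eta norm_triangle_ineq2[of z "cis t"] by (simp add: dist_norm norm_minus_commute)
  define C where "C z l = fourier_coeff s (\<lambda>\<theta>. \<psi> \<theta> / (1 - z * cis (- \<theta>))) l" for z l
  have "\<exists>M. \<forall>z\<in>ball (cis t) \<eta>. \<forall>l. norm (C z l) \<le> M / (1 + \<bar>real_of_int l\<bar>)\<^sup>2"
    unfolding C_def by (rule cutoff_kernel_coeff_decay[OF Cpsi oG psiG eta(1,2) far z2])
  then obtain M where "\<forall>z\<in>ball (cis t) \<eta>. \<forall>l. norm (C z l) \<le> M / (1 + \<bar>real_of_int l\<bar>)\<^sup>2" ..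
  then have M: "norm (C z l) \<le> M / (1 + \<bar>real_of_int l\<bar>)\<^sup>2" if "z \<in> ball (cis t) \<eta>" for z l
    using that by auto
  have hol: "(\<lambda>z. C z l) holomorphic_on ball (cis t) \<eta>" for l
    unfolding C_def
  proof (rule cutoff_kernel_coeff_holomorphic[OF periodic_Ck_continuous[OF Cpsi] oG psiG])
    show "1 - z * cis (- \<theta>) \<noteq> 0" if "z \<in> ball (cis t) \<eta>" "\<theta> \<notin> G" for z \<theta>
      using far[OF that] eta(1) by auto
  qed auto
  have half: "\<eta> / 2 < \<eta>" "ball (cis t) (\<eta> / 2) \<subseteq> ball (cis t) \<eta>" using eta by auto
  have Cphi_eq: "C z l = fourier_coeff s (\<lambda>\<theta>. (1 - \<phi> \<theta>) / (1 - z * cis (- \<theta>))) l" for z l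
    by (simp add: C_def \<psi>_def)
  show ?thesis
  \<comment> \<open>Half the radius, because \<open>holomorphic_on_pairing\<close> works on a closed
    ball inside the region of the coefficient bounds.\<close>
  proof (rule that[of "\<eta> / 2" "\<lambda>z. \<Sum>\<^sub>\<infinity>l. b (- l) * C z l"])
    show "0 < \<eta> / 2" using eta by simp
    show "(\<lambda>z. \<Sum>\<^sub>\<infinity>l. b (- l) * C z l) holomorphic_on ball (cis t) (\<eta> / 2)"
      by (rule holomorphic_on_pairing[OF b hol M half(1)])
    fix z assume z: "z \<in> ball (cis t) (\<eta> / 2)"
    show "(\<Sum>\<^sub>\<infinity>l. b (- l) * C z l) = g z" if z1: "norm z < 1"
    proof -
      obtain \<kappa> where \<kappa>: "(\<lambda>n. norm (\<kappa> n)) summable_on UNIV" "\<forall>\<theta>. trig_series \<kappa> \<theta> * (1 - z * cis (- \<theta>)) = 1"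
        "(\<lambda>n. b (int n) * z ^ n) sums (\<Sum>\<^sub>\<infinity>n. b (- n) * \<kappa> n)"
        using inner_cauchy_kernel[where b = b, OF z1 b] by blast
      have "(\<lambda>n. a n * z ^ n) sums g z" using bps z1 by (simp add: bounded_power_series_def)
      then have "(\<Sum>\<^sub>\<infinity>n. b (- n) * \<kappa> n) = g z" using \<kappa>(3) by (simp add: ren sums_unique2)
      then show ?thesis
        unfolding Cphi_eq using pairing_cutoff_kernel[where b = b, OF b cphi \<kappa>(1) sX[unfolded X_def] ann[unfolded X_def] \<kappa>(2)[rule_format]] by simp
    qed
    show "(\<Sum>\<^sub>\<infinity>l. b (- l) * C z l) = exterior_function b (Some z)" if z1: "norm z > 1"
    proof -
      obtain \<kappa> where \<kappa>: "(\<lambda>n. norm (\<kappa> n)) summable_on UNIV" "\<forall>\<theta>. trig_series \<kappa> \<theta> * (1 - z * cis (- \<theta>)) = 1"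
        "(\<Sum>\<^sub>\<infinity>n. b (- n) * \<kappa> n) = exterior_function b (Some z)"
        using outer_cauchy_kernel[OF z1, of b] by blast
      then show ?thesis
        unfolding Cphi_eq using pairing_cutoff_kernel[where b = b, OF b cphi \<kappa>(1) sX[unfolded X_def] ann[unfolded X_def] \<kappa>(2)[rule_format]] by simp
    qed
  qed
qed

text \<open>In the variable 1 / z the series is a power series with bounded coefficients and zero
  constant term.\<close>

lemma exterior_function_holomorphic:
  fixes b :: "int \<Rightarrow> complex"
  assumes b: "\<And>l. norm (b l) \<le> A"
  shows "(\<lambda>z. exterior_function b (Some z)) holomorphic_on - cball 0 1"
proof -
  define c :: "nat \<Rightarrow> complex" where "c n = (if n = 0 then 0 else - b (- int n))" for n
  define E where "E w = (\<Sum>n. c n * w ^ n)" for w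
  have abs: "summable (\<lambda>n. norm (c n * w ^ n))" if "norm w < 1" for w
  proof (rule summable_comparison_test)
    have A: "A \<ge> 0" by (rule order_trans[OF norm_ge_zero b[of 0]])
    show "summable (\<lambda>n. A * norm w ^ n)" using that by (intro summable_mult summable_geometric) simp
    show "\<exists>N. \<forall>n\<ge>N. norm (norm (c n * w ^ n)) \<le> A * norm w ^ n"
      using b A by (auto simp: c_def norm_mult norm_power intro!: mult_right_mono)
  qed
  have "E holomorphic_on ball 0 1"
  proof (rule power_series_holomorphic[of 0 1 c])
    fix w :: complex assume "w \<in> ball 0 1"
    then have "summable (\<lambda>n. c n * w ^ n)" by (intro summable_norm_cancel[OF abs]) simp
    then show "(\<lambda>n. c n * (w - 0) ^ n) sums E w" by (simp add: E_def summable_sums)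
  qed
  then have "(\<lambda>z. E (inverse z)) holomorphic_on - cball 0 1"
    by (intro holomorphic_on_compose_gen[of inverse _ E "ball 0 1", unfolded o_def] holomorphic_intros)
       (auto simp: norm_inverse inverse_less_1_iff)
  moreover have "E (inverse z) = exterior_function b (Some z)" if z: "z \<in> - cball 0 1" for z
  proof -
    have "((\<lambda>n. c n * inverse z ^ n) has_sum E (inverse z)) UNIV"
      unfolding E_def using z
      by (intro norm_summable_imp_has_sum abs summable_sums[OF summable_norm_cancel[OF abs]])
         (auto simp: norm_inverse inverse_less_1_iff)
    from has_sum_int_nonneg[THEN iffD2, OF this]
    have "((\<lambda>n::int. if - n \<ge> 0 then c (nat (- n)) * inverse z ^ nat (- n) else 0) has_sum E (inverse z)) UNIV"
      by (subst has_sum_reindex_bij_betw[OF bij_uminus_int, of "\<lambda>n. if n \<ge> 0 then c (nat n) * inverse z ^ nat n else 0"])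
    then have "E (inverse z) = (\<Sum>\<^sub>\<infinity>n::int. if - n \<ge> 0 then c (nat (- n)) * inverse z ^ nat (- n) else 0)"
      by (rule infsumI[symmetric])
    also have "\<dots> = (\<Sum>\<^sub>\<infinity>n\<in>{..<0}. - (b n * z powi n))"
      by (rule infsum_cong_neutral) (auto simp: c_def power_int_def)
    also have "\<dots> = exterior_function b (Some z)"
      using z by (simp add: exterior_function_def exterior_disk_def infsum_uminus)
    finally show ?thesis .
  qed
  ultimately show ?thesis by (rule holomorphic_transform)
qed

section \<open>Bounds from a given continuation, and the identity theorem\<close>

lemma set_nn_integral_le_interval:
  fixes f :: "real \<Rightarrow> real"
  assumes "\<And>x. x \<in> {a<..<b} \<Longrightarrow> f x \<le> M" "0 \<le> M" "a \<le> b"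
  shows "(\<integral>\<^sup>+x\<in>{a<..<b}. ennreal (f x) \<partial>lborel) \<le> ennreal (M * (b - a))"
proof -
  have "(\<integral>\<^sup>+x\<in>{a<..<b}. ennreal (f x) \<partial>lborel) \<le> (\<integral>\<^sup>+x. ennreal M * indicator {a<..<b} x \<partial>lborel)"
    by (rule nn_integral_mono) (use assms in \<open>auto simp: indicator_def intro: ennreal_leI\<close>)
  also have "\<dots> = ennreal M * emeasure lborel {a<..<b}" by (rule nn_integral_cmult_indicator) simp
  also have "\<dots> = ennreal (M * (b - a))" using assms by (simp add: ennreal_mult)
  finally show ?thesis .
qed

text \<open>The bound has to hold at every radius: close to the circle g equals f, which is bounded
  on a compact ball around \<open>cis t\<close>, and for radii up to \<open>r0\<close> compactness
  of a smaller disk suffices. The interval is centred at t, as the construction of the continuation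
  expects.\<close>

lemma local_integral_bound_of_continuation:
  assumes hg: "g holomorphic_on ball 0 1" and ac: "analytic_continuation_through g J U f" and t: "cis t \<in> J"
  obtains \<omega>1 \<omega>2 L where "\<omega>1 < \<omega>2" "t = (\<omega>1 + \<omega>2) / 2" "0 \<le> L"
    "\<And>r. 0 < r \<Longrightarrow> r < 1 \<Longrightarrow> (\<integral>\<^sup>+\<omega>\<in>{\<omega>1<..<\<omega>2}. ennreal (norm (g (rcis r \<omega>))) \<partial>lborel) \<le> ennreal L"
proof -
  have U: "open U" "cis t \<in> U" "f holomorphic_on U" "\<And>z. z \<in> U \<Longrightarrow> norm z < 1 \<Longrightarrow> f z = g z"
    using ac t by (auto simp: analytic_continuation_through_def)
  obtain e where e: "e > 0" "cball (cis t) e \<subseteq> U" using U open_contains_cball by blast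
  have "bounded (f ` cball (cis t) e)"
    by (intro compact_imp_bounded compact_continuous_image holomorphic_on_imp_continuous_on
          holomorphic_on_subset[OF U(3) e(2)]) auto
  then obtain M1 where M1: "\<forall>z\<in>cball (cis t) e. norm (f z) \<le> M1" by (auto simp: bounded_iff)
  define r0 where "r0 = 1 - e / 2"
  have "bounded (g ` cball 0 r0)"
    using e by (intro compact_imp_bounded compact_continuous_image holomorphic_on_imp_continuous_on
          holomorphic_on_subset[OF hg]) (auto simp: r0_def)
  then obtain M2 where M2: "\<forall>z\<in>cball 0 r0. norm (g z) \<le> M2" by (auto simp: bounded_iff)
  have "continuous_on UNIV (\<lambda>x. cis x)" by (intro continuous_intros)
  then have "isCont cis t" by (simp add: continuous_on_eq_continuous_at)
  then obtain \<delta> where \<delta>: "\<delta> > 0" "\<And>\<omega>. dist \<omega> t < \<delta> \<Longrightarrow> dist (cis \<omega>) (cis t) < e / 2"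
    unfolding continuous_at_eps_delta using e by (metis half_gt_zero)
  define M where "M = max 0 (max M1 M2)"
  have le: "norm (g (rcis r \<omega>)) \<le> M" if r: "0 < r" "r < 1" and \<omega>: "\<omega> \<in> {t - \<delta><..<t + \<delta>}" for r \<omega>
  proof (cases "r \<le> r0")
    case True
    then show ?thesis using M2[rule_format, of "rcis r \<omega>"] r by (auto simp: M_def le_max_iff_disj)
  next
    case False
    have "dist (cis \<omega>) (cis t) < e / 2" using \<omega> by (intro \<delta>) (auto simp: dist_real_def)
    moreover have "dist (rcis r \<omega>) (cis \<omega>) = 1 - r"
    proof -
      have "rcis r \<omega> - cis \<omega> = of_real (r - 1) * cis \<omega>" by (simp add: rcis_def algebra_simps)
      then show ?thesis unfolding dist_norm using r by (simp only: norm_mult norm_of_real norm_cis) simp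
    qed
    moreover have "1 - r < e / 2" using False by (simp add: r0_def)
    ultimately have "dist (rcis r \<omega>) (cis t) < e" using dist_triangle[of "rcis r \<omega>" "cis t" "cis \<omega>"] by linarith
    then have in_ball: "rcis r \<omega> \<in> cball (cis t) e" by (simp add: dist_commute)
    moreover have "norm (rcis r \<omega>) < 1" using r by simp
    ultimately show ?thesis using M1[rule_format, OF in_ball] U(4)[of "rcis r \<omega>"] e(2) by (auto simp: M_def le_max_iff_disj)
  qed
  show ?thesis
  proof (rule that[of "t - \<delta>" "t + \<delta>" "M * (t + \<delta> - (t - \<delta>))"])
    show "(\<integral>\<^sup>+\<omega>\<in>{t - \<delta><..<t + \<delta>}. ennreal (norm (g (rcis r \<omega>))) \<partial>lborel) \<le> ennreal (M * (t + \<delta> - (t - \<delta>)))"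
      if "0 < r" "r < 1" for r
      by (rule set_nn_integral_le_interval) (use le that \<delta> in \<open>auto simp: M_def\<close>)
    show "0 \<le> M * (t + \<delta> - (t - \<delta>))" using \<delta> by (simp add: M_def)
  qed (use \<delta> in auto)
qed

lemma ball_cis_Int_ball_nonempty:
  assumes "0 < \<eta>"
  shows "ball (cis t) \<eta> \<inter> ball 0 1 \<noteq> {}" "ball (cis t) \<eta> \<inter> - cball 0 1 \<noteq> {}"
proof -
  define \<epsilon> where "\<epsilon> = min (1/2) (\<eta> / 2)"
  have eps: "0 < \<epsilon>" "\<epsilon> < 1" "\<epsilon> < \<eta>" using assms by (auto simp: \<epsilon>_def)
  have dist: "norm (cis t - rcis (1 + c) t) = \<bar>c\<bar>" for c
  proof -
    have "cis t - rcis (1 + c) t = of_real (- c) * cis t" by (simp add: rcis_def algebra_simps)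
    then show ?thesis by (simp only: norm_mult norm_of_real norm_cis)
  qed
  have "rcis (1 + (- \<epsilon>)) t \<in> ball (cis t) \<eta> \<inter> ball 0 1" "rcis (1 + \<epsilon>) t \<in> ball (cis t) \<eta> \<inter> - cball 0 1"
    using eps dist[of \<epsilon>] dist[of "- \<epsilon>"] by (auto simp: dist_norm)
  then show "ball (cis t) \<eta> \<inter> ball 0 1 \<noteq> {}" "ball (cis t) \<eta> \<inter> - cball 0 1 \<noteq> {}" by auto
qed

text \<open>Any continuation f bounds g locally, so b produces its own continuation F across the
  same point. F and f agree inside the disk, hence on a whole ball, and F has the exterior
  values.\<close>

lemma continuation_eq_exterior_function:
  assumes bps: "bounded_power_series g a" and rr: "renascent_right_limit a b"
    and ac: "analytic_continuation_through g J U f" and p: "p \<in> J"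
  shows "\<exists>\<eta>>0. ball p \<eta> \<subseteq> U \<and> (\<forall>z\<in>ball p \<eta>. norm z > 1 \<longrightarrow> f z = exterior_function b (Some z))"
proof -
  obtain t where pt: "p = cis t" using ac p by (auto simp: analytic_continuation_through_def open_arc_def)
  have U: "open U" "cis t \<in> U" "f holomorphic_on U" "\<And>z. z \<in> U \<Longrightarrow> norm z < 1 \<Longrightarrow> f z = g z"
    using ac p by (auto simp: analytic_continuation_through_def pt)
  have hg: "g holomorphic_on ball 0 1" using bps by (simp add: bounded_power_series_def)
  obtain \<omega>1 \<omega>2 L where L: "\<omega>1 < \<omega>2" "t = (\<omega>1 + \<omega>2) / 2" "0 \<le> L"
    "\<And>r. 0 < r \<Longrightarrow> r < 1 \<Longrightarrow> (\<integral>\<^sup>+\<omega>\<in>{\<omega>1<..<\<omega>2}. ennreal (norm (g (rcis r \<omega>))) \<partial>lborel) \<le> ennreal L"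
    using local_integral_bound_of_continuation[OF hg ac p[unfolded pt]] by blast
  obtain \<eta>1 F where F: "0 < \<eta>1" "F holomorphic_on ball (cis t) \<eta>1"
    "\<And>z. z \<in> ball (cis t) \<eta>1 \<Longrightarrow> norm z < 1 \<Longrightarrow> F z = g z"
    "\<And>z. z \<in> ball (cis t) \<eta>1 \<Longrightarrow> norm z > 1 \<Longrightarrow> F z = exterior_function b (Some z)"
    using continuation_across_bounded_arc[OF bps rr L] by blast
  obtain \<eta>2 where \<eta>2: "\<eta>2 > 0" "ball (cis t) \<eta>2 \<subseteq> U" using U open_contains_ball by blast
  define \<eta> where "\<eta> = min \<eta>1 \<eta>2"
  have \<eta>: "\<eta> > 0" "ball (cis t) \<eta> \<subseteq> ball (cis t) \<eta>1" "ball (cis t) \<eta> \<subseteq> U"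
    using F(1) \<eta>2 by (auto simp: \<eta>_def)
  have "f z = F z" if "z \<in> ball (cis t) \<eta>" for z
  proof (rule analytic_continuation_open[where s = "ball (cis t) \<eta> \<inter> ball 0 1" and s' = "ball (cis t) \<eta>"
        and f = f and g = F and z = z])
    show "ball (cis t) \<eta> \<inter> ball 0 1 \<noteq> {}" by (rule ball_cis_Int_ball_nonempty[OF \<eta>(1)])
    show "f z = F z" if "z \<in> ball (cis t) \<eta> \<inter> ball 0 1" for z
      using U(4)[OF subsetD[OF \<eta>(3)]] F(3)[OF subsetD[OF \<eta>(2)]] that by auto
  qed (use that \<eta> holomorphic_on_subset[OF U(3)] holomorphic_on_subset[OF F(2)] in auto)
  then show ?thesis using \<eta> F(4) by (intro exI[of _ \<eta>]) (auto simp: pt)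
qed

lemma continuation_coincides_exterior_function:
  assumes bps: "bounded_power_series g a" and rr: "renascent_right_limit a b"
    and ac: "analytic_continuation_through g J U f"
  shows "continuation_coincides J U f (exterior_function b)"
proof -
  \<comment> \<open>The union of all admissible open sets spares a choice of radius for each point
    of \<open>J\<close>.\<close>
  define V where "V = \<Union>{B. open B \<and> B \<subseteq> U \<and> (\<forall>z\<in>B. norm z > 1 \<longrightarrow> f z = exterior_function b (Some z))}"
  have "p \<in> V" if p: "p \<in> J" for p
  proof -
    obtain \<eta> where "0 < \<eta>"
      "ball p \<eta> \<subseteq> U \<and> (\<forall>z\<in>ball p \<eta>. norm z > 1 \<longrightarrow> f z = exterior_function b (Some z))"
      using continuation_eq_exterior_function[OF bps rr ac p] by blast
    then show ?thesis unfolding V_def using centre_in_ball[of p \<eta>] by blast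
  qed
  moreover have "open V" "V \<subseteq> U" "\<forall>z\<in>V. Some z \<in> exterior_disk \<longrightarrow> f z = exterior_function b (Some z)"
    unfolding V_def by (auto simp: exterior_disk_def)
  ultimately show ?thesis unfolding continuation_coincides_def by blast
qed

text \<open>Both exterior functions equal the same f just outside one point of the arc, and the
  exterior of the disk is connected. At infinity both are 0 by definition.\<close>

lemma exterior_function_unique:
  assumes bps: "bounded_power_series g a1" "bounded_power_series g a2"
    and rr: "renascent_right_limit a1 b1" "renascent_right_limit a2 b2"
    and ac: "analytic_continuation_through g J U f"
  shows "exterior_function b1 = exterior_function b2"
proof -
  obtain \<omega>1 \<omega>2 where J: "\<omega>1 < \<omega>2" "J = cis ` {\<omega>1<..<\<omega>2}"
    using ac by (auto simp: analytic_continuation_through_def open_arc_def)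
  obtain t where "\<omega>1 < t" "t < \<omega>2" using dense[OF J(1)] by blast
  then have t: "cis t \<in> J" by (simp add: J(2))
  obtain \<eta>1 where \<eta>1: "0 < \<eta>1" "\<forall>z\<in>ball (cis t) \<eta>1. norm z > 1 \<longrightarrow> f z = exterior_function b1 (Some z)"
    using continuation_eq_exterior_function[OF bps(1) rr(1) ac t] by blast
  obtain \<eta>2 where \<eta>2: "0 < \<eta>2" "\<forall>z\<in>ball (cis t) \<eta>2. norm z > 1 \<longrightarrow> f z = exterior_function b2 (Some z)"
    using continuation_eq_exterior_function[OF bps(2) rr(2) ac t] by blast
  have hol: "(\<lambda>z. exterior_function b (Some z)) holomorphic_on - cball 0 1"
    if h: "bounded_power_series g a" "renascent_right_limit a b" for a b
  proof -
    obtain A where A: "\<And>k. norm (a k) \<le> A" using h(1) by (auto simp: bounded_power_series_def bounded_iff)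
    have "right_limit a b" using h(2) by (simp add: renascent_right_limit_def)
    from exterior_function_holomorphic[OF right_limit_bounded[OF this A]] show ?thesis .
  qed
  have eq: "exterior_function b1 (Some z) = exterior_function b2 (Some z)" if "norm z > 1" for z
  proof (rule analytic_continuation_open[of "ball (cis t) (min \<eta>1 \<eta>2) \<inter> - cball 0 1" "- cball 0 1"
        "\<lambda>z. exterior_function b1 (Some z)" "\<lambda>z. exterior_function b2 (Some z)"])
    show "ball (cis t) (min \<eta>1 \<eta>2) \<inter> - cball 0 1 \<noteq> {}"
      by (rule ball_cis_Int_ball_nonempty) (use \<eta>1 \<eta>2 in auto)
    show "connected (- cball (0::complex) 1)"
      by (rule connected_complement_bounded_convex) auto
    show "exterior_function b1 (Some z) = exterior_function b2 (Some z)"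
      if "z \<in> ball (cis t) (min \<eta>1 \<eta>2) \<inter> - cball 0 1" for z
      using \<eta>1(2)[rule_format, of z] \<eta>2(2)[rule_format, of z] that by auto
  qed (use that hol[OF bps(1) rr(1)] hol[OF bps(2) rr(2)] in auto)
  show ?thesis
  proof
    fix w
    show "exterior_function b1 w = exterior_function b2 w"
    proof (cases "w \<in> exterior_disk")
      case True
      then show ?thesis using eq by (cases w) (auto simp: exterior_disk_def exterior_function_def)
    qed (simp add: exterior_function_def)
  qed
qed

text \<open>A finite supremum over one interval supplies the bound; the ball obtained at its
  midpoint contains a short arc, by continuity of \<open>cis\<close>.\<close>

lemma continuation_of_not_strong_natural_boundary:
  assumes bps: "bounded_power_series g a" and rr: "renascent_right_limit a b"
    and nb: "\<not> strong_natural_boundary g"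
  shows "\<exists>J U f. analytic_continuation_through g J U f"
proof -
  obtain \<omega>1 \<omega>2 where w: "\<omega>1 < \<omega>2" and
    ne: "(SUP r\<in>{0<..<1}. \<integral>\<^sup>+\<omega>\<in>{\<omega>1<..<\<omega>2}. ennreal (norm (g (rcis r \<omega>))) \<partial>lborel) \<noteq> \<infinity>"
    using nb by (auto simp: strong_natural_boundary_def)
  obtain L where L: "0 \<le> L" "(SUP r\<in>{0<..<1}. \<integral>\<^sup>+\<omega>\<in>{\<omega>1<..<\<omega>2}. ennreal (norm (g (rcis r \<omega>))) \<partial>lborel) = ennreal L"
    using ne by (cases "SUP r\<in>{0<..<1::real}. \<integral>\<^sup>+\<omega>\<in>{\<omega>1<..<\<omega>2}. ennreal (norm (g (rcis r \<omega>))) \<partial>lborel" rule: ennreal_cases) auto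
  have le: "(\<integral>\<^sup>+\<omega>\<in>{\<omega>1<..<\<omega>2}. ennreal (norm (g (rcis r \<omega>))) \<partial>lborel) \<le> ennreal L" if "0 < r" "r < 1" for r
    unfolding L(2)[symmetric] by (rule SUP_upper) (use that in auto)
  define t where "t = (\<omega>1 + \<omega>2) / 2"
  obtain \<eta> F where F: "0 < \<eta>" "F holomorphic_on ball (cis t) \<eta>"
    "\<And>z. z \<in> ball (cis t) \<eta> \<Longrightarrow> norm z < 1 \<Longrightarrow> F z = g z"
    using continuation_across_bounded_arc[OF bps rr w t_def L(1) le] by metis
  have "continuous_on UNIV (\<lambda>x. cis x)" by (intro continuous_intros)
  then have "isCont cis t" by (simp add: continuous_on_eq_continuous_at)
  then obtain \<delta> where \<delta>: "\<delta> > 0" "\<And>\<omega>. dist \<omega> t < \<delta> \<Longrightarrow> dist (cis \<omega>) (cis t) < \<eta>"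
    unfolding continuous_at_eps_delta using F(1) by metis
  have "analytic_continuation_through g (cis ` {t - \<delta><..<t + \<delta>}) (ball (cis t) \<eta>) F"
    unfolding analytic_continuation_through_def
  proof (intro conjI)
    show "open_arc (cis ` {t - \<delta><..<t + \<delta>})"
      unfolding open_arc_def using \<delta>(1) by (intro exI[of _ "t - \<delta>"] exI[of _ "t + \<delta>"]) auto
    show "cis ` {t - \<delta><..<t + \<delta>} \<subseteq> ball (cis t) \<eta>"
      using \<delta>(2) by (auto simp: dist_commute dist_real_def)
  qed (use F in auto)
  then show ?thesis by blast
qed

text \<open>Inside the disk both functions equal g, outside both equal h, and points of the circle
  are limits of interior points.\<close>

lemma continuations_match_of_coincide:
  assumes ac: "analytic_continuation_through g J1 U1 f1" "analytic_continuation_through g J2 U2 f2"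
    and co: "continuation_coincides J1 U1 f1 h" "continuation_coincides J2 U2 f2 h"
  shows "continuations_match J1 U1 f1 J2 U2 f2"
proof -
  obtain V1 where V1: "open V1" "J1 \<subseteq> V1" "V1 \<subseteq> U1" "\<And>z. z \<in> V1 \<Longrightarrow> norm z > 1 \<Longrightarrow> f1 z = h (Some z)"
    using co(1) by (auto simp: continuation_coincides_def exterior_disk_def)
  obtain V2 where V2: "open V2" "J2 \<subseteq> V2" "V2 \<subseteq> U2" "\<And>z. z \<in> V2 \<Longrightarrow> norm z > 1 \<Longrightarrow> f2 z = h (Some z)"
    using co(2) by (auto simp: continuation_coincides_def exterior_disk_def)
  have inside: "f1 z = f2 z" if "z \<in> V1 \<inter> V2" "norm z < 1" for z
  proof -
    have "z \<in> U1 \<inter> ball 0 1" "z \<in> U2 \<inter> ball 0 1" using that V1(3) V2(3) by auto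
    then show ?thesis using ac by (simp add: analytic_continuation_through_def)
  qed
  have "f1 z = f2 z" if z: "z \<in> V1 \<inter> V2" for z
  proof (cases "norm z" "1 :: real" rule: linorder_cases)
    case equal
    have c: "isCont f1 z" "isCont f2 z"
    proof -
      have "isCont f z" if "f holomorphic_on U" "open U" "z \<in> U" for f U
        using holomorphic_on_imp_continuous_on[OF that(1)] that by (simp add: continuous_on_eq_continuous_at)
      then show "isCont f1 z" "isCont f2 z"
        using ac z V1(3) V2(3) by (auto simp: analytic_continuation_through_def)
    qed
    \<comment> \<open>Radial approach from inside; the points lie in \<open>V1 \<inter> V2\<close>
      eventually, which suffices for the limit.\<close>
    define x where "x n = of_real (1 - 1 / real (n + 2)) * z" for n
    have "(\<lambda>n. of_real (1 - 1 / real (n + 2)) * z) \<longlonglongrightarrow> of_real 1 * z"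
      by (intro tendsto_mult tendsto_of_real radii_limit tendsto_const)
    then have x: "x \<longlonglongrightarrow> z" by (simp add: x_def[abs_def])
    have nx: "norm (x n) < 1" for n
    proof -
      have "\<bar>1 - 1 / real (n + 2)\<bar> < 1" by (auto simp: abs_if field_simps)
      then show ?thesis using equal unfolding x_def norm_mult norm_of_real by simp
    qed
    have "\<forall>\<^sub>F n in sequentially. x n \<in> V1 \<inter> V2"
      using V1(1) V2(1) z by (intro topological_tendstoD[OF x]) auto
    then have "\<forall>\<^sub>F n in sequentially. f1 (x n) = f2 (x n)"
      by (rule eventually_mono) (use inside nx in blast)
    then have "(\<lambda>n. f2 (x n)) \<longlonglongrightarrow> f1 z"
      by (rule Lim_transform_eventually[OF isCont_tendsto_compose[OF c(1) x]])
    with isCont_tendsto_compose[OF c(2) x] show ?thesis by (rule LIMSEQ_unique[rotated])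
  qed (use inside z V1(4) V2(4) in auto)
  then show ?thesis unfolding continuations_match_def using V1 V2 by blast
qed

theorem proposition2p7:
  fixes g :: "complex \<Rightarrow> complex"
  assumes "rrl_continuable g"
  shows
    "((\<exists>J U f. analytic_continuation_through g J U f) \<or> strong_natural_boundary g) \<and>
     ((\<exists>J U f. analytic_continuation_through g J U f) \<longrightarrow>
        uniquely_rrl_continuable g \<and>
        (\<forall>J1 U1 f1 J2 U2 f2.
           analytic_continuation_through g J1 U1 f1 \<and> analytic_continuation_through g J2 U2 f2 \<longrightarrow>
           continuations_match J1 U1 f1 J2 U2 f2) \<and>
        (\<forall>h\<in>rrl_continuations g. \<forall>J U f.
           analytic_continuation_through g J U f \<longrightarrow> continuation_coincides J U f h)) \<and>
     (polygenous g \<longrightarrow> strong_natural_boundary g)"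
proof -
  obtain a b where ab: "bounded_power_series g a" "renascent_right_limit a b"
    using assms by (auto simp: rrl_continuable_def)
  have in_rrl: "exterior_function b \<in> rrl_continuations g"
    using ab by (auto simp: rrl_continuations_def)
  have 1: "(\<exists>J U f. analytic_continuation_through g J U f) \<or> strong_natural_boundary g"
    using continuation_of_not_strong_natural_boundary[OF ab] by blast
  have unique: "h1 = h2" if ex: "\<exists>J U f. analytic_continuation_through g J U f"
      and h1: "h1 \<in> rrl_continuations g" and h2: "h2 \<in> rrl_continuations g" for h1 h2
  proof -
    obtain J U f where ac: "analytic_continuation_through g J U f" using ex by blast
    obtain a1 b1 where 1: "h1 = exterior_function b1" "bounded_power_series g a1" "renascent_right_limit a1 b1"
      using h1 by (auto simp: rrl_continuations_def)
    obtain a2 b2 where 2: "h2 = exterior_function b2" "bounded_power_series g a2" "renascent_right_limit a2 b2"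
      using h2 by (auto simp: rrl_continuations_def)
    show ?thesis unfolding 1(1) 2(1) by (rule exterior_function_unique[OF 1(2) 2(2) 1(3) 2(3) ac])
  qed
  have coincide: "continuation_coincides J U f h"
    if "h \<in> rrl_continuations g" "analytic_continuation_through g J U f" for h J U f
    using that continuation_coincides_exterior_function by (auto simp: rrl_continuations_def)
  have match: "continuations_match J1 U1 f1 J2 U2 f2"
    if "analytic_continuation_through g J1 U1 f1" "analytic_continuation_through g J2 U2 f2" for J1 U1 f1 J2 U2 f2
    using continuations_match_of_coincide[OF that coincide[OF in_rrl that(1)] coincide[OF in_rrl that(2)]] .
  have uniq: "uniquely_rrl_continuable g" if "\<exists>J U f. analytic_continuation_through g J U f"
    unfolding uniquely_rrl_continuable_def using assms in_rrl unique[OF that] by blast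
  have poly: "strong_natural_boundary g" if "polygenous g"
  \<comment> \<open>Otherwise the dichotomy \<open>1\<close> yields a continuation through some arc,
    and that forces all rrl-continuations to coincide.\<close>
  proof (rule ccontr)
    assume "\<not> strong_natural_boundary g"
    then have "\<exists>J U f. analytic_continuation_through g J U f" using 1 by blast
    then show False using that unique unfolding polygenous_def by blast
  qed
  show ?thesis by (intro conjI 1 impI allI ballI uniq coincide poly) (auto intro: match)
qed

end
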